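(* Assume that $\mu_{X_n}$ converges almost surely weakly to a non-random compactly supported probability measure $\mu_X$, that the largest singular value of $X_n$ converges almost surely to $b:=\sup\operatorname{supp}\mu_X$, and that $\nu$ has mean zero, variance one and satisfies a log-Sobolev inequality. Let $\widetilde X_n=X_n+P_n$, with $P_n$ built according to either the i.i.d. model or the orthonormalized model. Then, as $n\to\infty$ (with $n/m_n\to c$), for each fixed $1\le i\le r$, $$\sigma_i(\widetilde X_n)\xrightarrow{\ \mathrm{a.s.}\ }\begin{cases}D_{\mu_X}^{-1}(1/\theta_i^2)&\text{if }\theta_i>\overline\theta,\\ b&\text{otherwise.}\end{cases}$$ Moreover, for each fixed $i>r$, $\sigma_i(\widetilde X_n)\to b$ almost surely.
   Context: Let $\mathbb K=\mathbb R$ or $\mathbb C$. For each $n$, let $m=m_n\ge n$ be an integer, with $n/m_n\to c\in[0,1]$ as $n\to\infty$. $X_n$ is an $n\times m$ random matrix with entries in $\mathbb K$. The singular values of an $n\times m$ matrix $M$ are written $\sigma_1(M)\ge\cdots\ge\sigma_n(M)$, and $\mu_{X_n}=\frac1n\sum_{i=1}^n\delta_{\sigma_i(X_n)}$. Perturbation. Fix $r\ge1$ and deterministic $\theta_1\ge\cdots\ge\theta_r>0$, independent of $n$. Let $\nu$ be a probability measure on $\mathbb K$. For every $n$ let $G_u^{(n)}$ ($n\times r$) and $G_v^{(n)}$ ($m\times r$) be two independent matrices with i.i.d. entries of law $\nu$; the families $(G_u^{(n)},G_v^{(n)})_n$ and $(X_n)_n$ are independent. Column vectors $u_1,\dots,u_r\in\mathbb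 K^{n\times1}$, $v_1,\dots,v_r\in\mathbb K^{m\times1}$ are obtained in one of two ways. i.i.d. model: $u_i$, $v_i$ are the $i$-th columns of $\frac1{\sqrt n}G_u^{(n)}$, $\frac1{\sqrt m}G_v^{(n)}$. Orthonormalized model: the $u_i$'s (resp. $v_i$'s) result from Gram-Schmidt orthonormalization of the columns of $G_u^{(n)}$ (resp. $G_v^{(n)}$), which is well defined with probability tending to one. Set $P_n=\sum_{i=1}^r\theta_iu_iv_i^*$ and $\widetilde X_n=X_n+P_n$. Log-Sobolev inequality: there is a constant $C>0$ such that $\int f^2\log\frac{f^2}{\int f^2d\nu}\,d\nu\le 2C\int|\nabla f|^2d\nu$ for all continuously differentiable $f\in L^2(\nu)$ (with $\mathbb C$ identified with $\mathbb R^2$). For $z>b$, $$D_{\mu_X}(z)=\Big[\int\frac{z}{z^2-t^2}d\mu_X(t)\Big]\times\Big[c\int\frac{z}{z^2-t^2}d\mu_X(t)+\frac{1-c}{z}\Big].$$ $D_{\mu_X}^{-1}$ is its functional inverse on $[b,+\infty)$, $D_{\mu_X}(b^+)=\lim_{z\downarrow b}D_{\mu_X}(z)$, and $\overline\theta=(D_{\mu_X}(b^+))^{-1/2}$ with the convention $(+\infty)^{-1/2}=0$. *)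

theory Defs
  imports
    "HOL-Probability.Probability"
    "HOL-Computational_Algebra.Computational_Algebra"
    "Jordan_Normal_Form.Schur_Decomposition"
    "Jordan_Normal_Form.DL_Rank"
begin

text \<open>
  Matrices are complex matrices of explicit size. The field \<open>K\<close> is the set \<open>\<real>\<close> or \<open>UNIV\<close> of
  complex numbers, so a real matrix is a complex matrix with entries in \<open>\<real>\<close>, and a measure on
  \<open>K\<close> is a Borel measure on the complex numbers that is carried by \<open>K\<close>.
\<close>

text \<open>
  For an \<open>n \<times> m\<close> matrix with \<open>n \<le> m\<close>, the numbers \<open>\<sigma>\<^sub>1 \<ge> \<dots> \<ge> \<sigma>\<^sub>n\<close> are the square roots of the
  eigenvalues of \<open>A A\<^sup>*\<close>, counted with algebraic multiplicity. Indices start at 1; the value is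
  of no significance outside \<open>{1..n}\<close>.
\<close>

definition singular_value :: "complex mat \<Rightarrow> nat \<Rightarrow> real" where
  "singular_value A i =
     sqrt (rev (sorted_list_of_multiset
                  (image_mset Re (proots (char_poly (A * mat_adjoint A))))) ! (i - 1))"

definition singular_value_distribution :: "complex mat \<Rightarrow> real measure" where
  "singular_value_distribution A =
     distr (uniform_count_measure {1..dim_row A}) borel (singular_value A)"

definition measure_support :: "'a::topological_space measure \<Rightarrow> 'a set" where
  "measure_support \<mu> = {x. \<forall>U. open U \<and> x \<in> U \<longrightarrow> emeasure \<mu> U > 0}"

definition random_matrix ::
  "'w measure \<Rightarrow> complex set \<Rightarrow> nat \<Rightarrow> nat \<Rightarrow> ('w \<Rightarrow> complex mat) \<Rightarrow> bool" where
  "random_matrix M K n m A \<longleftrightarrow>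
     (\<forall>\<omega>\<in>space M. A \<omega> \<in> carrier_mat n m) \<and>
     (\<forall>i<n. \<forall>j<m. (\<lambda>\<omega>. A \<omega> $$ (i, j)) \<in> borel_measurable M \<and>
                   (\<forall>\<omega>\<in>space M. A \<omega> $$ (i, j) \<in> K))"

text \<open>
  The positions of the entries of a pair of matrices of sizes \<open>n \<times> r\<close> and \<open>m \<times> r\<close>, and the entry
  at such a position.
\<close>

definition pair_index :: "nat \<Rightarrow> nat \<Rightarrow> nat \<Rightarrow> (nat \<times> nat + nat \<times> nat) set" where
  "pair_index n m r = ({..<n} \<times> {..<r}) <+> ({..<m} \<times> {..<r})"

definition pair_entry :: "complex mat \<Rightarrow> complex mat \<Rightarrow> nat \<times> nat + nat \<times> nat \<Rightarrow> complex" where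
  "pair_entry A B = case_sum (\<lambda>p. A $$ p) (\<lambda>p. B $$ p)"

text \<open>
  Two independent matrices with i.i.d. entries of law \<open>\<nu>\<close>, that is: all the entries of both
  matrices together form an i.i.d. family.
\<close>

definition iid_matrix_pair ::
  "'w measure \<Rightarrow> complex measure \<Rightarrow> nat \<Rightarrow> nat \<Rightarrow> nat \<Rightarrow>
   ('w \<Rightarrow> complex mat) \<Rightarrow> ('w \<Rightarrow> complex mat) \<Rightarrow> bool" where
  "iid_matrix_pair M \<nu> n m r A B \<longleftrightarrow>
     prob_space.indep_vars M (\<lambda>_. borel) (\<lambda>p \<omega>. pair_entry (A \<omega>) (B \<omega>) p) (pair_index n m r) \<and>
     (\<forall>p\<in>pair_index n m r. distr M borel (\<lambda>\<omega>. pair_entry (A \<omega>) (B \<omega>) p) = \<nu>)"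

text \<open>
  Independence of the whole sequence \<open>(X n)\<^sub>n\<close> of \<open>n \<times> m n\<close> matrices from the whole sequence
  \<open>(A n, B n)\<^sub>n\<close> of pairs of matrices of sizes \<open>n \<times> r\<close> and \<open>m n \<times> r\<close>, that is, of the \<open>\<sigma>\<close>-algebras that the
  entries generate.
\<close>

definition indep_families ::
  "'w measure \<Rightarrow> (nat \<Rightarrow> nat) \<Rightarrow> nat \<Rightarrow> (nat \<Rightarrow> 'w \<Rightarrow> complex mat) \<Rightarrow>
   (nat \<Rightarrow> 'w \<Rightarrow> complex mat) \<Rightarrow> (nat \<Rightarrow> 'w \<Rightarrow> complex mat) \<Rightarrow> bool" where
  "indep_families M m r X A B \<longleftrightarrow>
     (let I = (SIGMA n:UNIV. {..<n} \<times> {..<m n});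
          J = (SIGMA n:UNIV. pair_index n (m n) r)
      in prob_space.indep_set M
           (sets (vimage_algebra (space M)
                    (\<lambda>\<omega>. restrict (\<lambda>(n, p). X n \<omega> $$ p) I) (PiM I (\<lambda>_. borel))))
           (sets (vimage_algebra (space M)
                    (\<lambda>\<omega>. restrict (\<lambda>(n, p). pair_entry (A n \<omega>) (B n \<omega>) p) J)
                    (PiM J (\<lambda>_. borel)))))"

text \<open>
  \<open>g\<close> is the gradient of \<open>f\<close>. If \<open>\<integral>\<bar>\<nabla>f\<bar>\<^sup>2 d\<nu> = \<infinity>\<close> the inequality holds trivially. Otherwise it forces
  the entropy on the left, which always exists in \<open>(-\<infinity>, \<infinity>]\<close>, to be finite; integrability has to be
  said explicitly because the Bochner integral of a non-integrable function is 0. The value of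
  \<open>ln 0\<close> plays no role because of the factor \<open>f\<^sup>2\<close>.
\<close>

definition log_sobolev :: "'a::euclidean_space measure \<Rightarrow> bool" where
  "log_sobolev \<nu> \<longleftrightarrow>
     (\<exists>C>0. \<forall>(f::'a \<Rightarrow> real) g.
        (\<forall>x. GDERIV f x :> g x) \<and> continuous_on UNIV g \<and>
        integrable \<nu> (\<lambda>x. (f x)\<^sup>2) \<and> integrable \<nu> (\<lambda>x. (norm (g x))\<^sup>2) \<longrightarrow>
        integrable \<nu> (\<lambda>x. (f x)\<^sup>2 * ln ((f x)\<^sup>2 / (\<integral>y. (f y)\<^sup>2 \<partial>\<nu>))) \<and>
        (\<integral>x. (f x)\<^sup>2 * ln ((f x)\<^sup>2 / (\<integral>y. (f y)\<^sup>2 \<partial>\<nu>)) \<partial>\<nu>)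
          \<le> 2 * C * (\<integral>x. (norm (g x))\<^sup>2 \<partial>\<nu>))"

text \<open>For \<open>K = \<real>\<close> the test functions live on the real line, otherwise on the plane.\<close>

definition log_sobolev_on :: "complex set \<Rightarrow> complex measure \<Rightarrow> bool" where
  "log_sobolev_on K \<nu> \<longleftrightarrow>
     (if K = \<real> then log_sobolev (distr \<nu> borel Re) else log_sobolev \<nu>)"

text \<open>
  In both models the \<open>i\<close>-th vector, \<open>1 \<le> i \<le> r\<close>, comes from the column with 0-based index \<open>i - 1\<close>.
\<close>

definition iid_model :: "nat \<Rightarrow> nat \<Rightarrow> complex mat \<Rightarrow> (nat \<Rightarrow> complex vec) \<Rightarrow> bool" where
  "iid_model n r G u \<longleftrightarrow>
     (\<forall>i\<in>{1..r}. u i = complex_of_real (1 / sqrt (real n)) \<cdot>\<^sub>v col G (i - 1))"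

definition normalize_vec :: "complex vec \<Rightarrow> complex vec" where
  "normalize_vec w =
     complex_of_real (1 / L2_set (\<lambda>j. cmod (w $ j)) {..<dim_vec w}) \<cdot>\<^sub>v w"

text \<open>
  \<open>gram_schmidt\<close> orthogonalizes without normalizing. Gram-Schmidt orthonormalization is well
  defined when the \<open>r\<close> columns are linearly independent; nothing but the dimension of the vectors
  is prescribed otherwise.
\<close>

definition orthonormalized_model ::
  "nat \<Rightarrow> nat \<Rightarrow> complex mat \<Rightarrow> (nat \<Rightarrow> complex vec) \<Rightarrow> bool" where
  "orthonormalized_model n r G u \<longleftrightarrow>
     (\<forall>i\<in>{1..r}. u i \<in> carrier_vec n) \<and>
     (vec_space.rank n G = r \<longrightarrow>
        (\<forall>i\<in>{1..r}. u i = normalize_vec (gram_schmidt n (cols G) ! (i - 1))))"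

text \<open>The matrix \<open>\<Sum>\<^sub>i \<theta>\<^sub>i u\<^sub>i v\<^sub>i\<^sup>*\<close>, entry by entry.\<close>

definition perturbation ::
  "nat \<Rightarrow> nat \<Rightarrow> nat \<Rightarrow> (nat \<Rightarrow> real) \<Rightarrow> (nat \<Rightarrow> complex vec) \<Rightarrow> (nat \<Rightarrow> complex vec) \<Rightarrow>
   complex mat" where
  "perturbation n m r \<theta> u v =
     Matrix.mat n m (\<lambda>(j, k). \<Sum>i=1..r. complex_of_real (\<theta> i) * (u i $ j) * cnj (v i $ k))"

definition D_transform :: "real \<Rightarrow> real measure \<Rightarrow> real \<Rightarrow> real" where
  "D_transform c \<mu> z =
     (\<integral>t. z / (z\<^sup>2 - t\<^sup>2) \<partial>\<mu>) * (c * (\<integral>t. z / (z\<^sup>2 - t\<^sup>2) \<partial>\<mu>) + (1 - c) / z)"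

text \<open>The limit at \<open>b\<^sup>+\<close> may be infinite.\<close>

definition D_right :: "real \<Rightarrow> real measure \<Rightarrow> real \<Rightarrow> ereal" where
  "D_right c \<mu> b = Lim (at_right b) (\<lambda>z. ereal (D_transform c \<mu> z))"

text \<open>The functional inverse on \<open>[b, \<infinity>)\<close>, where the value at \<open>b\<close> is the limit at \<open>b\<^sup>+\<close>.\<close>

definition D_inverse :: "real \<Rightarrow> real measure \<Rightarrow> real \<Rightarrow> real \<Rightarrow> real" where
  "D_inverse c \<mu> b y =
     the_inv_into {b..}
       (\<lambda>z. if z = b then D_right c \<mu> b else ereal (D_transform c \<mu> z)) (ereal y)"

definition theta_bar :: "real \<Rightarrow> real measure \<Rightarrow> real \<Rightarrow> real" where
  "theta_bar c \<mu> b =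
     (if D_right c \<mu> b = \<infinity> then 0 else real_of_ereal (D_right c \<mu> b) powr (- 1 / 2))"

end

theory Submission
  imports Defs
begin

text \<open>
  Write \<open>A = X + \<Sum>\<^sub>i \<theta>\<^sub>i u\<^sub>i v\<^sub>i\<^sup>*\<close>. By Courant-Fischer, locating \<open>\<sigma>\<^sub>i(A)\<close> relative to \<open>z > b\<close> amounts to finding
  the signs of the form \<open>\<bar>A\<^sup>* x\<bar>\<^sup>2 - z\<^sup>2 \<bar>x\<bar>\<^sup>2\<close>, which differs from the negative definite form of \<open>X X\<^sup>* - z\<^sup>2\<close>
  by terms in \<open>\<langle>x, u\<^sub>i\<rangle>\<close> and \<open>\<langle>x, X v\<^sub>i\<rangle>\<close> only. Let \<open>R = (z\<^sup>2 - X X\<^sup>*)\<^sup>-\<^sup>1\<close>. Almost surely the Gram matrix of the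
  vectors \<open>u\<^sub>i\<close>, \<open>X v\<^sub>i\<close> with respect to \<open>R\<close> tends to a diagonal matrix, with entries \<open>\<alpha> = \<integral> 1/(z\<^sup>2 - t\<^sup>2) d\<mu>\<close> and
  \<open>\<beta> = c \<integral> t\<^sup>2/(z\<^sup>2 - t\<^sup>2) d\<mu>\<close>, and completing squares shows that \<open>\<theta>\<^sub>i\<^sup>2 \<alpha> (1 + \<beta>) = \<theta>\<^sub>i\<^sup>2 D(z)\<close> being above or
  below 1 decides the sign. Instead of \<open>R\<close> one uses truncations of its power series, so that only the forms
  \<open>\<langle>(X X\<^sup>*)\<^sup>k \<cdot>, \<cdot>\<rangle>\<close> have to converge. They do by a fourth moment bound and summability, since the log-Sobolev
  inequality gives \<open>\<nu>\<close> moments of order 8. Gram-Schmidt changes the vectors by a matrix that tends to the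
  identity. The lower bound \<open>b\<close> for the other singular values is interlacing.
\<close>

section \<open>Linear algebra on functions\<close>

text \<open>Signs of a form, rather than zeros of a determinant, locate the singular values, so no
  analytic functions of z occur and singular values never have to be matched with roots. The two
  directions differ: a lower bound needs enough good test vectors, while an upper bound must control
  every vector satisfying the constraints, hence the completed square. Because the limiting Gram
  matrix is diagonal, the problem decouples into one scalar condition for each \<theta>. The
  truncation order N is fixed first, from limits in N of the limiting forms, and only then n tends
  to infinity; so for each z finitely many forms are involved.

  The moment order has the following origin. The squared Frobenius norms of the coefficients are of
  order 1/n, so second moments of the centred forms would only be O(1/n), which is not summable,
  whereas fourth moments are O(1/n^2). The fourth power of a quadratic form contains eighth powers
  of single entries.\<close>

text \<open>A vector of \<open>\<complex>\<^sup>n\<close> is a function on the natural numbers that vanishes from \<open>n\<close> on, so that the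
  dimension, which varies along the sequences below, is not part of the type. \<open>gram X n m\<close> is \<open>X X\<^sup>*\<close>.\<close>

definition vecs :: "nat \<Rightarrow> (nat \<Rightarrow> complex) set" where
  "vecs n = {x. \<forall>j\<ge>n. x j = 0}"

definition ip :: "nat \<Rightarrow> (nat \<Rightarrow> complex) \<Rightarrow> (nat \<Rightarrow> complex) \<Rightarrow> complex" where
  "ip n x y = (\<Sum>j<n. x j * cnj (y j))"

definition nsq :: "nat \<Rightarrow> (nat \<Rightarrow> complex) \<Rightarrow> real" where
  "nsq n x = (\<Sum>j<n. (cmod (x j))\<^sup>2)"

definition lc :: "nat \<Rightarrow> (nat \<Rightarrow> complex) \<Rightarrow> (nat \<Rightarrow> nat \<Rightarrow> complex) \<Rightarrow> nat \<Rightarrow> complex" where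
  "lc k c w = (\<lambda>j. \<Sum>l<k. c l * w l j)"

definition mulv :: "(nat \<Rightarrow> nat \<Rightarrow> complex) \<Rightarrow> nat \<Rightarrow> (nat \<Rightarrow> complex) \<Rightarrow> nat \<Rightarrow> complex" where
  "mulv X m y = (\<lambda>j. \<Sum>k<m. X j k * y k)"

definition adjv :: "(nat \<Rightarrow> nat \<Rightarrow> complex) \<Rightarrow> nat \<Rightarrow> (nat \<Rightarrow> complex) \<Rightarrow> nat \<Rightarrow> complex" where
  "adjv X n x = (\<lambda>k. \<Sum>j<n. cnj (X j k) * x j)"

definition gram :: "(nat \<Rightarrow> nat \<Rightarrow> complex) \<Rightarrow> nat \<Rightarrow> nat \<Rightarrow> (nat \<Rightarrow> complex) \<Rightarrow> nat \<Rightarrow> complex" where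
  "gram X n m x = mulv X m (adjv X n x)"

definition kern :: "nat \<Rightarrow> nat \<Rightarrow> (nat \<Rightarrow> nat \<Rightarrow> complex) \<Rightarrow> bool" where
  "kern n m X \<longleftrightarrow> (\<forall>j k. n \<le> j \<or> m \<le> k \<longrightarrow> X j k = 0)"

definition entries :: "complex mat \<Rightarrow> nat \<Rightarrow> nat \<Rightarrow> complex" where
  "entries A = (\<lambda>j k. if j < dim_row A \<and> k < dim_col A then A $$ (j, k) else 0)"

lemma ip_self: "ip n x x = complex_of_real (nsq n x)"
  by (simp add: ip_def nsq_def complex_norm_square[symmetric])

lemma nsq_nonneg [simp]: "0 \<le> nsq n x"
  by (simp add: nsq_def sum_nonneg)

lemma cnj_ip: "cnj (ip n x y) = ip n y x"
  by (simp add: ip_def mult.commute)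

lemma ip_add_left: "ip n (\<lambda>j. x j + y j) z = ip n x z + ip n y z"
  by (simp add: ip_def algebra_simps sum.distrib)

lemma ip_diff_left: "ip n (\<lambda>j. x j - y j) z = ip n x z - ip n y z"
  by (simp add: ip_def algebra_simps sum_subtractf)

lemma ip_diff_right: "ip n z (\<lambda>j. x j - y j) = ip n z x - ip n z y"
  by (simp add: ip_def algebra_simps sum_subtractf)

lemma ip_add_right: "ip n z (\<lambda>j. x j + y j) = ip n z x + ip n z y"
  by (simp add: ip_def algebra_simps sum.distrib)

lemma ip_scale_left: "ip n (\<lambda>j. a * x j) z = a * ip n x z"
  by (simp add: ip_def sum_distrib_left mult_ac)

lemma ip_scale_right: "ip n z (\<lambda>j. a * x j) = cnj a * ip n z x"
  by (simp add: ip_def sum_distrib_left mult_ac)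

lemma ip_lc_left: "ip n (lc k c w) y = (\<Sum>l<k. c l * ip n (w l) y)"
  unfolding ip_def lc_def sum_distrib_right sum_distrib_left
  by (subst sum.swap) (simp add: mult_ac)

lemma ip_lc_right: "ip n y (lc k c w) = (\<Sum>l<k. cnj (c l) * ip n y (w l))"
  by (subst cnj_ip[symmetric], subst ip_lc_left) (simp add: cnj_ip)

lemma nsq_scale: "nsq n (\<lambda>j. a * x j) = (cmod a)\<^sup>2 * nsq n x"
  by (simp add: nsq_def norm_mult power_mult_distrib sum_distrib_left)

lemma nsq_eq_0D:
  assumes "x \<in> vecs n" "nsq n x = 0"
  shows "x = (\<lambda>j. 0)"
proof
  fix j
  have "\<forall>i<n. x i = 0"
    using assms(2) unfolding nsq_def by (subst (asm) sum_nonneg_eq_0_iff) auto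
  then show "x j = 0" using assms(1) by (cases "j < n") (auto simp: vecs_def)
qed

lemma lc_in_vecs: "(\<And>l. l < k \<Longrightarrow> w l \<in> vecs n) \<Longrightarrow> lc k c w \<in> vecs n"
  by (simp add: vecs_def lc_def)

lemma vecs_add: "x \<in> vecs n \<Longrightarrow> y \<in> vecs n \<Longrightarrow> (\<lambda>j. x j + y j) \<in> vecs n"
  by (simp add: vecs_def)

lemma vecs_diff: "x \<in> vecs n \<Longrightarrow> y \<in> vecs n \<Longrightarrow> (\<lambda>j. x j - y j) \<in> vecs n"
  by (simp add: vecs_def)

lemma vecs_scale: "x \<in> vecs n \<Longrightarrow> (\<lambda>j. a * x j) \<in> vecs n"
  by (simp add: vecs_def)

lemma adjv_lc: "adjv X n (lc k c w) = lc k c (\<lambda>l. adjv X n (w l))"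
  unfolding adjv_def lc_def sum_distrib_left
  by (rule ext, subst sum.swap) (simp add: mult_ac)

lemma mulv_lc: "mulv X m (lc k c w) = lc k c (\<lambda>l. mulv X m (w l))"
  unfolding mulv_def lc_def sum_distrib_left
  by (rule ext, subst sum.swap) (simp add: mult_ac)

lemma gram_lc: "gram X n m (lc k c w) = lc k c (\<lambda>l. gram X n m (w l))"
  by (simp add: gram_def adjv_lc mulv_lc)

lemma gram_pow_lc: "(gram X n m ^^ p) (lc k c w) = lc k c (\<lambda>l. (gram X n m ^^ p) (w l))"
  by (induction p) (simp_all add: gram_lc)

lemma mulv_in_vecs: "kern n m X \<Longrightarrow> mulv X m y \<in> vecs n"
  by (simp add: kern_def mulv_def vecs_def)

lemma gram_in_vecs: "kern n m X \<Longrightarrow> gram X n m y \<in> vecs n"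
  by (simp add: gram_def mulv_in_vecs)

lemma gram_pow_in_vecs: "kern n m X \<Longrightarrow> y \<in> vecs n \<Longrightarrow> (gram X n m ^^ p) y \<in> vecs n"
  by (cases p) (simp_all add: gram_in_vecs)

lemma ip_mulv: "ip n (mulv X m y) x = ip m y (adjv X n x)"
  unfolding ip_def mulv_def adjv_def sum_distrib_right cnj_sum sum_distrib_left
  by (subst sum.swap) (simp add: mult_ac)

lemma ip_adjv: "ip m (adjv X n x) y = ip n x (mulv X m y)"
  by (metis cnj_ip ip_mulv)

lemma ip_gram: "ip n (gram X n m x) y = ip m (adjv X n x) (adjv X n y)"
  by (simp add: gram_def ip_mulv)

lemma ip_gram_right: "ip n x (gram X n m y) = ip m (adjv X n x) (adjv X n y)"
  by (simp add: gram_def ip_adjv)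

lemma ip_gram_swap: "ip n (gram X n m x) y = ip n x (gram X n m y)"
  by (simp add: ip_gram ip_gram_right)

lemma ip_gram_pow_swap: "ip n ((gram X n m ^^ p) x) y = ip n x ((gram X n m ^^ p) y)"
proof (induction p arbitrary: x)
  case (Suc p)
  have "ip n ((gram X n m ^^ Suc p) x) y = ip n ((gram X n m ^^ p) (gram X n m x)) y"
    by (simp add: funpow_swap1)
  also have "\<dots> = ip n x (gram X n m ((gram X n m ^^ p) y))"
    by (simp add: Suc ip_gram_swap)
  finally show ?case by simp
qed simp

text \<open>The \<open>k\<close> equations are padded with zero rows to a square system of size
  \<open>p\<close>, whose determinant vanishes by expansion along the zero row \<open>k\<close>.
  This is the dimension count behind the arguments with subspaces and constraints below.\<close>

lemma nontrivial_combination: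
  fixes f :: "nat \<Rightarrow> nat \<Rightarrow> complex"
  assumes "k < p"
  shows "\<exists>c. (\<exists>l<p. c l \<noteq> 0) \<and> (\<forall>i<k. (\<Sum>l<p. c l * f l i) = 0)"
proof -
  define A where "A = Matrix.mat p p (\<lambda>(i, l). if i < k then f l i else 0)"
  have A: "A \<in> carrier_mat p p" by (simp add: A_def)
  have "Determinant.det A = (\<Sum>j<p. A $$ (k, j) * cofactor A k j)"
    by (rule laplace_expansion_row[OF A assms])
  also have "\<dots> = 0" using assms by (simp add: A_def)
  finally obtain v where v: "v \<in> carrier_vec p" "v \<noteq> 0\<^sub>v p" "A *\<^sub>v v = 0\<^sub>v p"
    using det_0_iff_vec_prod_zero_field[OF A] by blast
  have "\<exists>l<p. v $ l \<noteq> 0" using v(1,2) by (metis carrier_vecD eq_vecI index_zero_vec)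
  moreover have "(\<Sum>l<p. v $ l * f l i) = 0" if "i < k" for i
  proof -
    have "(A *\<^sub>v v) $ i = 0" using v(3) that assms by simp
    then show ?thesis using that assms v(1)
      by (simp add: A_def scalar_prod_def lessThan_atLeast0 mult.commute)
  qed
  ultimately show ?thesis by (intro exI[of _ "\<lambda>l. v $ l"]) simp
qed

section \<open>Orthonormal systems and the spectral theorem\<close>

definition orthonormal :: "nat \<Rightarrow> nat \<Rightarrow> (nat \<Rightarrow> nat \<Rightarrow> complex) \<Rightarrow> bool" where
  "orthonormal n k e \<longleftrightarrow> (\<forall>i<k. e i \<in> vecs n) \<and>
     (\<forall>i<k. \<forall>j<k. ip n (e i) (e j) = (if i = j then 1 else 0))"

lemma orthonormalD:
  assumes "orthonormal n k e"
  shows "i < k \<Longrightarrow> e i \<in> vecs n"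
    and "i < k \<Longrightarrow> j < k \<Longrightarrow> ip n (e i) (e j) = (if i = j then 1 else 0)"
  using assms by (auto simp: orthonormal_def)

lemma ip_lc_orthonormal:
  assumes "orthonormal n k e" "i < k"
  shows "ip n (lc k c e) (e i) = c i"
proof -
  have "ip n (lc k c e) (e i) = (\<Sum>l<k. if l = i then c l else 0)"
    unfolding ip_lc_left using assms by (intro sum.cong) (auto simp: orthonormalD(2))
  then show ?thesis using assms(2) by simp
qed

text \<open>The remainder \<open>y\<close> is orthogonal to every \<open>e i\<close>. Together with
  it there are \<open>n + 1\<close> vectors with \<open>n\<close> coordinates, hence a linear
  relation; pairing it with \<open>e i\<close> kills the coefficient of \<open>e i\<close>, so the
  coefficient of \<open>y\<close> is nonzero and \<open>y\<close> vanishes.\<close>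

lemma orthonormal_expansion:
  assumes e: "orthonormal n n e" and x: "x \<in> vecs n"
  shows "lc n (\<lambda>i. ip n x (e i)) e = x"
proof -
  define y where "y = (\<lambda>j. x j - lc n (\<lambda>i. ip n x (e i)) e j)"
  have y: "y \<in> vecs n"
    unfolding y_def using e x by (intro vecs_diff lc_in_vecs) (auto simp: orthonormalD)
  have ye: "ip n y (e i) = 0" if "i < n" for i
    unfolding y_def ip_diff_left using ip_lc_orthonormal[OF e that] by simp
  obtain c where c: "\<exists>l<Suc n. c l \<noteq> 0"
      "\<And>i. i < n \<Longrightarrow> (\<Sum>l<Suc n. c l * (if l < n then e l i else y i)) = 0"
    using nontrivial_combination[of n "Suc n" "\<lambda>l i. if l < n then e l i else y i"] by auto
  define w where "w = (\<lambda>j. lc n c e j + c n * y j)"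
  have w0: "w j = 0" for j
  proof (cases "j < n")
    case True
    then show ?thesis using c(2)[OF True] by (simp add: w_def lc_def)
  next
    case False
    then show ?thesis using y e by (simp add: w_def lc_def vecs_def orthonormal_def)
  qed
  have ci: "c i = 0" if "i < n" for i
  proof -
    have "ip n w (e i) = c i"
      unfolding w_def ip_add_left ip_scale_left using ip_lc_orthonormal[OF e that] ye[OF that] by simp
    moreover have "ip n w (e i) = 0" by (simp add: ip_def w0)
    ultimately show ?thesis by simp
  qed
  then have cn: "c n \<noteq> 0" using c(1) less_Suc_eq by auto
  have "y j = 0" for j
    using w0[of j] cn ci by (simp add: w_def lc_def)
  then show ?thesis unfolding y_def by (simp add: fun_eq_iff)
qed

lemma Parseval:
  assumes "orthonormal n n e" "x \<in> vecs n"
  shows "ip n x y = (\<Sum>i<n. ip n x (e i) * cnj (ip n y (e i)))"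
  by (subst orthonormal_expansion[OF assms, symmetric], subst ip_lc_left) (simp add: cnj_ip)

lemma Parseval_nsq:
  assumes "orthonormal n n e" "x \<in> vecs n"
  shows "nsq n x = (\<Sum>i<n. (cmod (ip n x (e i)))\<^sup>2)"
proof -
  have "complex_of_real (nsq n x) = complex_of_real (\<Sum>i<n. (cmod (ip n x (e i)))\<^sup>2)"
    using Parseval[OF assms, of x] by (simp add: ip_self complex_norm_square[symmetric])
  then show ?thesis using of_real_eq_iff by blast
qed

text \<open>Gram-Schmidt applied to the columns of \<open>P\<close> in Schur's triangularization \<open>A = P B P\<^sup>-\<^sup>1\<close> yields
  eigenvectors when \<open>A\<close> is Hermitian; the rows of \<open>P\<^sup>-\<^sup>1\<close> (the functionals \<open>q\<close>) show that no vector
  of the process vanishes.\<close>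

lemma hermitian_orthonormal_eigenbasis:
  fixes A :: "complex mat"
  assumes A: "A \<in> carrier_mat n n"
    and herm: "\<And>i j. i < n \<Longrightarrow> j < n \<Longrightarrow> A $$ (i, j) = cnj (A $$ (j, i))"
    and cp: "char_poly A = (\<Prod>a\<leftarrow>es. [:- a, 1:])"
  shows "\<exists>e. orthonormal n n e \<and> (\<forall>i<n. mulv (entries A) n (e i) = (\<lambda>j. es ! i * e i j))"
proof -
  obtain B P Q where BPQ: "schur_decomposition A es = (B, P, Q)"
    by (metis prod_cases3)
  from schur_decomposition[OF A cp BPQ]
  have sim: "similar_mat_wit A B P Q" and ut: "upper_triangular B" and dg: "diag_mat B = es" by auto
  from similar_mat_witD2[OF A sim]
  have QP: "Q * P = 1\<^sub>m n" and APQ: "A = P * B * Q"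
    and B: "B \<in> carrier_mat n n" and P: "P \<in> carrier_mat n n" and Q: "Q \<in> carrier_mat n n" by auto
  have AP: "A * P = P * B"
    using B P Q QP unfolding APQ by (simp add: assoc_mult_mat[of _ n n _ n _ n])
  define T where "T = mulv (entries A) n"
  define p where "p = (\<lambda>l a. entries P a l)"
  define q where "q = (\<lambda>k x. \<Sum>a<n. Q $$ (k, a) * x a)" for k and x :: "nat \<Rightarrow> complex"
  have T_lc: "T (lc k c w) = lc k c (\<lambda>l. T (w l))" for k c w
    by (simp add: T_def mulv_lc)
  have T_diff: "T (\<lambda>j. x j - y j) = (\<lambda>j. T x j - T y j)" for x y
    by (simp add: T_def mulv_def algebra_simps sum_subtractf)
  have T_scale: "T (\<lambda>j. a * x j) = (\<lambda>j. a * T x j)" for a x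
    by (simp add: T_def mulv_def algebra_simps sum_distrib_left)
  have T_swap: "ip n (T x) y = ip n x (T y)" for x y
  proof -
    have "adjv (entries A) n y j = T y j" if "j < n" for j
      unfolding adjv_def T_def mulv_def using that A
      by (intro sum.cong refl) (simp add: entries_def herm[of _ j])
    then show ?thesis unfolding T_def ip_mulv by (simp add: ip_def T_def)
  qed
  have Tp: "T (p l) = lc (Suc l) (\<lambda>i. B $$ (i, l)) p" if l: "l < n" for l
  proof
    fix a
    show "T (p l) a = lc (Suc l) (\<lambda>i. B $$ (i, l)) p a"
    proof (cases "a < n")
      case a: True
      have "T (p l) a = (A * P) $$ (a, l)"
        using a l A P by (simp add: T_def mulv_def p_def entries_def scalar_prod_def lessThan_atLeast0)
      also have "\<dots> = (\<Sum>i<n. P $$ (a, i) * B $$ (i, l))"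
        unfolding AP using a l B P by (simp add: scalar_prod_def lessThan_atLeast0)
      also have "\<dots> = (\<Sum>i<Suc l. P $$ (a, i) * B $$ (i, l))"
        using upper_triangularD[OF ut, of l] B l by (intro sum.mono_neutral_right) (auto simp: not_less)
      finally show ?thesis using a l P by (simp add: lc_def p_def entries_def mult.commute)
    next
      case False
      then show ?thesis using A P by (simp add: T_def mulv_def p_def entries_def lc_def)
    qed
  qed
  have qp: "q k (p l) = (if k = l then 1 else 0)" if "k < n" "l < n" for k l
  proof -
    have "q k (p l) = (Q * P) $$ (k, l)"
      using that P Q by (simp add: q_def p_def entries_def scalar_prod_def lessThan_atLeast0)
    then show ?thesis using that by (simp add: QP)
  qed
  have q_lc: "q k (lc h c w) = (\<Sum>l<h. c l * q k (w l))" for k h c w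
    unfolding q_def lc_def sum_distrib_left by (subst sum.swap) (simp add: mult_ac)
  have q_diff: "q k (\<lambda>j. x j - y j) = q k x - q k y" for k x y
    by (simp add: q_def algebra_simps sum_subtractf)
  have q_scale: "q k (\<lambda>j. a * x j) = a * q k x" for k a x
    by (simp add: q_def algebra_simps sum_distrib_left)
  have pv: "p l \<in> vecs n" for l using P by (simp add: p_def vecs_def entries_def)
  \<comment> \<open>Besides the eigenvectors the induction carries the expansions of the earlier
    columns, which turn the triangular relation \<open>Tp\<close> into one between
    \<open>T y\<close> and the \<open>e l\<close>, and the zeros of \<open>q h\<close>, which keep
    the next \<open>y\<close> nonzero.\<close>
  have "\<exists>e. orthonormal n k e \<and> (\<forall>i<k. T (e i) = (\<lambda>j. es ! i * e i j)) \<and>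
      (\<forall>l<k. \<exists>d. p l = lc k d e) \<and> (\<forall>l<k. \<forall>h. k \<le> h \<and> h < n \<longrightarrow> q h (e l) = 0)" if "k \<le> n" for k
    using that
  proof (induction k)
    case 0
    then show ?case by (auto simp: orthonormal_def)
  next
    case (Suc k)
    then have k: "k < n" by simp
    from Suc obtain e d where e: "orthonormal n k e" and Te: "\<And>i. i < k \<Longrightarrow> T (e i) = (\<lambda>j. es ! i * e i j)"
      and pd: "\<And>l. l < k \<Longrightarrow> p l = lc k (d l) e"
      and qe: "\<And>l h. l < k \<Longrightarrow> k \<le> h \<Longrightarrow> h < n \<Longrightarrow> q h (e l) = 0"
      by (metis Suc_leD)
    define c where "c = (\<lambda>l. ip n (p k) (e l))"
    define y where "y = (\<lambda>j. p k j - lc k c e j)"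
    have yv: "y \<in> vecs n"
      unfolding y_def using pv e by (intro vecs_diff lc_in_vecs) (auto simp: orthonormalD)
    have ye: "ip n y (e i) = 0" if "i < k" for i
      unfolding y_def ip_diff_left using ip_lc_orthonormal[OF e that] by (simp add: c_def)
    have qy: "q h y = (if h = k then 1 else 0)" if "k \<le> h" "h < n" for h
      unfolding y_def q_diff q_lc using qe that k by (auto simp: qp)
    have "y \<noteq> (\<lambda>j. 0)" using qy[of k] k by (auto simp: q_def)
    then have ny: "nsq n y > 0"
      using nsq_eq_0D[OF yv] nsq_nonneg[of n y] by linarith
    define g where "g = (\<lambda>l. (\<Sum>i<k. B $$ (i, k) * d i l) + es ! k * c l - c l * es ! l)"
    have esk: "es ! k = B $$ (k, k)" using dg B k by (auto simp: diag_mat_def)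
    have Ty: "T y j = es ! k * y j + lc k g e j" for j
    proof -
      have s1: "(\<Sum>i<k. B $$ (i, k) * p i j) = lc k (\<lambda>l. \<Sum>i<k. B $$ (i, k) * d i l) e j"
      proof -
        have "(\<Sum>i<k. B $$ (i, k) * p i j) = (\<Sum>i<k. B $$ (i, k) * lc k (d i) e j)"
          using pd by simp
        also have "\<dots> = lc k (\<lambda>l. \<Sum>i<k. B $$ (i, k) * d i l) e j"
          unfolding lc_def sum_distrib_left sum_distrib_right
          by (subst sum.swap) (simp add: mult_ac)
        finally show ?thesis .
      qed
      have s2: "lc k c (\<lambda>l. T (e l)) j = lc k (\<lambda>l. c l * es ! l) e j"
        unfolding lc_def by (intro sum.cong refl) (simp add: Te)
      have "T y j = T (p k) j - lc k c (\<lambda>l. T (e l)) j"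
        unfolding y_def T_diff T_lc ..
      also have "T (p k) j = (\<Sum>i<k. B $$ (i, k) * p i j) + es ! k * p k j"
        unfolding Tp[OF k] lc_def by (simp add: esk)
      finally show ?thesis unfolding s1 s2
        by (simp add: y_def g_def lc_def algebra_simps sum.distrib sum_subtractf sum_distrib_left)
    qed
    \<comment> \<open>By symmetry of \<open>T\<close> the orthogonal complement of the eigenvectors
      found so far is invariant: both \<open>y\<close> and \<open>T y\<close> are orthogonal to
      \<open>e i\<close>, so their combination \<open>lc k g e\<close> has no component
      there.\<close>
    have g0: "g i = 0" if i: "i < k" for i
    proof -
      have "ip n (T y) (e i) = ip n y (T (e i))" by (rule T_swap)
      also have "\<dots> = 0" using ye[OF i] by (simp add: Te[OF i] ip_scale_right)
      finally have "ip n (\<lambda>j. es ! k * y j + lc k g e j) (e i) = 0"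
        by (simp add: Ty[abs_def, symmetric])
      then show ?thesis
        unfolding ip_add_left ip_scale_left using ip_lc_orthonormal[OF e i] ye[OF i] by simp
    qed
    define a where "a = complex_of_real (1 / sqrt (nsq n y))"
    have a0: "a \<noteq> 0" and a2: "cmod a ^ 2 * nsq n y = 1"
      using ny by (auto simp: a_def power_divide norm_divide)
    define f where "f = e(k := (\<lambda>j. a * y j))"
    have fk: "f k = (\<lambda>j. a * y j)" and fl: "\<And>l. l < k \<Longrightarrow> f l = e l" by (simp_all add: f_def)
    have of: "orthonormal n (Suc k) f"
    proof -
      have 1: "ip n (f k) (f k) = 1"
        unfolding fk ip_self nsq_scale a2 by simp
      have 2: "ip n (f k) (f i) = 0" if "i < k" for i
        using ye[OF that] by (simp add: fk fl[OF that] ip_scale_left)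
      then have 3: "ip n (f i) (f k) = 0" if "i < k" for i
        using that by (metis cnj_ip complex_cnj_zero)
      show ?thesis unfolding orthonormal_def
        using e 1 2 3 yv by (auto simp: less_Suc_eq fl fk vecs_scale orthonormalD)
    qed
    have lcf: "lc (Suc k) b f = (\<lambda>j. lc k b e j + b k * (a * y j))" for b
      unfolding lc_def by (simp add: fk fl)
    have Tf: "T (f i) = (\<lambda>j. es ! i * f i j)" if "i < Suc k" for i
    proof (cases "i = k")
      case True
      have "lc k g e = (\<lambda>j. 0)" by (simp add: lc_def g0)
      then show ?thesis unfolding True fk T_scale Ty by (simp add: mult_ac)
    next
      case False
      then show ?thesis using that Te by (simp add: fl)
    qed
    have "\<exists>b. p l = lc (Suc k) b f" if "l < Suc k" for l
    proof (cases "l = k")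
      case True
      have "p k = lc (Suc k) (c(k := 1 / a)) f"
        unfolding lcf using a0 by (auto simp: y_def lc_def fun_eq_iff)
      then show ?thesis using True by blast
    next
      case False
      then have "p l = lc (Suc k) ((d l)(k := 0)) f"
        unfolding lcf using that pd by (auto simp: lc_def fun_eq_iff)
      then show ?thesis by blast
    qed
    moreover have "q h (f l) = 0" if "l < Suc k" "Suc k \<le> h" "h < n" for l h
      using that qe[of l h] qy[of h] by (cases "l = k") (auto simp: fk fl q_scale)
    ultimately show ?case using of Tf by blast
  qed
  then show ?thesis unfolding T_def by blast
qed

section \<open>Singular values\<close>

definition unitv :: "nat \<Rightarrow> nat \<Rightarrow> complex" where
  "unitv a = (\<lambda>j. if j = a then 1 else 0)"

lemma unitv_in_vecs: "a < n \<Longrightarrow> unitv a \<in> vecs n"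
  by (auto simp: unitv_def vecs_def)

lemma ip_unitv_right: "a < n \<Longrightarrow> ip n x (unitv a) = x a"
  by (simp add: ip_def unitv_def if_distrib cong: if_cong)

locale singular_system =
  fixes n m :: nat and X :: "nat \<Rightarrow> nat \<Rightarrow> complex" and e :: "nat \<Rightarrow> nat \<Rightarrow> complex"
    and s :: "nat \<Rightarrow> real"
  assumes kern: "kern n m X"
    and basis: "orthonormal n n e"
    and eigen: "i < n \<Longrightarrow> gram X n m (e i) = (\<lambda>j. complex_of_real ((s i)\<^sup>2) * e i j)"
    and s_nonneg: "i < n \<Longrightarrow> 0 \<le> s i"
    and s_antimono: "i \<le> j \<Longrightarrow> j < n \<Longrightarrow> s j \<le> s i"
begin

lemma gram_pow_eigen:
  assumes "i < n"
  shows "(gram X n m ^^ p) (e i) = (\<lambda>j. complex_of_real (s i ^ (2 * p)) * e i j)"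
proof (induction p)
  case (Suc p)
  have "gram X n m (\<lambda>j. a * e i j) = (\<lambda>j. a * gram X n m (e i) j)" for a
    by (simp add: gram_def adjv_def mulv_def fun_eq_iff sum_distrib_left mult_ac)
  from this[of "complex_of_real (s i ^ (2 * p))"] show ?case
    using eigen[OF assms] by (simp add: Suc power_add power2_eq_square mult_ac)
qed simp

lemma ip_gram_pow:
  assumes "x \<in> vecs n"
  shows "ip n ((gram X n m ^^ p) x) y =
    (\<Sum>i<n. complex_of_real (s i ^ (2 * p)) * (ip n x (e i) * cnj (ip n y (e i))))"
proof -
  have "(gram X n m ^^ p) x = lc n (\<lambda>i. ip n x (e i)) (\<lambda>i. (gram X n m ^^ p) (e i))"
    by (subst orthonormal_expansion[OF basis assms, symmetric], subst gram_pow_lc) simp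
  then show ?thesis
    by (simp only: ip_lc_left) (simp add: gram_pow_eigen ip_scale_left cnj_ip mult.left_commute)
qed

lemma nsq_adjv:
  assumes "x \<in> vecs n"
  shows "nsq m (adjv X n x) = (\<Sum>i<n. (s i)\<^sup>2 * (cmod (ip n x (e i)))\<^sup>2)"
proof -
  have "complex_of_real (nsq m (adjv X n x)) =
      complex_of_real (\<Sum>i<n. (s i)\<^sup>2 * (cmod (ip n x (e i)))\<^sup>2)"
    using ip_gram_pow[OF assms, of 1 x]
    by (simp add: ip_gram ip_self complex_norm_square[symmetric])
  then show ?thesis using of_real_eq_iff by blast
qed

lemma nsq_adjv_le_of_orthogonal:
  assumes x: "x \<in> vecs n" and k: "k < n" and orth: "\<And>j. j < k \<Longrightarrow> ip n x (e j) = 0"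
  shows "nsq m (adjv X n x) \<le> (s k)\<^sup>2 * nsq n x"
  unfolding nsq_adjv[OF x] Parseval_nsq[OF basis x] sum_distrib_left
proof (rule sum_mono)
  fix i assume i: "i \<in> {..<n}"
  show "(s i)\<^sup>2 * (cmod (ip n x (e i)))\<^sup>2 \<le> (s k)\<^sup>2 * (cmod (ip n x (e i)))\<^sup>2"
  proof (cases "i < k")
    case True
    then show ?thesis by (simp add: orth)
  next
    case False
    then show ?thesis using i s_antimono[of k i] s_nonneg[of i]
      by (intro mult_right_mono power_mono) auto
  qed
qed

text \<open>The span of \<open>e 0\<close> to \<open>e k\<close> has dimension \<open>k + 1\<close>,
  too large for \<open>k\<close> constraints to cut down to 0. On a surviving \<open>x\<close> only
  the eigenvalues from \<open>(s k)\<^sup>2\<close> upwards contribute.\<close>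

lemma s_le_of_constraints:
  assumes k: "k < n" and t: "0 \<le> t"
    and bd: "\<And>x. x \<in> vecs n \<Longrightarrow> (\<And>j. j < k \<Longrightarrow> ip n x (f j) = 0) \<Longrightarrow>
      nsq m (adjv X n x) \<le> t\<^sup>2 * nsq n x"
  shows "s k \<le> t"
proof -
  obtain c where c: "\<exists>l<Suc k. c l \<noteq> 0" "\<And>i. i < k \<Longrightarrow> (\<Sum>l<Suc k. c l * ip n (e l) (f i)) = 0"
    using nontrivial_combination[of k "Suc k" "\<lambda>l i. ip n (e l) (f i)"] by auto
  define x where "x = lc (Suc k) c e"
  have ok: "orthonormal n (Suc k) e" using basis k by (auto simp: orthonormal_def)
  have x: "x \<in> vecs n" unfolding x_def using ok by (intro lc_in_vecs) (auto simp: orthonormalD)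
  have xe: "ip n x (e i) = (if i < Suc k then c i else 0)" if "i < n" for i
  proof (cases "i < Suc k")
    case True then show ?thesis unfolding x_def using ip_lc_orthonormal[OF ok] by simp
  next
    case False
    then have "c l * ip n (e l) (e i) = 0" if "l < Suc k" for l
      using that \<open>i < n\<close> k orthonormalD(2)[OF basis, of l i] by auto
    then have "(\<Sum>l<Suc k. c l * ip n (e l) (e i)) = 0" by (intro sum.neutral) auto
    then show ?thesis using False unfolding x_def ip_lc_left by simp
  qed
  have pos: "nsq n x > 0"
  proof -
    obtain l where l: "l < Suc k" "c l \<noteq> 0" using c(1) by blast
    have "0 < (cmod (ip n x (e l)))\<^sup>2" using l k xe[of l] by simp
    also have "\<dots> \<le> nsq n x" unfolding Parseval_nsq[OF basis x]
      using l k by (intro member_le_sum) auto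
    finally show ?thesis .
  qed
  have "(s k)\<^sup>2 * nsq n x \<le> nsq m (adjv X n x)"
    unfolding nsq_adjv[OF x] Parseval_nsq[OF basis x] sum_distrib_left
  proof (rule sum_mono)
    fix i assume i: "i \<in> {..<n}"
    show "(s k)\<^sup>2 * (cmod (ip n x (e i)))\<^sup>2 \<le> (s i)\<^sup>2 * (cmod (ip n x (e i)))\<^sup>2"
      using i k s_antimono[of i k] s_nonneg[of k] xe[of i]
      by (cases "i < Suc k") (auto intro!: mult_right_mono power_mono)
  qed
  also have "\<dots> \<le> t\<^sup>2 * nsq n x"
    using c(2) by (intro bd x) (simp add: x_def ip_lc_left)
  finally have "(s k)\<^sup>2 \<le> t\<^sup>2" using pos by simp
  then show ?thesis using t by (rule power2_le_imp_le)
qed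

lemma trace_gram_pow:
  "(\<Sum>a<n. ip n ((gram X n m ^^ p) (unitv a)) (unitv a)) = complex_of_real (\<Sum>i<n. s i ^ (2 * p))"
proof -
  have "(\<Sum>a<n. ip n ((gram X n m ^^ p) (unitv a)) (unitv a)) =
    (\<Sum>a<n. \<Sum>i<n. complex_of_real (s i ^ (2 * p)) * (e i a * cnj (e i a)))"
    by (intro sum.cong refl, subst ip_gram_pow)
      (auto simp: unitv_in_vecs ip_unitv_right mult_ac cnj_ip[of n "e _", symmetric])
  also have "\<dots> = (\<Sum>i<n. complex_of_real (s i ^ (2 * p)) * ip n (e i) (e i))"
    unfolding ip_def sum_distrib_left by (rule sum.swap)
  also have "\<dots> = complex_of_real (\<Sum>i<n. s i ^ (2 * p))"
    using orthonormalD(2)[OF basis] by simp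
  finally show ?thesis .
qed

end

section \<open>Singular values of matrices\<close>

lemma entries_kern: "A \<in> carrier_mat n m \<Longrightarrow> kern n m (entries A)"
  by (auto simp: kern_def entries_def)

lemma mulv_entries_gram:
  assumes A: "A \<in> carrier_mat n m"
  shows "mulv (entries (A * mat_adjoint A)) n x = gram (entries A) n m x"
proof
  fix j
  have adj: "mat_adjoint A \<in> carrier_mat m n" using A by (auto simp: mat_adjoint_def mat_of_rows_def)
  have adjoint: "mat_adjoint A $$ (k, l) = cnj (A $$ (l, k))" if "k < m" "l < n" for k l
    using that A by (simp add: mat_adjoint_def mat_of_rows_def)
  show "mulv (entries (A * mat_adjoint A)) n x j = gram (entries A) n m x j"
  proof (cases "j < n")
    case j: True
    have "mulv (entries (A * mat_adjoint A)) n x j = (\<Sum>l<n. (\<Sum>k<m. A $$ (j, k) * cnj (A $$ (l, k))) * x l)"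
      unfolding mulv_def using j A adj
      by (intro sum.cong refl) (simp add: entries_def scalar_prod_def lessThan_atLeast0 adjoint)
    also have "\<dots> = (\<Sum>k<m. A $$ (j, k) * (\<Sum>l<n. cnj (A $$ (l, k)) * x l))"
      unfolding sum_distrib_right sum_distrib_left by (subst sum.swap) (simp add: mult_ac)
    also have "\<dots> = gram (entries A) n m x j"
      unfolding gram_def mulv_def adjv_def using j A by (simp add: entries_def)
    finally show ?thesis .
  next
    case False
    then show ?thesis using A by (simp add: mulv_def entries_def gram_def)
  qed
qed

text \<open>\<open>singular_value\<close> sorts the real parts of the complex roots of the
  characteristic polynomial. A first eigenbasis, for an arbitrary order of the roots, shows that
  every root is a squared norm, so taking real parts loses nothing. A second eigenbasis follows the
  sorted order, which the triangularization allows to be prescribed.\<close>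

lemma singular_system_exists:
  assumes A: "A \<in> carrier_mat n m"
  shows "\<exists>e. singular_system n m (entries A) e (\<lambda>i. singular_value A (Suc i))"
proof -
  define S where "S = A * mat_adjoint A"
  have adj: "mat_adjoint A \<in> carrier_mat m n" using A by (auto simp: mat_adjoint_def mat_of_rows_def)
  have S: "S \<in> carrier_mat n n" using A adj by (simp add: S_def)
  have adjoint: "mat_adjoint A $$ (k, l) = cnj (A $$ (l, k))" if "k < m" "l < n" for k l
    using that A by (simp add: mat_adjoint_def mat_of_rows_def)
  have Sjl: "S $$ (j, l) = (\<Sum>k<m. A $$ (j, k) * cnj (A $$ (l, k)))" if "j < n" "l < n" for j l
    using that A adj by (simp add: S_def scalar_prod_def lessThan_atLeast0 adjoint)
  have herm: "S $$ (j, l) = cnj (S $$ (l, j))" if "j < n" "l < n" for j l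
    using that by (simp add: Sjl mult.commute)
  note S_gram = mulv_entries_gram[OF A, folded S_def]
  obtain es0 where es0: "char_poly S = (\<Prod>a\<leftarrow>es0. [:- a, 1:])" "length es0 = n"
    using char_poly_factorized[OF S] by auto
  obtain e0 where e0: "orthonormal n n e0"
      "\<And>i. i < n \<Longrightarrow> gram (entries A) n m (e0 i) = (\<lambda>j. es0 ! i * e0 i j)"
    using hermitian_orthonormal_eigenbasis[OF S herm es0(1)] unfolding S_gram by blast
  have ev: "es0 ! i = complex_of_real (nsq m (adjv (entries A) n (e0 i)))" if i: "i < n" for i
  proof -
    have "ip n (gram (entries A) n m (e0 i)) (e0 i) = es0 ! i"
      using e0(1) i by (simp add: e0(2) ip_scale_left orthonormalD)
    then show ?thesis by (simp add: ip_gram ip_self)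
  qed
  define xs where "xs = rev (sorted_list_of_multiset (image_mset Re (mset es0)))"
  define es where "es = map complex_of_real xs"
  have nonneg: "x \<ge> 0" if "x \<in> set xs" for x
    using that ev es0(2) by (force simp: xs_def in_set_conv_nth)
  have mxs: "mset xs = image_mset Re (mset es0)" by (simp add: xs_def)
  have "mset es = image_mset (\<lambda>x. complex_of_real (Re x)) (mset es0)"
    by (simp add: es_def mxs image_mset.compositionality o_def)
  also have "\<dots> = image_mset (\<lambda>x. x) (mset es0)"
    using ev es0(2) by (intro image_mset_cong) (auto simp: in_set_conv_nth)
  finally have mes: "mset es = mset es0" by simp
  have cp: "char_poly S = (\<Prod>a\<leftarrow>es. [:- a, 1:])"
  proof -
    have "(\<Prod>a\<leftarrow>es. [:- a, 1:]) = prod_mset (image_mset (\<lambda>a. [:- a, 1:]) (mset es))"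
      by (simp add: prod_mset_prod_list[symmetric])
    also have "\<dots> = (\<Prod>a\<leftarrow>es0. [:- a, 1:])"
      by (simp add: mes prod_mset_prod_list[symmetric])
    finally show ?thesis using es0 by simp
  qed
  have proots: "proots (char_poly S) = mset es0"
  proof -
    have "proots (\<Prod>a\<leftarrow>as. [:- a, 1:]) = mset as" for as :: "complex list"
    proof (induction as)
      case (Cons a as)
      have "(\<Prod>a\<leftarrow>as. [:- a, 1:]) \<noteq> 0" by (auto simp: prod_list_zero_iff)
      then show ?case using Cons by (simp only: list.map prod_list.Cons) (subst proots_mult, simp_all)
    qed simp
    then show ?thesis using es0(1) by simp
  qed
  have len: "length xs = n" using arg_cong[OF mxs, of size] es0(2) by simp
  have sv: "singular_value A (Suc i) = sqrt (xs ! i)" for i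
    by (simp add: singular_value_def S_def[symmetric] proots xs_def)
  have srt: "sorted (rev xs)" by (simp add: xs_def)
  obtain e where e: "orthonormal n n e"
      "\<And>i. i < n \<Longrightarrow> gram (entries A) n m (e i) = (\<lambda>j. es ! i * e i j)"
    using hermitian_orthonormal_eigenbasis[OF S herm cp] unfolding S_gram by blast
  have "singular_system n m (entries A) e (\<lambda>i. singular_value A (Suc i))"
  proof
    show "kern n m (entries A)" by (rule entries_kern[OF A])
    fix i assume i: "i < n"
    have "xs ! i \<ge> 0" using i len by (intro nonneg) simp
    then show "gram (entries A) n m (e i) = (\<lambda>j. complex_of_real ((singular_value A (Suc i))\<^sup>2) * e i j)"
      "0 \<le> singular_value A (Suc i)"
      using i len by (simp_all add: e(2) es_def sv)
  next
    fix i j assume "i \<le> j" "j < n"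
    then show "singular_value A (Suc j) \<le> singular_value A (Suc i)"
      unfolding sv using srt len by (simp add: sorted_rev_nth_mono)
  qed (rule e(1))
  then show ?thesis by blast
qed

text \<open>Courant-Fischer, phrased with linear constraints instead of subspaces.\<close>

lemma singular_value_le_iff:
  assumes A: "A \<in> carrier_mat n m" and k: "k < n" and t: "0 \<le> t"
  shows "singular_value A (Suc k) \<le> t \<longleftrightarrow>
    (\<exists>f. \<forall>x\<in>vecs n. (\<forall>j<k. ip n x (f j) = 0) \<longrightarrow> nsq m (adjv (entries A) n x) \<le> t\<^sup>2 * nsq n x)"
proof -
  obtain e where "singular_system n m (entries A) e (\<lambda>i. singular_value A (Suc i))"
    using singular_system_exists[OF A] by blast
  then interpret singular_system n m "entries A" e "\<lambda>i. singular_value A (Suc i)" .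
  show ?thesis
  proof
    assume le: "singular_value A (Suc k) \<le> t"
    have "nsq m (adjv (entries A) n x) \<le> t\<^sup>2 * nsq n x"
      if x: "x \<in> vecs n" and "\<forall>j<k. ip n x (e j) = 0" for x
    proof -
      have "nsq m (adjv (entries A) n x) \<le> (singular_value A (Suc k))\<^sup>2 * nsq n x"
        using that by (intro nsq_adjv_le_of_orthogonal k) auto
      also have "\<dots> \<le> t\<^sup>2 * nsq n x"
        using le s_nonneg[OF k] by (intro mult_right_mono power_mono) auto
      finally show ?thesis .
    qed
    then show "\<exists>f. \<forall>x\<in>vecs n. (\<forall>j<k. ip n x (f j) = 0) \<longrightarrow>
        nsq m (adjv (entries A) n x) \<le> t\<^sup>2 * nsq n x" by blast
  qed (use s_le_of_constraints[OF k t] in blast)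
qed

section \<open>Perturbation of singular values when the quadratic forms converge\<close>

text \<open>One index has to serve all coefficient vectors. If every entry is within \<epsilon> of
  its limit, the form is off by at most \<epsilon> times the square of the sum of the |c j|, which
  by Cauchy-Schwarz is at most \<epsilon> \<open>card J\<close> times the sum of their squares. The
  choice of \<epsilon> leaves half of the smallest limiting eigenvalue \<open>d\<close>.\<close>

lemma eventually_form_positive:
  fixes f :: "nat \<Rightarrow> nat \<Rightarrow> nat \<Rightarrow> complex" and \<phi> :: "nat \<Rightarrow> real"
  assumes J: "finite J"
    and lim: "\<And>j k. j \<in> J \<Longrightarrow> k \<in> J \<Longrightarrow>
      (\<lambda>n. f n j k) \<longlonglongrightarrow> (if j = k then complex_of_real (\<phi> j) else 0)"
    and pos: "\<And>j. j \<in> J \<Longrightarrow> 0 < \<phi> j"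
  shows "\<forall>\<^sub>F n in sequentially. \<forall>c::nat \<Rightarrow> complex. (\<exists>j\<in>J. c j \<noteq> 0) \<longrightarrow>
    0 < Re (\<Sum>j\<in>J. \<Sum>k\<in>J. c j * cnj (c k) * f n j k)"
proof (cases "J = {}")
  case False
  define d where "d = Min (\<phi> ` J)"
  have d: "d > 0" "\<And>j. j \<in> J \<Longrightarrow> d \<le> \<phi> j"
    using J False pos by (auto simp: d_def)
  define L where "L = (\<lambda>j k. if j = k then complex_of_real (\<phi> j) else 0)"
  define \<epsilon> where "\<epsilon> = d / (2 * real (card J))"
  have card: "card J > 0" using J False by (simp add: card_gt_0_iff)
  have \<epsilon>: "\<epsilon> > 0" using d card by (simp add: \<epsilon>_def)
  have "\<forall>\<^sub>F n in sequentially. \<forall>j\<in>J. \<forall>k\<in>J. dist (f n j k) (L j k) < \<epsilon>"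
    using J lim \<epsilon> unfolding L_def by (intro eventually_ball_finite ballI tendstoD)
  then show ?thesis
  proof (rule eventually_mono, intro allI impI)
    fix n and c :: "nat \<Rightarrow> complex" assume close: "\<forall>j\<in>J. \<forall>k\<in>J. dist (f n j k) (L j k) < \<epsilon>" and c: "\<exists>j\<in>J. c j \<noteq> 0"
    define s where "s = (\<Sum>j\<in>J. (cmod (c j))\<^sup>2)"
    have s: "s > 0" using c J by (auto simp: s_def intro!: sum_pos2)
    have eq: "(\<Sum>j\<in>J. \<Sum>k\<in>J. c j * cnj (c k) * f n j k) =
      (\<Sum>j\<in>J. \<Sum>k\<in>J. c j * cnj (c k) * L j k) + (\<Sum>j\<in>J. \<Sum>k\<in>J. c j * cnj (c k) * (f n j k - L j k))"
      by (simp add: sum.distrib[symmetric] algebra_simps)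
    have "(\<Sum>j\<in>J. \<Sum>k\<in>J. c j * cnj (c k) * L j k) = (\<Sum>j\<in>J. c j * cnj (c j) * complex_of_real (\<phi> j))"
      unfolding L_def using J by (simp add: if_distrib cong: if_cong)
    then have main: "Re (\<Sum>j\<in>J. \<Sum>k\<in>J. c j * cnj (c k) * L j k) = (\<Sum>j\<in>J. \<phi> j * (cmod (c j))\<^sup>2)"
      by (simp add: complex_norm_square[symmetric] mult.commute)
    have "d * s \<le> (\<Sum>j\<in>J. \<phi> j * (cmod (c j))\<^sup>2)"
      unfolding s_def sum_distrib_left using d by (intro sum_mono mult_right_mono) auto
    moreover have "cmod (\<Sum>j\<in>J. \<Sum>k\<in>J. c j * cnj (c k) * (f n j k - L j k)) \<le> d * s / 2"
    proof -
      have "cmod (\<Sum>j\<in>J. \<Sum>k\<in>J. c j * cnj (c k) * (f n j k - L j k)) \<le>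
          (\<Sum>j\<in>J. \<Sum>k\<in>J. cmod (c j) * cmod (c k) * \<epsilon>)"
        using close by (intro order_trans[OF norm_sum] sum_mono)
          (simp add: norm_mult dist_norm less_imp_le mult_left_mono)
      also have "\<dots> = \<epsilon> * (\<Sum>j\<in>J. cmod (c j))\<^sup>2"
        by (simp add: power2_eq_square sum_product sum_distrib_left mult_ac)
      also have "\<dots> \<le> \<epsilon> * ((\<Sum>j\<in>J. (cmod (c j))\<^sup>2) * (\<Sum>j\<in>J. 1\<^sup>2))"
        using \<epsilon> Cauchy_Schwarz_ineq_sum[of "\<lambda>j. cmod (c j)" "\<lambda>_. 1" J] by (intro mult_left_mono) auto
      also have "\<dots> = d * s / 2" using card by (simp add: s_def \<epsilon>_def)
      finally show ?thesis .
    qed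
    moreover have "d * s > 0" using d s by simp
    ultimately show "0 < Re (\<Sum>j\<in>J. \<Sum>k\<in>J. c j * cnj (c k) * f n j k)"
      unfolding eq using abs_Re_le_cmod[of "\<Sum>j\<in>J. \<Sum>k\<in>J. c j * cnj (c k) * (f n j k - L j k)"]
      by (simp only: plus_complex.sel main)
  qed
qed simp

text \<open>Truncated resolvent of the Gram operator: the inverse of \<open>z\<^sup>2 - X X\<^sup>*\<close> up to the remainder
  \<open>(X X\<^sup>* / z\<^sup>2)\<^sup>N\<close>.\<close>

definition nres :: "(nat \<Rightarrow> nat \<Rightarrow> complex) \<Rightarrow> nat \<Rightarrow> nat \<Rightarrow> nat \<Rightarrow> real \<Rightarrow> (nat \<Rightarrow> complex) \<Rightarrow> nat \<Rightarrow> complex" where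
  "nres X n m N z x = lc N (\<lambda>k. complex_of_real (1 / z ^ (2 * k + 2))) (\<lambda>k. (gram X n m ^^ k) x)"

lemma nres_in_vecs: "kern n m X \<Longrightarrow> x \<in> vecs n \<Longrightarrow> nres X n m N z x \<in> vecs n"
  unfolding nres_def by (intro lc_in_vecs gram_pow_in_vecs)

lemma nres_telescope:
  assumes "z \<noteq> 0"
  shows "complex_of_real (z\<^sup>2) * nres X n m N z x j - gram X n m (nres X n m N z x) j =
    x j - complex_of_real (1 / z ^ (2 * N)) * (gram X n m ^^ N) x j"
proof -
  have 1: "complex_of_real (z\<^sup>2) * nres X n m N z x j =
      (\<Sum>k<N. complex_of_real (1 / z ^ (2 * k)) * (gram X n m ^^ k) x j)"
    unfolding nres_def lc_def sum_distrib_left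
  proof (intro sum.cong refl)
    fix k
    have "z\<^sup>2 * (1 / z ^ (2 * k + 2)) = 1 / z ^ (2 * k)" using assms by (simp add: power_add power2_eq_square divide_simps)
    then show "complex_of_real (z\<^sup>2) * (complex_of_real (1 / z ^ (2 * k + 2)) * (gram X n m ^^ k) x j) =
        complex_of_real (1 / z ^ (2 * k)) * (gram X n m ^^ k) x j"
      by (simp only: mult.assoc[symmetric] of_real_mult[symmetric])
  qed
  have 2: "gram X n m (nres X n m N z x) j =
      (\<Sum>k<N. complex_of_real (1 / z ^ (2 * Suc k)) * (gram X n m ^^ Suc k) x j)"
    unfolding nres_def gram_lc by (simp add: lc_def)
  have "complex_of_real (z\<^sup>2) * nres X n m N z x j - gram X n m (nres X n m N z x) j =
    (\<Sum>k<N. complex_of_real (1 / z ^ (2 * k)) * (gram X n m ^^ k) x j -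
      complex_of_real (1 / z ^ (2 * Suc k)) * (gram X n m ^^ Suc k) x j)"
    unfolding 1 2 sum_subtractf ..
  also have "\<dots> = x j - complex_of_real (1 / z ^ (2 * N)) * (gram X n m ^^ N) x j"
    by (subst sum_lessThan_telescope') simp
  finally show ?thesis .
qed

lemma ip_nres: "ip n (nres X n m N z x) y =
    (\<Sum>k<N. complex_of_real (1 / z ^ (2 * k + 2)) * ip n ((gram X n m ^^ k) x) y)"
  unfolding nres_def ip_lc_left ..

lemma ip_gram_pow_pow:
  "ip n ((gram X n m ^^ p) x) ((gram X n m ^^ q) y) = ip n ((gram X n m ^^ (p + q)) x) y"
  by (simp add: ip_gram_pow_swap[symmetric] add.commute[of p] funpow_add)

text \<open>On truncated resolvents the form of \<open>z\<^sup>2\<close> minus the Gram operator is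
  a finite combination of forms with powers below \<open>2 * N\<close>; this is why only such forms
  have to converge.\<close>

lemma ip_nres_form:
  assumes "z \<noteq> 0"
  shows "complex_of_real (z\<^sup>2) * ip n (nres X n m N z x) (nres X n m N z y) -
      ip n (gram X n m (nres X n m N z x)) (nres X n m N z y) =
    (\<Sum>k<N. complex_of_real (1 / z ^ (2 * k + 2)) * (ip n ((gram X n m ^^ k) x) y -
      complex_of_real (1 / z ^ (2 * N)) * ip n ((gram X n m ^^ (N + k)) x) y))"
proof -
  have "complex_of_real (z\<^sup>2) * ip n (nres X n m N z x) (nres X n m N z y) -
      ip n (gram X n m (nres X n m N z x)) (nres X n m N z y) =
    ip n (\<lambda>j. x j - complex_of_real (1 / z ^ (2 * N)) * (gram X n m ^^ N) x j) (nres X n m N z y)"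
    unfolding ip_scale_left[symmetric] ip_diff_left[symmetric] nres_telescope[OF assms] ..
  also have "\<dots> = (\<Sum>k<N. complex_of_real (1 / z ^ (2 * k + 2)) * (ip n ((gram X n m ^^ k) x) y -
      complex_of_real (1 / z ^ (2 * N)) * ip n ((gram X n m ^^ (N + k)) x) y))"
  proof -
    have "ip n ((gram X n m ^^ N) x) ((gram X n m ^^ k) y) = ip n ((gram X n m ^^ (N + k)) x) y" for k
      by (rule ip_gram_pow_pow)
    moreover have "ip n x ((gram X n m ^^ k) y) = ip n ((gram X n m ^^ k) x) y" for k
      by (rule ip_gram_pow_swap[symmetric])
    ultimately show ?thesis
      unfolding nres_def ip_lc_right ip_diff_left ip_scale_left
      by (simp add: diff_divide_distrib sum_subtractf sum_divide_distrib mult_ac)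
  qed
  finally show ?thesis .
qed

text \<open>Both parts are comparisons with a geometric series of ratio
  \<open>q = (b / z)\<^sup>2\<close>. The second sum is what the remainder in
  \<open>ip_nres_form\<close> becomes once the forms are replaced by their limits \<open>g\<close>;
  it carries an extra factor \<open>q ^ N\<close>.\<close>

lemma power_series_truncation:
  fixes g :: "nat \<Rightarrow> real"
  assumes g: "\<And>k. 0 \<le> g k" "\<And>k. g k \<le> C * b ^ (2 * k)" and b: "0 \<le> b" and z: "b < z"
  shows power_series_summable: "summable (\<lambda>k. g k / z ^ (2 * k + 2))"
    and power_series_tail: "(\<lambda>N. \<Sum>k<N. g (N + k) / z ^ (2 * N) / z ^ (2 * k + 2)) \<longlonglongrightarrow> 0"
proof -
  define q where "q = (b / z)\<^sup>2"
  have q: "0 \<le> q" "q < 1" using b z by (auto simp: q_def power_less_one_iff)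
  have z0: "z > 0" using b z by simp
  have bq: "b ^ (2 * k) / z ^ (2 * k) = q ^ k" for k
    by (simp add: q_def power_mult power_divide)
  have C: "C \<ge> 0" using g[of 0] by simp
  have le: "g k / z ^ (2 * k) \<le> C * q ^ k" for k
    using g(2)[of k] z0 by (simp add: bq[symmetric] divide_simps)
  have le2: "g k' / z ^ (2 * k') / z\<^sup>2 \<le> C / z\<^sup>2 * q ^ k'" for k'
    using divide_right_mono[OF le[of k'], of "z\<^sup>2"] by simp
  show s: "summable (\<lambda>k. g k / z ^ (2 * k + 2))"
  proof (rule summable_comparison_test'[of "\<lambda>k. C / z\<^sup>2 * q ^ k" 0])
    show "summable (\<lambda>k. C / z\<^sup>2 * q ^ k)" using q by (intro summable_mult summable_geometric) simp
    show "norm (g k / z ^ (2 * k + 2)) \<le> C / z\<^sup>2 * q ^ k" for k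
      using le2[of k] g(1)[of k] z0 by (simp add: power_add power2_eq_square mult.commute)
  qed
  have up: "(\<Sum>k<N. g (N + k) / z ^ (2 * N) / z ^ (2 * k + 2)) \<le> q ^ N * (C / z\<^sup>2 * (1 / (1 - q)))" for N
  proof -
    have "(\<Sum>k<N. g (N + k) / z ^ (2 * N) / z ^ (2 * k + 2)) \<le> (\<Sum>k<N. q ^ N * (C / z\<^sup>2) * q ^ k)"
    proof (rule sum_mono)
      fix k
      show "g (N + k) / z ^ (2 * N) / z ^ (2 * k + 2) \<le> q ^ N * (C / z\<^sup>2) * q ^ k"
        using le2[of "N + k"] by (simp add: power_add power2_eq_square distrib_left mult_ac)
    qed
    also have "\<dots> = q ^ N * (C / z\<^sup>2) * (\<Sum>k<N. q ^ k)" by (simp add: sum_distrib_left)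
    also have "\<dots> \<le> q ^ N * (C / z\<^sup>2) * (1 / (1 - q))"
      using q C z0 sum_le_suminf[OF summable_geometric[of q], of "{..<N}"] suminf_geometric[of q]
      by (intro mult_left_mono) auto
    finally show ?thesis by (simp add: mult_ac)
  qed
  have "(\<lambda>N. q ^ N * (C / z\<^sup>2 * (1 / (1 - q)))) \<longlonglongrightarrow> 0 * (C / z\<^sup>2 * (1 / (1 - q)))"
    using q by (intro tendsto_mult tendsto_const LIMSEQ_realpow_zero) auto
  then have lim: "(\<lambda>N. q ^ N * (C / z\<^sup>2 * (1 / (1 - q)))) \<longlonglongrightarrow> 0" by simp
  show "(\<lambda>N. \<Sum>k<N. g (N + k) / z ^ (2 * N) / z ^ (2 * k + 2)) \<longlonglongrightarrow> 0"
  proof (rule tendsto_sandwich[OF _ _ tendsto_const lim])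
    show "\<forall>\<^sub>F N in sequentially. 0 \<le> (\<Sum>k<N. g (N + k) / z ^ (2 * N) / z ^ (2 * k + 2))"
      using g(1) z0 by (intro always_eventually allI sum_nonneg divide_nonneg_nonneg) auto
    show "\<forall>\<^sub>F N in sequentially. (\<Sum>k<N. g (N + k) / z ^ (2 * N) / z ^ (2 * k + 2)) \<le>
        q ^ N * (C / z\<^sup>2 * (1 / (1 - q)))"
      using up by (intro always_eventually allI)
  qed
qed

section \<open>Low-rank updates of the form\<close>

definition rank_update ::
  "(nat \<Rightarrow> nat \<Rightarrow> complex) \<Rightarrow> nat \<Rightarrow> (nat \<Rightarrow> real) \<Rightarrow> (nat \<Rightarrow> nat \<Rightarrow> complex) \<Rightarrow> (nat \<Rightarrow> nat \<Rightarrow> complex) \<Rightarrow>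
   nat \<Rightarrow> nat \<Rightarrow> complex" where
  "rank_update X r \<theta> u v = (\<lambda>j k. X j k + (\<Sum>i<r. complex_of_real (\<theta> i) * u i j * cnj (v i k)))"

lemma adjv_rank_update:
  "adjv (rank_update X r \<theta> u v) n x =
    (\<lambda>k. adjv X n x k + lc r (\<lambda>i. complex_of_real (\<theta> i) * ip n x (u i)) v k)"
proof
  fix k
  have "adjv (rank_update X r \<theta> u v) n x k =
      adjv X n x k + (\<Sum>j<n. \<Sum>i<r. complex_of_real (\<theta> i) * (x j * cnj (u i j)) * v i k)"
    by (simp add: adjv_def rank_update_def sum.distrib sum_distrib_left sum_distrib_right algebra_simps)
  also have "(\<Sum>j<n. \<Sum>i<r. complex_of_real (\<theta> i) * (x j * cnj (u i j)) * v i k) =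
      lc r (\<lambda>i. complex_of_real (\<theta> i) * ip n x (u i)) v k"
    unfolding lc_def ip_def sum_distrib_left sum_distrib_right by (subst sum.swap) simp
  finally show "adjv (rank_update X r \<theta> u v) n x k =
      adjv X n x k + lc r (\<lambda>i. complex_of_real (\<theta> i) * ip n x (u i)) v k" .
qed

lemma ip_adjv_rank_update:
  "ip m (adjv (rank_update X r \<theta> u v) n x) (adjv (rank_update X r \<theta> u v) n y) =
    ip n (gram X n m x) y +
    (\<Sum>i<r. complex_of_real (\<theta> i) * (cnj (ip n y (u i)) * ip n x (mulv X m (v i)) +
       ip n x (u i) * cnj (ip n y (mulv X m (v i))))) +
    (\<Sum>i<r. \<Sum>l<r. complex_of_real (\<theta> i * \<theta> l) * (ip n x (u i) * cnj (ip n y (u l)) * ip m (v i) (v l)))"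
proof -
  have 1: "ip m (adjv X n x) (lc r (\<lambda>i. complex_of_real (\<theta> i) * ip n y (u i)) v) =
      (\<Sum>i<r. complex_of_real (\<theta> i) * (cnj (ip n y (u i)) * ip n x (mulv X m (v i))))"
    by (simp add: ip_lc_right ip_adjv mult.assoc)
  have 2: "ip m (lc r (\<lambda>i. complex_of_real (\<theta> i) * ip n x (u i)) v) (adjv X n y) =
      (\<Sum>i<r. complex_of_real (\<theta> i) * (ip n x (u i) * cnj (ip n y (mulv X m (v i)))))"
    unfolding ip_lc_left by (simp add: ip_mulv[symmetric] cnj_ip mult.assoc)
  have 3: "ip m (lc r (\<lambda>i. complex_of_real (\<theta> i) * ip n x (u i)) v)
        (lc r (\<lambda>i. complex_of_real (\<theta> i) * ip n y (u i)) v) =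
      (\<Sum>i<r. \<Sum>l<r. complex_of_real (\<theta> i * \<theta> l) * (ip n x (u i) * cnj (ip n y (u l)) * ip m (v i) (v l)))"
    unfolding ip_lc_left by (simp add: ip_lc_right sum_distrib_left mult_ac)
  show ?thesis
    unfolding adjv_rank_update ip_add_left ip_add_right 1 2 3
    by (simp add: ip_gram distrib_left sum.distrib add_ac)
qed

text \<open>A weighted Young inequality: expand the squared norm of \<delta> x - t and divide by
  \<delta>.\<close>

lemma two_Re_ip_le:
  assumes "\<delta> > 0"
  shows "2 * Re (ip n t x) \<le> \<delta> * nsq n x + nsq n t / \<delta>"
proof -
  define w where "w = (\<lambda>j. complex_of_real \<delta> * x j - t j)"
  have "complex_of_real (nsq n w) = ip n w w" by (simp add: ip_self)
  also have "\<dots> = complex_of_real (\<delta> * \<delta> * nsq n x) - complex_of_real \<delta> * (ip n x t + ip n t x)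
      + complex_of_real (nsq n t)"
    unfolding w_def ip_diff_left ip_diff_right ip_scale_left ip_scale_right
    by (simp add: ip_self[symmetric] algebra_simps)
  also have "ip n x t + ip n t x = complex_of_real (2 * Re (ip n t x))"
    by (subst cnj_ip[of n t x, symmetric]) (simp add: complex_eq_iff)
  finally have "complex_of_real (nsq n w) =
      complex_of_real (\<delta> * \<delta> * nsq n x - \<delta> * (2 * Re (ip n t x)) + nsq n t)" by simp
  then have "nsq n w = \<delta> * \<delta> * nsq n x - \<delta> * (2 * Re (ip n t x)) + nsq n t"
    using of_real_eq_iff by blast
  then have "\<delta> * (2 * Re (ip n t x)) \<le> \<delta> * \<delta> * nsq n x + nsq n t"
    using nsq_nonneg[of n w] by linarith
  also have "\<dots> = \<delta> * (\<delta> * nsq n x + nsq n t / \<delta>)" using assms by (simp add: distrib_left)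
  finally have "\<delta> * (2 * Re (ip n t x)) \<le> \<delta> * (\<delta> * nsq n x + nsq n t / \<delta>)" .
  then show ?thesis using assms by simp
qed

text \<open>Expand \<open>0 \<le> q (x - y) (x - y)\<close> for \<open>y = \<Sum>\<^sub>l \<langle>x, u\<^sub>l\<rangle> Y\<^sub>l\<close>; the choice of \<open>Y\<close> makes the mixed terms
  \<open>\<langle>x, u\<^sub>l\<rangle>\<langle>X v\<^sub>l, x\<rangle>\<close> of the perturbed form cancel, and \<open>\<delta>\<close> absorbs the remainders \<open>\<rho>\<close>.\<close>

lemma form_completed_square:
  fixes X Y \<rho> :: "nat \<Rightarrow> nat \<Rightarrow> complex" and n m :: nat and z :: real
  defines "q \<equiv> \<lambda>x y. complex_of_real (z\<^sup>2) * ip n x y - ip n (gram X n m x) y"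
  assumes psd: "\<And>x. x \<in> vecs n \<Longrightarrow> nsq m (adjv X n x) \<le> z\<^sup>2 * nsq n x"
    and x: "x \<in> vecs n" and Y: "\<And>l. l < r \<Longrightarrow> Y l \<in> vecs n" and \<delta>: "\<delta> > 0"
    and qY: "\<And>l. l < r \<Longrightarrow> q (Y l) x =
      complex_of_real \<gamma> * cnj (ip n x (u l)) + complex_of_real (\<theta> l) * cnj (ip n x (mulv X m (v l))) - ip n (\<rho> l) x"
  shows "nsq m (adjv (rank_update X r \<theta> u v) n x) - (z\<^sup>2 + \<delta>) * nsq n x \<le>
    Re (\<Sum>l<r. \<Sum>k<r. ip n x (u l) * cnj (ip n x (u k)) *
      (ip n (\<rho> l) (\<rho> k) / complex_of_real \<delta> + q (Y l) (Y k) +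
       complex_of_real (\<theta> l * \<theta> k) * ip m (v l) (v k) - (if l = k then complex_of_real (2 * \<gamma>) else 0)))"
proof -
  define \<xi> where "\<xi> = (\<lambda>l. ip n x (u l))"
  define \<zeta> where "\<zeta> = (\<lambda>l. ip n x (mulv X m (v l)))"
  have xi: "ip n x (u l) = \<xi> l" and zeta: "ip n x (mulv X m (v l)) = \<zeta> l" for l
    by (simp_all add: \<xi>_def \<zeta>_def)
  define y where "y = lc r \<xi> Y"
  define t where "t = lc r \<xi> \<rho>"
  have qherm: "q a a' = cnj (q a' a)" for a a'
    by (simp add: q_def cnj_ip ip_gram_swap)
  have qself: "Re (q a a) = z\<^sup>2 * nsq n a - nsq m (adjv X n a)" for a
    by (simp add: q_def ip_self ip_gram)
  have q_diff: "q (\<lambda>j. a j - a' j) w = q a w - q a' w" for a a' w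
    unfolding q_def ip_gram_swap ip_diff_left by (simp add: algebra_simps)
  have q_diff': "q w (\<lambda>j. a j - a' j) = q w a - q w a'" for a a' w
    unfolding q_def ip_diff_right by (simp add: algebra_simps)
  have "0 \<le> Re (q (\<lambda>j. x j - y j) (\<lambda>j. x j - y j))"
    unfolding qself using psd[of "\<lambda>j. x j - y j"] x Y
    by (auto simp: y_def intro!: vecs_diff lc_in_vecs)
  also have "q (\<lambda>j. x j - y j) (\<lambda>j. x j - y j) = q x x - cnj (q y x) - q y x + q y y"
    unfolding q_diff q_diff' by (simp add: qherm[of x y])
  finally have sq: "2 * Re (q y x) - Re (q y y) \<le> Re (q x x)" by simp
  have qyx: "q y x = (\<Sum>l<r. \<xi> l * (complex_of_real \<gamma> * cnj (\<xi> l) + complex_of_real (\<theta> l) * cnj (\<zeta> l))) - ip n t x"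
  proof -
    have "q y x = (\<Sum>l<r. \<xi> l * q (Y l) x)"
      unfolding q_def y_def ip_gram_swap ip_lc_left
      by (simp add: sum_distrib_left sum_subtractf[symmetric] right_diff_distrib mult_ac)
    then show ?thesis
      by (simp add: qY xi zeta t_def ip_lc_left right_diff_distrib sum_subtractf)
  qed
  have qyy: "q y y = (\<Sum>l<r. \<Sum>k<r. \<xi> l * cnj (\<xi> k) * q (Y l) (Y k))"
    unfolding q_def y_def gram_lc ip_lc_left ip_lc_right
    by (simp add: sum_distrib_left sum_subtractf[symmetric] right_diff_distrib mult_ac)
  have tt: "complex_of_real (nsq n t) = (\<Sum>l<r. \<Sum>k<r. \<xi> l * cnj (\<xi> k) * ip n (\<rho> l) (\<rho> k))"
    unfolding ip_self[symmetric] t_def ip_lc_left by (simp add: ip_lc_right sum_distrib_left mult_ac)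
  have F: "complex_of_real (nsq m (adjv (rank_update X r \<theta> u v) n x)) =
      complex_of_real (nsq m (adjv X n x)) +
      (\<Sum>l<r. complex_of_real (\<theta> l) * (cnj (\<xi> l) * \<zeta> l + \<xi> l * cnj (\<zeta> l))) +
      (\<Sum>l<r. \<Sum>k<r. \<xi> l * cnj (\<xi> k) * (complex_of_real (\<theta> l * \<theta> k) * ip m (v l) (v k)))"
    unfolding ip_self[symmetric] ip_adjv_rank_update
    by (simp add: ip_gram xi zeta mult_ac)
  define C where "C = (\<Sum>l<r. \<Sum>k<r. \<xi> l * cnj (\<xi> k) *
      (ip n (\<rho> l) (\<rho> k) / complex_of_real \<delta> + q (Y l) (Y k) +
       complex_of_real (\<theta> l * \<theta> k) * ip m (v l) (v k) - (if l = k then complex_of_real (2 * \<gamma>) else 0)))"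
  define V where "V = (\<Sum>l<r. \<Sum>k<r. \<xi> l * cnj (\<xi> k) * (complex_of_real (\<theta> l * \<theta> k) * ip m (v l) (v k)))"
  define G where "G = (\<Sum>l<r. \<xi> l * cnj (\<xi> l))"
  define H where "H = (\<Sum>l<r. complex_of_real (\<theta> l) * (\<xi> l * cnj (\<zeta> l)))"
  have C: "C = complex_of_real (nsq n t) / complex_of_real \<delta> + q y y + V - complex_of_real (2 * \<gamma>) * G"
  proof -
    have "C = (\<Sum>l<r. \<Sum>k<r. \<xi> l * cnj (\<xi> k) * ip n (\<rho> l) (\<rho> k) / complex_of_real \<delta>) +
        (\<Sum>l<r. \<Sum>k<r. \<xi> l * cnj (\<xi> k) * q (Y l) (Y k)) + V -
        (\<Sum>l<r. \<Sum>k<r. \<xi> l * cnj (\<xi> k) * (if l = k then complex_of_real (2 * \<gamma>) else 0))"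
      by (simp add: C_def V_def algebra_simps sum.distrib sum_subtractf)
    also have "(\<Sum>l<r. \<Sum>k<r. \<xi> l * cnj (\<xi> k) * (if l = k then complex_of_real (2 * \<gamma>) else 0)) =
        complex_of_real (2 * \<gamma>) * G"
      by (simp add: G_def sum_distrib_left if_distrib mult_ac cong: if_cong)
    finally show ?thesis unfolding tt qyy by (simp add: sum_divide_distrib)
  qed
  have qyx': "q y x = complex_of_real \<gamma> * G + H - ip n t x"
    unfolding qyx G_def H_def by (simp add: distrib_left sum.distrib sum_distrib_left mult_ac)
  have H2: "(\<Sum>l<r. complex_of_real (\<theta> l) * (cnj (\<xi> l) * \<zeta> l + \<xi> l * cnj (\<zeta> l))) = cnj H + H"
    by (simp add: H_def distrib_left sum.distrib)
  have FR: "nsq m (adjv (rank_update X r \<theta> u v) n x) = nsq m (adjv X n x) + 2 * Re H + Re V"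
    using arg_cong[OF F, of Re] unfolding H2 V_def[symmetric] by simp
  have CR: "Re C = nsq n t / \<delta> + Re (q y y) + Re V - 2 * \<gamma> * Re G"
    unfolding C by (simp add: of_real_divide[symmetric] del: of_real_divide)
  have qR: "Re (q y x) = \<gamma> * Re G + Re H - Re (ip n t x)"
    unfolding qyx' by simp
  show ?thesis
    using sq two_Re_ip_le[OF \<delta>, of n t x]
    unfolding xi C_def[symmetric] FR CR qR qself[of x]
    by (simp add: algebra_simps)
qed

text \<open>\<open>mom k\<close> stands for \<open>\<integral> t\<^sup>2\<^sup>k d\<mu>\<close>. Then \<open>alpha z = \<integral> 1/(z\<^sup>2 - t\<^sup>2) d\<mu>\<close>, \<open>beta z = c \<integral> t\<^sup>2/(z\<^sup>2 - t\<^sup>2) d\<mu>\<close>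
  and \<open>D\<close> is the D-transform.\<close>

locale moment_sequence =
  fixes mom :: "nat \<Rightarrow> real" and c b :: real
  assumes mom: "0 \<le> mom k" "mom k \<le> b ^ (2 * k)" "mom 0 = 1"
    and b_nonneg: "0 \<le> b" and c_nonneg: "0 \<le> c"
begin

definition alpha :: "real \<Rightarrow> real" where "alpha z = (\<Sum>k. mom k / z ^ (2 * k + 2))"
definition beta :: "real \<Rightarrow> real" where "beta z = (\<Sum>k. c * mom (Suc k) / z ^ (2 * k + 2))"
definition D :: "real \<Rightarrow> real" where "D z = alpha z * (1 + beta z)"

lemma cmom_bound: "0 \<le> c * mom (Suc k)" "c * mom (Suc k) \<le> (c * b\<^sup>2) * b ^ (2 * k)"
  using mom(1)[of "Suc k"] mult_left_mono[OF mom(2)[of "Suc k"] c_nonneg] c_nonneg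
  by (simp_all add: power2_eq_square mult_ac)

lemma mom_bound: "mom k \<le> 1 * b ^ (2 * k)"
  using mom by simp

lemma power_series_term:
  "z \<noteq> 0 \<Longrightarrow> g * (1 / z\<^sup>2) ^ k = z\<^sup>2 * (g / z ^ (2 * k + 2))" for g z :: real
  by (simp only: power_add power_mult power_one_over) (simp add: field_simps)

lemma summable_alpha: "b < z \<Longrightarrow> summable (\<lambda>k. mom k / z ^ (2 * k + 2))"
  by (rule power_series_summable[OF mom(1) mom_bound b_nonneg])

lemma summable_beta: "b < z \<Longrightarrow> summable (\<lambda>k. c * mom (Suc k) / z ^ (2 * k + 2))"
  by (rule power_series_summable[OF cmom_bound b_nonneg])

text \<open>Up to the factor \<open>c\<close>, the series of \<open>beta\<close> is that of
  \<open>alpha\<close> shifted by one term, mirroring t^2/(z^2 - t^2) = z^2/(z^2 - t^2) - 1. This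
  identity turns \<alpha>(1 + \<beta>) into the product that defines the D-transform.\<close>

lemma beta_eq:
  assumes "b < z"
  shows "beta z = c * (z\<^sup>2 * alpha z - 1)"
proof -
  have z: "z > 0" using assms b_nonneg by simp
  note S = summable_alpha[OF assms]
  have "alpha z = 1 / z\<^sup>2 + (\<Sum>k. mom (Suc k) / z ^ (2 * Suc k + 2))"
    unfolding alpha_def using suminf_split_head[OF S] mom by (simp add: power2_eq_square)
  also have "(\<Sum>k. mom (Suc k) / z ^ (2 * Suc k + 2)) = (\<Sum>k. (1 / z\<^sup>2) * (mom (Suc k) / z ^ (2 * k + 2)))"
    by (intro arg_cong[where f = suminf] ext) (simp add: power2_eq_square)
  also have "\<dots> = (1 / z\<^sup>2) * (\<Sum>k. mom (Suc k) / z ^ (2 * k + 2))"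
  proof (rule suminf_mult)
    have "0 \<le> mom (Suc k)" "mom (Suc k) \<le> b\<^sup>2 * b ^ (2 * k)" for k
      using mom(1,2)[of "Suc k"] by (simp_all add: power2_eq_square mult_ac)
    then show "summable (\<lambda>k. mom (Suc k) / z ^ (2 * k + 2))"
      by (rule power_series_summable[OF _ _ b_nonneg assms])
  qed
  finally have "(\<Sum>k. mom (Suc k) / z ^ (2 * k + 2)) = z\<^sup>2 * alpha z - 1" using z by (simp add: field_simps)
  moreover have "beta z = c * (\<Sum>k. mom (Suc k) / z ^ (2 * k + 2))"
  proof -
    have "0 \<le> mom (Suc k)" "mom (Suc k) \<le> b\<^sup>2 * b ^ (2 * k)" for k
      using mom(1,2)[of "Suc k"] by (simp_all add: power2_eq_square mult_ac)
    then have "summable (\<lambda>k. mom (Suc k) / z ^ (2 * k + 2))"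
      by (rule power_series_summable[OF _ _ b_nonneg assms])
    from suminf_mult[OF this, of c] show ?thesis by (simp add: beta_def)
  qed
  ultimately show ?thesis by simp
qed

lemma alpha_pos:
  assumes "b < z"
  shows "alpha z > 0"
proof -
  have z: "z > 0" using assms b_nonneg by simp
  show ?thesis unfolding alpha_def
    using summable_alpha[OF assms] mom z by (intro suminf_pos2[of _ 0]) auto
qed

lemma beta_nonneg:
  assumes "b < z"
  shows "beta z \<ge> 0"
  unfolding beta_def using summable_beta[OF assms] cmom_bound(1) assms b_nonneg by (intro suminf_nonneg) auto

lemma D_pos: "b < z \<Longrightarrow> D z > 0"
  unfolding D_def using alpha_pos beta_nonneg by (intro mult_pos_pos) (auto intro: add_pos_nonneg)

lemma D_strict_decreasing:
  assumes "b < z" "z < z'"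
  shows "D z' < D z"
proof -
  have b: "b < z'" and z: "0 < z" using assms b_nonneg by auto
  have pw: "z ^ (2 * k + 2) < z' ^ (2 * k + 2)" for k
    using assms z by (intro power_strict_mono) auto
  have le: "g / z' ^ (2 * k + 2) \<le> g / z ^ (2 * k + 2)" if "0 \<le> g" for g k
    using pw[of k] that z assms(2) by (intro divide_left_mono mult_pos_pos zero_less_power) auto
  have BB: "beta z' \<le> beta z" unfolding beta_def
    using cmom_bound(1) by (intro suminf_le le summable_beta assms b)
  \<comment> \<open>Strictness comes from the term \<open>k = 0\<close>, where
    \<open>mom 0 = 1\<close>; all higher moments may vanish.\<close>
  have "0 < (\<Sum>k. mom k / z ^ (2 * k + 2) - mom k / z' ^ (2 * k + 2))"
  proof (rule suminf_pos2[of _ 0])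
    show "summable (\<lambda>k. mom k / z ^ (2 * k + 2) - mom k / z' ^ (2 * k + 2))"
      by (intro summable_diff summable_alpha assms b)
    show "0 \<le> mom k / z ^ (2 * k + 2) - mom k / z' ^ (2 * k + 2)" for k using le[OF mom(1)[of k], of k] by simp
    have "1 / z' ^ 2 < 1 / z ^ 2" using assms z by (intro divide_strict_left_mono power_strict_mono) auto
    then show "0 < mom 0 / z ^ (2 * 0 + 2) - mom 0 / z' ^ (2 * 0 + 2)" by (simp add: mom power2_eq_square)
  qed
  also have "\<dots> = alpha z - alpha z'" unfolding alpha_def
    by (intro suminf_diff[symmetric] summable_alpha assms b)
  finally have AA: "alpha z' < alpha z" by simp
  have "D z' \<le> alpha z' * (1 + beta z)"
    unfolding D_def using BB alpha_pos[OF b] by (intro mult_left_mono) auto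
  also have "\<dots> < D z"
    unfolding D_def using AA beta_nonneg[OF assms(1)] by (intro mult_strict_right_mono) auto
  finally show ?thesis .
qed

text \<open>\<open>D\<close> in the variable \<open>x = 1/z\<^sup>2\<close>, in which it is built from power series.\<close>

definition F :: "real \<Rightarrow> real" where
  "F x = x * (\<Sum>k. mom k * x ^ k) * (1 + x * (\<Sum>k. (c * mom (Suc k)) * x ^ k))"

lemma D_eq_F:
  assumes "b < z"
  shows "D z = F (1 / z\<^sup>2)"
proof -
  have z: "z > 0" using assms b_nonneg by simp
  have scale: "(\<Sum>k. g k / z ^ (2 * k + 2)) = (1 / z\<^sup>2) * (\<Sum>k. g k * (1 / z\<^sup>2) ^ k)"
    if "summable (\<lambda>k. g k / z ^ (2 * k + 2))" for g
  proof -
    have eq: "g k * (1 / z\<^sup>2) ^ k = z\<^sup>2 * (g k / z ^ (2 * k + 2))" for k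
      using z by (intro power_series_term) simp
    show ?thesis unfolding eq using suminf_mult[OF that, of "z\<^sup>2"] z by simp
  qed
  show ?thesis
    unfolding D_def F_def alpha_def beta_def scale[OF summable_alpha[OF assms]] scale[OF summable_beta[OF assms]] ..
qed

lemma isCont_F:
  assumes x: "0 \<le> x" "x < 1 / y\<^sup>2" and y: "b < y"
  shows "isCont F x"
proof -
  have y0: "y > 0" using y b_nonneg by simp
  have cont: "isCont (\<lambda>x. \<Sum>k. g k * x ^ k) x" if "summable (\<lambda>k. g k / y ^ (2 * k + 2))" for g :: "nat \<Rightarrow> real"
  proof (rule isCont_powser)
    have "g k * (1 / y\<^sup>2) ^ k = y\<^sup>2 * (g k / y ^ (2 * k + 2))" for k
      using y0 by (intro power_series_term) simp
    then show "summable (\<lambda>k. g k * (1 / y\<^sup>2) ^ k)" using summable_mult[OF that] by simp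
    show "norm x < norm (1 / y\<^sup>2)" using x by simp
  qed
  show ?thesis
    unfolding F_def[abs_def] by (intro continuous_intros cont summable_alpha summable_beta y)
qed

lemma isCont_D:
  assumes "b < z"
  shows "isCont D z"
proof -
  \<comment> \<open>The series still converge at \<open>1 / y\<^sup>2\<close>, and
    \<open>1 / z\<^sup>2\<close> lies strictly inside that disc.\<close>
  define y where "y = (b + z) / 2"
  have y: "b < y" "y < z" "0 < y" "0 < z" using assms b_nonneg by (auto simp: y_def)
  have "isCont (\<lambda>z. F (1 / z\<^sup>2)) z"
  proof (rule isCont_o2[where g = F])
    show "isCont (\<lambda>z. 1 / z\<^sup>2) z" using y by (intro continuous_intros) auto
    show "isCont F (1 / z\<^sup>2)"
      using y by (intro isCont_F[of _ y]) (auto intro!: divide_strict_left_mono power_strict_mono)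
  qed
  moreover have "\<forall>\<^sub>F z in nhds z. F (1 / z\<^sup>2) = D z"
    using assms D_eq_F by (auto simp: eventually_nhds intro!: exI[of _ "{b<..}"])
  ultimately show ?thesis by (simp add: isCont_cong)
qed

text \<open>In the variable 1/z^2 infinity becomes the point 0, where \<open>F\<close> is continuous
  and vanishes.\<close>

lemma D_tendsto_0: "(D \<longlongrightarrow> 0) at_top"
proof -
  have "isCont F 0" using b_nonneg by (intro isCont_F[of _ "b + 1"]) auto
  then have F0: "(F \<longlongrightarrow> F 0) (nhds 0)" by (simp add: isCont_def tendsto_at_iff_tendsto_nhds)
  have "((\<lambda>z::real. 1 / z\<^sup>2) \<longlongrightarrow> 0) at_top"
    by (intro tendsto_divide_0[OF tendsto_const] filterlim_at_top_imp_at_infinity filterlim_pow_at_top filterlim_ident) auto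
  with F0 have "((\<lambda>z. F (1 / z\<^sup>2)) \<longlongrightarrow> F 0) at_top" by (rule filterlim_compose)
  moreover have "\<forall>\<^sub>F z in at_top. F (1 / z\<^sup>2) = D z"
    using eventually_gt_at_top[of b] by eventually_elim (simp add: D_eq_F)
  ultimately show ?thesis
    by (subst (asm) tendsto_cong) (auto simp: F_def)
qed

text \<open>This is the value at b from the right, possibly infinite. As a supremum it exists
  without a limit argument, and monotonicity identifies it with the limit.\<close>

definition D_sup :: ereal where "D_sup = (SUP z\<in>{b<..}. ereal (D z))"

lemma D_less_sup:
  assumes "b < z"
  shows "ereal (D z) < D_sup"
proof -
  have "b < (b + z) / 2" "(b + z) / 2 < z" using assms by auto
  then have "ereal (D z) < ereal (D ((b + z) / 2))" using D_strict_decreasing by simp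
  also have "\<dots> \<le> D_sup" unfolding D_sup_def using assms by (intro SUP_upper) auto
  finally show ?thesis .
qed

lemma D_right_limit: "((\<lambda>z. ereal (D z)) \<longlongrightarrow> D_sup) (at_right b)"
proof (rule order_tendstoI)
  fix a assume "a < D_sup"
  then obtain z0 where z0: "b < z0" "a < ereal (D z0)" unfolding D_sup_def less_SUP_iff by auto
  show "\<forall>\<^sub>F z in at_right b. a < ereal (D z)"
    unfolding eventually_at_right_field
  proof (intro exI[of _ z0] conjI allI impI z0)
    fix z assume "b < z" "z < z0"
    then show "a < ereal (D z)"
      using D_strict_decreasing[of z z0] z0(2) by (meson ereal_less(2) less_ereal.simps(1) less_trans)
  qed
next
  fix a assume "D_sup < a"
  then show "\<forall>\<^sub>F z in at_right b. ereal (D z) < a"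
    using D_less_sup less_trans unfolding eventually_at_right_field by (meson gt_ex)
qed

lemma D_attains:
  assumes "0 < y" "ereal y < D_sup"
  shows "\<exists>z>b. D z = y"
proof -
  obtain z1 where z1: "b < z1" "y < D z1" using assms(2) unfolding D_sup_def less_SUP_iff by auto
  have "\<forall>\<^sub>F z in at_top. D z < y" using D_tendsto_0 assms(1) by (rule order_tendstoD)
  then obtain z2 where z2: "z1 < z2" "D z2 < y"
    using eventually_conj[OF _ eventually_gt_at_top[of z1]] by (metis (mono_tags, lifting) eventually_happens trivial_limit_at_top_linorder)
  have "\<exists>z\<ge>z1. z \<le> z2 \<and> D z = y"
    using z1 z2 by (intro IVT2) (auto intro!: isCont_D)
  then show ?thesis using z1 by (metis less_le_trans)
qed

end

text \<open>A deterministic model of a single trajectory. The factor \<open>c\<close> and the shift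
  to \<open>Suc k\<close> in \<open>vv\<close> have the following origin: 1/m times the trace of the
  (k+1)-st power of the Gram operator is n/m times its normalized trace. The limits being diagonal
  is what separates the r perturbations from each other, and \<open>vu\<close> separates the left
  vectors from the right ones.\<close>

locale converging_forms = moment_sequence mom c b
  for m :: "nat \<Rightarrow> nat" and X :: "nat \<Rightarrow> nat \<Rightarrow> nat \<Rightarrow> complex"
    and u v :: "nat \<Rightarrow> nat \<Rightarrow> nat \<Rightarrow> complex" and r :: nat and mom :: "nat \<Rightarrow> real" and c b :: real +
  assumes kern: "kern n (m n) (X n)"
    and u_vec: "i < r \<Longrightarrow> u n i \<in> vecs n"
    and uu: "i < r \<Longrightarrow> j < r \<Longrightarrow> (\<lambda>n. ip n ((gram (X n) n (m n) ^^ k) (u n i)) (u n j))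
        \<longlonglongrightarrow> (if i = j then complex_of_real (mom k) else 0)"
    and vv: "i < r \<Longrightarrow> j < r \<Longrightarrow>
      (\<lambda>n. ip n ((gram (X n) n (m n) ^^ k) (mulv (X n) (m n) (v n i))) (mulv (X n) (m n) (v n j)))
        \<longlonglongrightarrow> (if i = j then complex_of_real (c * mom (Suc k)) else 0)"
    and vu: "i < r \<Longrightarrow> j < r \<Longrightarrow>
      (\<lambda>n. ip n ((gram (X n) n (m n) ^^ k) (mulv (X n) (m n) (v n i))) (u n j)) \<longlonglongrightarrow> 0"
    and v_orth: "i < r \<Longrightarrow> j < r \<Longrightarrow> (\<lambda>n. ip (m n) (v n i) (v n j)) \<longlonglongrightarrow> (if i = j then 1 else 0)"
    and norm_bound: "b < s \<Longrightarrow>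
      \<forall>\<^sub>F n in sequentially. \<forall>x\<in>vecs n. nsq (m n) (adjv (X n) n x) \<le> s\<^sup>2 * nsq n x"
begin

abbreviation xv :: "nat \<Rightarrow> nat \<Rightarrow> nat \<Rightarrow> complex" where
  "xv n i \<equiv> mulv (X n) (m n) (v n i)"

abbreviation S :: "nat \<Rightarrow> (nat \<Rightarrow> complex) \<Rightarrow> nat \<Rightarrow> complex" where
  "S n \<equiv> gram (X n) n (m n)"

text \<open>Both bounds apply the truncated resolvent to such vectors: the lower one with
  \<open>a = 1\<close> and \<open>t = \<theta> * alpha\<close>, the upper one with
  \<open>a = 1 / alpha\<close> and \<open>t = \<theta>\<close>. For equal z the two choices are
  proportional.\<close>

definition hv :: "(nat \<Rightarrow> real) \<Rightarrow> (nat \<Rightarrow> real) \<Rightarrow> nat \<Rightarrow> nat \<Rightarrow> nat \<Rightarrow> complex" where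
  "hv a t n i = (\<lambda>q. complex_of_real (a i) * u n i q + complex_of_real (t i) * xv n i q)"

definition hmom :: "(nat \<Rightarrow> real) \<Rightarrow> (nat \<Rightarrow> real) \<Rightarrow> nat \<Rightarrow> nat \<Rightarrow> real" where
  "hmom a t i k = (a i)\<^sup>2 * mom k + (t i)\<^sup>2 * (c * mom (Suc k))"

lemma hv_vec: "i < r \<Longrightarrow> hv a t n i \<in> vecs n"
  unfolding hv_def using kern by (intro vecs_add vecs_scale u_vec mulv_in_vecs)

lemma uv:
  assumes "i < r" "j < r"
  shows "(\<lambda>n. ip n ((S n ^^ k) (u n i)) (xv n j)) \<longlonglongrightarrow> 0"
proof -
  have "(\<lambda>n. cnj (ip n ((S n ^^ k) (xv n j)) (u n i))) \<longlonglongrightarrow> cnj 0"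
    by (intro tendsto_cnj vu assms)
  then show ?thesis by (simp add: cnj_ip ip_gram_pow_swap[symmetric])
qed

lemma ip_gram_pow_hv:
  "ip n ((S n ^^ k) (hv a t n i)) y =
    complex_of_real (a i) * ip n ((S n ^^ k) (u n i)) y + complex_of_real (t i) * ip n ((S n ^^ k) (xv n i)) y"
  unfolding hv_def by (subst (1 2 3) ip_gram_pow_swap) (simp add: ip_add_left ip_scale_left)

lemma hv_u:
  assumes "i < r" "j < r"
  shows "(\<lambda>n. ip n ((S n ^^ k) (hv a t n i)) (u n j)) \<longlonglongrightarrow> (if i = j then complex_of_real (a i * mom k) else 0)"
  unfolding ip_gram_pow_hv
  using tendsto_add[OF tendsto_mult[OF tendsto_const[of "complex_of_real (a i)"] uu[OF assms, of k]]
      tendsto_mult[OF tendsto_const[of "complex_of_real (t i)"] vu[OF assms, of k]]]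
  by (cases "i = j") simp_all

lemma hv_xv:
  assumes "i < r" "j < r"
  shows "(\<lambda>n. ip n ((S n ^^ k) (hv a t n i)) (xv n j)) \<longlonglongrightarrow>
    (if i = j then complex_of_real (t i * (c * mom (Suc k))) else 0)"
  unfolding ip_gram_pow_hv
  using tendsto_add[OF tendsto_mult[OF tendsto_const[of "complex_of_real (a i)"] uv[OF assms, of k]]
      tendsto_mult[OF tendsto_const[of "complex_of_real (t i)"] vv[OF assms, of k]]]
  by (cases "i = j") simp_all

lemma hv_hv:
  assumes "i < r" "j < r"
  shows "(\<lambda>n. ip n ((S n ^^ k) (hv a t n i)) (hv a t n j)) \<longlonglongrightarrow>
    (if i = j then complex_of_real (hmom a t i k) else 0)"
proof -
  have "(\<lambda>n. complex_of_real (a j) * ip n ((S n ^^ k) (hv a t n i)) (u n j) +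
      complex_of_real (t j) * ip n ((S n ^^ k) (hv a t n i)) (xv n j)) \<longlonglongrightarrow>
    (if i = j then complex_of_real (hmom a t i k) else 0)"
    using tendsto_add[OF tendsto_mult[OF tendsto_const[of "complex_of_real (a j)"] hv_u[OF assms, of k a t]]
        tendsto_mult[OF tendsto_const[of "complex_of_real (t j)"] hv_xv[OF assms, of k a t]]]
    by (cases "i = j") (simp_all add: hmom_def power2_eq_square mult.assoc)
  then show ?thesis
    by (subst (2) hv_def) (simp add: ip_add_right ip_scale_right)
qed

definition trunc :: "(nat \<Rightarrow> real) \<Rightarrow> nat \<Rightarrow> real \<Rightarrow> real" where
  "trunc g N z = (\<Sum>k<N. g k / z ^ (2 * k + 2))"

definition tail :: "(nat \<Rightarrow> real) \<Rightarrow> nat \<Rightarrow> real \<Rightarrow> real" where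
  "tail g N z = (\<Sum>k<N. g (N + k) / z ^ (2 * N) / z ^ (2 * k + 2))"

lemma nres_u:
  assumes "i < r" "j < r"
  shows "(\<lambda>n. ip n (nres (X n) n (m n) N z (hv a t n i)) (u n j)) \<longlonglongrightarrow>
    (if i = j then complex_of_real (a i * trunc mom N z) else 0)"
proof -
  have "(\<lambda>n. \<Sum>k<N. complex_of_real (1 / z ^ (2 * k + 2)) * ip n ((S n ^^ k) (hv a t n i)) (u n j)) \<longlonglongrightarrow>
    (\<Sum>k<N. complex_of_real (1 / z ^ (2 * k + 2)) * (if i = j then complex_of_real (a i * mom k) else 0))"
    by (intro tendsto_intros hv_u assms)
  then show ?thesis unfolding ip_nres
    by (cases "i = j") (simp_all add: trunc_def sum_distrib_left)
qed

lemma nres_xv: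
  assumes "i < r" "j < r"
  shows "(\<lambda>n. ip n (nres (X n) n (m n) N z (hv a t n i)) (xv n j)) \<longlonglongrightarrow>
    (if i = j then complex_of_real (t i * trunc (\<lambda>k. c * mom (Suc k)) N z) else 0)"
proof -
  have "(\<lambda>n. \<Sum>k<N. complex_of_real (1 / z ^ (2 * k + 2)) * ip n ((S n ^^ k) (hv a t n i)) (xv n j)) \<longlonglongrightarrow>
    (\<Sum>k<N. complex_of_real (1 / z ^ (2 * k + 2)) * (if i = j then complex_of_real (t i * (c * mom (Suc k))) else 0))"
    by (intro tendsto_intros hv_xv assms)
  then show ?thesis unfolding ip_nres
    by (cases "i = j") (simp_all add: trunc_def sum_distrib_left)
qed

lemma nres_form:
  assumes "i < r" "j < r" "z \<noteq> 0"
  shows "(\<lambda>n. complex_of_real (z\<^sup>2) *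
        ip n (nres (X n) n (m n) N z (hv a t n i)) (nres (X n) n (m n) N z (hv a t n j)) -
      ip n (S n (nres (X n) n (m n) N z (hv a t n i))) (nres (X n) n (m n) N z (hv a t n j))) \<longlonglongrightarrow>
    (if i = j then complex_of_real (trunc (hmom a t i) N z - tail (hmom a t i) N z) else 0)"
proof -
  have "(\<lambda>n. \<Sum>k<N. complex_of_real (1 / z ^ (2 * k + 2)) * (ip n ((S n ^^ k) (hv a t n i)) (hv a t n j) -
      complex_of_real (1 / z ^ (2 * N)) * ip n ((S n ^^ (N + k)) (hv a t n i)) (hv a t n j))) \<longlonglongrightarrow>
    (\<Sum>k<N. complex_of_real (1 / z ^ (2 * k + 2)) * ((if i = j then complex_of_real (hmom a t i k) else 0) -
      complex_of_real (1 / z ^ (2 * N)) * (if i = j then complex_of_real (hmom a t i (N + k)) else 0)))"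
    by (intro tendsto_intros hv_hv assms)
  then show ?thesis unfolding ip_nres_form[OF assms(3)]
    by (cases "i = j") (simp_all add: trunc_def tail_def sum_subtractf[symmetric] diff_divide_distrib)
qed

lemma bounded_moments:
  assumes z: "b < z" and g: "\<And>k. 0 \<le> g k" "\<And>k. g k \<le> C * b ^ (2 * k)"
  shows "(\<lambda>N. trunc g N z) \<longlonglongrightarrow> (\<Sum>k. g k / z ^ (2 * k + 2))" "(\<lambda>N. tail g N z) \<longlonglongrightarrow> 0"
  unfolding trunc_def tail_def
  using power_series_truncation[OF g b_nonneg z] summable_LIMSEQ by blast+

lemma hmom_bound: "0 \<le> hmom a t i k" "hmom a t i k \<le> ((a i)\<^sup>2 + (t i)\<^sup>2 * (c * b\<^sup>2)) * b ^ (2 * k)"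
proof -
  show "0 \<le> hmom a t i k" using mom(1) cmom_bound(1) by (simp add: hmom_def)
  have "(a i)\<^sup>2 * mom k \<le> (a i)\<^sup>2 * b ^ (2 * k)" by (intro mult_left_mono mom) auto
  moreover have "(t i)\<^sup>2 * (c * mom (Suc k)) \<le> (t i)\<^sup>2 * ((c * b\<^sup>2) * b ^ (2 * k))"
    by (intro mult_left_mono cmom_bound) auto
  ultimately show "hmom a t i k \<le> ((a i)\<^sup>2 + (t i)\<^sup>2 * (c * b\<^sup>2)) * b ^ (2 * k)"
    by (simp add: hmom_def algebra_simps)
qed

lemma trunc_mom: "b < z \<Longrightarrow> (\<lambda>N. trunc mom N z) \<longlonglongrightarrow> alpha z"
  unfolding alpha_def by (rule bounded_moments(1)[OF _ mom(1) mom_bound])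

lemma trunc_cmom: "b < z \<Longrightarrow> (\<lambda>N. trunc (\<lambda>k. c * mom (Suc k)) N z) \<longlonglongrightarrow> beta z"
  unfolding beta_def by (rule bounded_moments(1)[OF _ cmom_bound(1) cmom_bound(2)])

lemma trunc_hmom:
  assumes "b < z"
  shows "(\<lambda>N. trunc (hmom a t i) N z) \<longlonglongrightarrow> (a i)\<^sup>2 * alpha z + (t i)\<^sup>2 * beta z"
proof -
  have "trunc (hmom a t i) N z = (a i)\<^sup>2 * trunc mom N z + (t i)\<^sup>2 * trunc (\<lambda>k. c * mom (Suc k)) N z" for N
    by (simp add: trunc_def hmom_def sum_distrib_left add_divide_distrib sum.distrib)
  then show ?thesis using trunc_mom[OF assms] trunc_cmom[OF assms] by (auto intro!: tendsto_intros)
qed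

lemma tail_hmom: "b < z \<Longrightarrow> (\<lambda>N. tail (hmom a t i) N z) \<longlonglongrightarrow> 0"
  by (rule bounded_moments(2)[OF _ hmom_bound(1) hmom_bound(2)])

text \<open>The quotient is the limit in n of the squared norm of the remainder left by the
  truncated resolvent, that is, of the \<open>N\<close>-th power of the Gram operator applied to
  \<open>hv\<close> and divided by \<open>z ^ (2 * N)\<close>.\<close>

lemma power_ratio_tendsto_0:
  assumes "b < z"
  shows "(\<lambda>N. hmom a t i (N + N) / z ^ (4 * N)) \<longlonglongrightarrow> 0"
proof -
  have z: "z > 0" using assms b_nonneg by simp
  define C where "C = (a i)\<^sup>2 + (t i)\<^sup>2 * (c * b\<^sup>2)"
  have "(\<lambda>N. C * ((b / z) ^ 4) ^ N) \<longlonglongrightarrow> C * 0"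
    using assms z b_nonneg
    by (intro tendsto_mult tendsto_const LIMSEQ_realpow_zero) (auto simp: power_less_one_iff)
  then have lim: "(\<lambda>N. C * ((b / z) ^ 4) ^ N) \<longlonglongrightarrow> 0" by simp
  have "hmom a t i (N + N) / z ^ (4 * N) \<le> C * ((b / z) ^ 4) ^ N" for N
  proof -
    have "hmom a t i (N + N) \<le> C * b ^ (4 * N)"
      using hmom_bound(2)[of a t i "N + N"] by (simp add: C_def mult_2[symmetric])
    then show ?thesis using z by (simp add: power_divide power_mult divide_right_mono)
  qed
  then show ?thesis using z hmom_bound(1)
    by (intro tendsto_sandwich[OF _ _ tendsto_const lim]) (auto intro!: always_eventually)
qed

text \<open>Only the contribution of the update is computed; subtracting the limit in
  \<open>nres_form\<close> from it gives the whole form. The diagonal limits of \<open>x_u\<close>,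
  \<open>x_xv\<close> and \<open>v_orth\<close> collapse the sums over the rank.\<close>

lemma update_form_limit:
  fixes U Z :: "nat \<Rightarrow> real"
  assumes x_u: "\<And>j l. j < r \<Longrightarrow> l < r \<Longrightarrow> (\<lambda>n. ip n (x n j) (u n l)) \<longlonglongrightarrow> (if j = l then complex_of_real (U j) else 0)"
    and x_xv: "\<And>j l. j < r \<Longrightarrow> l < r \<Longrightarrow> (\<lambda>n. ip n (x n j) (xv n l)) \<longlonglongrightarrow> (if j = l then complex_of_real (Z j) else 0)"
    and jk: "j < r" "k < r"
  shows "(\<lambda>n. ip (m n) (adjv (rank_update (X n) r \<theta> (u n) (v n)) n (x n j)) (adjv (rank_update (X n) r \<theta> (u n) (v n)) n (x n k))
      - ip n (S n (x n j)) (x n k)) \<longlonglongrightarrow>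
    (if j = k then complex_of_real (2 * \<theta> j * U j * Z j + (\<theta> j)\<^sup>2 * (U j)\<^sup>2) else 0)"
proof -
  have 1: "(\<lambda>n. \<Sum>i<r. complex_of_real (\<theta> i) * (cnj (ip n (x n k) (u n i)) * ip n (x n j) (xv n i) +
       ip n (x n j) (u n i) * cnj (ip n (x n k) (xv n i)))) \<longlonglongrightarrow>
    (\<Sum>i<r. complex_of_real (\<theta> i) * (cnj (if k = i then complex_of_real (U k) else 0) * (if j = i then complex_of_real (Z j) else 0) +
       (if j = i then complex_of_real (U j) else 0) * cnj (if k = i then complex_of_real (Z k) else 0)))"
    by (intro tendsto_intros x_u x_xv jk) auto
  have 2: "(\<lambda>n. \<Sum>i<r. \<Sum>l<r. complex_of_real (\<theta> i * \<theta> l) * (ip n (x n j) (u n i) * cnj (ip n (x n k) (u n l)) *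
      ip (m n) (v n i) (v n l))) \<longlonglongrightarrow>
    (\<Sum>i<r. \<Sum>l<r. complex_of_real (\<theta> i * \<theta> l) * ((if j = i then complex_of_real (U j) else 0) *
      cnj (if k = l then complex_of_real (U k) else 0) * (if i = l then 1 else 0)))"
    by (intro tendsto_intros x_u x_xv jk v_orth) auto
  have s1: "(\<Sum>i<r. complex_of_real (\<theta> i) * (cnj (if k = i then complex_of_real (U k) else 0) * (if j = i then complex_of_real (Z j) else 0) +
       (if j = i then complex_of_real (U j) else 0) * cnj (if k = i then complex_of_real (Z k) else 0))) =
    (if j = k then complex_of_real (2 * \<theta> j * U j * Z j) else 0)"
    using jk by (simp add: if_distrib distrib_left sum.distrib cong: if_cong)
  have s2: "(\<Sum>i<r. \<Sum>l<r. complex_of_real (\<theta> i * \<theta> l) * ((if j = i then complex_of_real (U j) else 0) *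
      cnj (if k = l then complex_of_real (U k) else 0) * (if i = l then 1 else 0))) =
    (if j = k then complex_of_real ((\<theta> j)\<^sup>2 * (U j)\<^sup>2) else 0)"
  proof -
    have "(\<Sum>l<r. complex_of_real (\<theta> i * \<theta> l) * ((if j = i then complex_of_real (U j) else 0) *
      cnj (if k = l then complex_of_real (U k) else 0) * (if i = l then 1 else 0))) =
      (if i = j then if j = k then complex_of_real ((\<theta> j)\<^sup>2 * (U j)\<^sup>2) else 0 else 0)" for i
      using jk by (auto simp: if_distrib power2_eq_square mult_ac cong: if_cong)
    then show ?thesis using jk by simp
  qed
  show ?thesis
    unfolding ip_adjv_rank_update
    using tendsto_add[OF 1 2] unfolding s1 s2
    by (simp add: add.assoc) (auto split: if_splits)
qed

end

section \<open>Lower and upper bounds for the singular values of the update\<close>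

context converging_forms
begin

text \<open>Test vectors \<open>(z\<^sup>2 - X X\<^sup>*)\<^sup>-\<^sup>1 (u\<^sub>j + \<theta>\<^sub>j \<alpha> X v\<^sub>j)\<close>: on them \<open>\<bar>A\<^sup>* x\<bar>\<^sup>2 - z\<^sup>2 \<bar>x\<bar>\<^sup>2\<close> tends to the diagonal form
  with entries \<open>\<alpha> (\<theta>\<^sub>j\<^sup>2 \<alpha> (1 + \<beta>) - 1)\<close>.\<close>

lemma eventually_singular_value_gt:
  assumes z: "b < z" and i: "i < r"
    and \<theta>: "\<And>j. j \<le> i \<Longrightarrow> 1 < (\<theta> j)\<^sup>2 * (alpha z * (1 + beta z))"
  shows "\<forall>\<^sub>F n in sequentially. \<forall>A\<in>carrier_mat n (m n).
    entries A = rank_update (X n) r \<theta> (u n) (v n) \<longrightarrow> z < singular_value A (Suc i)"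
proof -
  have z0: "z > 0" using z b_nonneg by simp
  define a where "a = (\<lambda>_::nat. 1::real)"
  \<comment> \<open>For general t the limiting diagonal entry is 2 \<theta> \<alpha> \<beta> t +
    \<theta>^2 \<alpha>^2 - \<alpha> - t^2 \<beta>. It is largest at t = \<theta> \<alpha>.\<close>
  define t where "t = (\<lambda>j. \<theta> j * alpha z)"
  define \<phi> where "\<phi> = (\<lambda>N j. 2 * \<theta> j * (a j * trunc mom N z) * (t j * trunc (\<lambda>k. c * mom (Suc k)) N z) +
      (\<theta> j)\<^sup>2 * (a j * trunc mom N z)\<^sup>2 - (trunc (hmom a t j) N z - tail (hmom a t j) N z))"
  have "\<forall>\<^sub>F N in sequentially. \<forall>j\<in>{..i}. 0 < \<phi> N j"
  proof (intro eventually_ball_finite ballI)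
    fix j assume j: "j \<in> {..i}"
    have "(\<lambda>N. \<phi> N j) \<longlonglongrightarrow> 2 * \<theta> j * (a j * alpha z) * (t j * beta z) + (\<theta> j)\<^sup>2 * (a j * alpha z)\<^sup>2 -
        (((a j)\<^sup>2 * alpha z + (t j)\<^sup>2 * beta z) - 0)"
      unfolding \<phi>_def by (intro tendsto_intros trunc_mom trunc_cmom trunc_hmom tail_hmom z)
    also have "2 * \<theta> j * (a j * alpha z) * (t j * beta z) + (\<theta> j)\<^sup>2 * (a j * alpha z)\<^sup>2 -
        (((a j)\<^sup>2 * alpha z + (t j)\<^sup>2 * beta z) - 0) =
        alpha z * ((\<theta> j)\<^sup>2 * (alpha z * (1 + beta z)) - 1)"
      by (simp add: a_def t_def power2_eq_square algebra_simps)
    finally have lim: "(\<lambda>N. \<phi> N j) \<longlonglongrightarrow> alpha z * ((\<theta> j)\<^sup>2 * (alpha z * (1 + beta z)) - 1)" .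
    have "0 < alpha z * ((\<theta> j)\<^sup>2 * (alpha z * (1 + beta z)) - 1)"
      using \<theta>[of j] j alpha_pos[OF z] by simp
    with lim show "\<forall>\<^sub>F N in sequentially. 0 < \<phi> N j" by (rule order_tendstoD)
  qed simp
  then obtain N where N: "\<And>j. j \<le> i \<Longrightarrow> 0 < \<phi> N j"
    by (auto simp: eventually_sequentially)
  define x where "x = (\<lambda>n j. nres (X n) n (m n) N z (hv a t n j))"
  define B where "B = (\<lambda>n. rank_update (X n) r \<theta> (u n) (v n))"
  define f where "f = (\<lambda>n j k. ip (m n) (adjv (B n) n (x n j)) (adjv (B n) n (x n k)) -
      complex_of_real (z\<^sup>2) * ip n (x n j) (x n k))"
  have lim: "(\<lambda>n. f n j k) \<longlonglongrightarrow> (if j = k then complex_of_real (\<phi> N j) else 0)"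
    if jk: "j \<in> {..i}" "k \<in> {..i}" for j k
  proof -
    have jk': "j < r" "k < r" using jk i by auto
    have "(\<lambda>n. (ip (m n) (adjv (B n) n (x n j)) (adjv (B n) n (x n k)) - ip n (S n (x n j)) (x n k)) -
        (complex_of_real (z\<^sup>2) * ip n (x n j) (x n k) - ip n (S n (x n j)) (x n k))) \<longlonglongrightarrow>
      (if j = k then complex_of_real (2 * \<theta> j * (a j * trunc mom N z) * (t j * trunc (\<lambda>k. c * mom (Suc k)) N z) +
          (\<theta> j)\<^sup>2 * (a j * trunc mom N z)\<^sup>2) else 0) -
      (if j = k then complex_of_real (trunc (hmom a t j) N z - tail (hmom a t j) N z) else 0)"
      unfolding B_def x_def using z0
      by (intro tendsto_diff update_form_limit nres_u nres_xv nres_form jk') auto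
    then show ?thesis by (cases "j = k") (simp_all add: f_def \<phi>_def)
  qed
  have "\<forall>\<^sub>F n in sequentially. \<forall>c::nat \<Rightarrow> complex. (\<exists>j\<in>{..i}. c j \<noteq> 0) \<longrightarrow>
      0 < Re (\<Sum>j\<in>{..i}. \<Sum>k\<in>{..i}. c j * cnj (c k) * f n j k)"
    using eventually_form_positive[of "{..i}" f "\<phi> N", OF _ lim] N by simp
  then show ?thesis using eventually_gt_at_top[of i]
  proof eventually_elim
    case (elim n)
    show ?case
    proof (intro ballI impI, rule ccontr)
      fix A assume A: "A \<in> carrier_mat n (m n)" "entries A = rank_update (X n) r \<theta> (u n) (v n)"
        and "\<not> z < singular_value A (Suc i)"
      then obtain g where g: "\<And>y. y \<in> vecs n \<Longrightarrow> \<forall>j<i. ip n y (g j) = 0 \<Longrightarrow>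
          nsq (m n) (adjv (B n) n y) \<le> z\<^sup>2 * nsq n y"
        using singular_value_le_iff[OF A(1) elim(2), of z] z0 by (auto simp: B_def)
      \<comment> \<open>There are \<open>i + 1\<close> test vectors, and Courant-Fischer imposes
        only \<open>i\<close> constraints, so some nonzero combination satisfies them all.\<close>
      obtain d where d: "\<exists>l<Suc i. d l \<noteq> 0" "\<And>j. j < i \<Longrightarrow> (\<Sum>l<Suc i. d l * ip n (x n l) (g j)) = 0"
        using nontrivial_combination[of i "Suc i" "\<lambda>l j. ip n (x n l) (g j)"] by auto
      define y where "y = lc (Suc i) d (x n)"
      have y: "y \<in> vecs n"
        unfolding y_def x_def using i by (intro lc_in_vecs nres_in_vecs kern hv_vec) simp
      have "complex_of_real (nsq (m n) (adjv (B n) n y) - z\<^sup>2 * nsq n y) =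
          ip (m n) (adjv (B n) n y) (adjv (B n) n y) - complex_of_real (z\<^sup>2) * ip n y y"
        by (simp add: ip_self)
      also have "\<dots> = (\<Sum>j<Suc i. \<Sum>k<Suc i. d j * cnj (d k) * f n j k)"
        unfolding y_def adjv_lc ip_lc_left
        by (simp only: ip_lc_right f_def sum_distrib_left sum_subtractf[symmetric] right_diff_distrib mult_ac)
      finally have "nsq (m n) (adjv (B n) n y) - z\<^sup>2 * nsq n y =
          Re (\<Sum>j\<in>{..i}. \<Sum>k\<in>{..i}. d j * cnj (d k) * f n j k)"
        by (metis Re_complex_of_real lessThan_Suc_atMost)
      moreover have "\<exists>j\<in>{..i}. d j \<noteq> 0" using d(1) by (auto simp: less_Suc_eq_le)
      ultimately have "nsq (m n) (adjv (B n) n y) - z\<^sup>2 * nsq n y > 0" using elim(1) by simp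
      moreover have "nsq (m n) (adjv (B n) n y) \<le> z\<^sup>2 * nsq n y"
        using d(2) by (intro g y) (simp add: y_def ip_lc_left)
      ultimately show False by simp
    qed
  qed
qed

text \<open>The constraints are \<open>\<langle>x, u\<^sub>j\<rangle> = 0\<close> for \<open>j < i\<close>. The gap between \<open>z'\<close> and \<open>z\<close> pays for the remainder of the
  truncated resolvent.\<close>

lemma eventually_singular_value_le:
  assumes z: "b < z'" "z' < z"
    and \<theta>: "\<And>j. i \<le> j \<Longrightarrow> j < r \<Longrightarrow> (\<theta> j)\<^sup>2 * (alpha z' * (1 + beta z')) < 1"
  shows "\<forall>\<^sub>F n in sequentially. \<forall>A\<in>carrier_mat n (m n).
    entries A = rank_update (X n) r \<theta> (u n) (v n) \<longrightarrow> singular_value A (Suc i) \<le> z"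
proof -
  have z0: "z' > 0" using z b_nonneg by simp
  define \<delta> where "\<delta> = z\<^sup>2 - z'\<^sup>2"
  have \<delta>: "\<delta> > 0" using z z0 by (simp add: \<delta>_def power_strict_mono)
  \<comment> \<open>For general \<gamma> the limit of \<psi> is \<gamma>^2 \<alpha> + \<theta>^2
    \<beta> + \<theta>^2 - 2 \<gamma>. It is smallest at \<gamma> = 1/\<alpha>.\<close>
  define \<gamma> where "\<gamma> = 1 / alpha z'"
  have \<alpha>: "alpha z' > 0" by (rule alpha_pos[OF z(1)])
  define a where "a = (\<lambda>_::nat. \<gamma>)"
  define J where "J = {i..<r}"
  define \<psi> where "\<psi> = (\<lambda>N l. hmom a \<theta> l (N + N) / z' ^ (4 * N) / \<delta> +
      (trunc (hmom a \<theta> l) N z' - tail (hmom a \<theta> l) N z') + (\<theta> l)\<^sup>2 - 2 * \<gamma>)"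
  have "\<forall>\<^sub>F N in sequentially. \<forall>l\<in>J. \<psi> N l < 0"
  proof (intro eventually_ball_finite ballI)
    fix l assume l: "l \<in> J"
    have "(\<lambda>N. \<psi> N l) \<longlonglongrightarrow> 0 / \<delta> + (((a l)\<^sup>2 * alpha z' + (\<theta> l)\<^sup>2 * beta z') - 0) + (\<theta> l)\<^sup>2 - 2 * \<gamma>"
      unfolding \<psi>_def using \<delta>
      by (intro tendsto_intros power_ratio_tendsto_0 trunc_hmom tail_hmom z) auto
    also have "0 / \<delta> + (((a l)\<^sup>2 * alpha z' + (\<theta> l)\<^sup>2 * beta z') - 0) + (\<theta> l)\<^sup>2 - 2 * \<gamma> =
        ((\<theta> l)\<^sup>2 * (alpha z' * (1 + beta z')) - 1) / alpha z'"
      using \<alpha> by (simp add: a_def \<gamma>_def power2_eq_square field_simps)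
    finally have lim: "(\<lambda>N. \<psi> N l) \<longlonglongrightarrow> ((\<theta> l)\<^sup>2 * (alpha z' * (1 + beta z')) - 1) / alpha z'" .
    have "((\<theta> l)\<^sup>2 * (alpha z' * (1 + beta z')) - 1) / alpha z' < 0"
      using \<theta>[of l] l \<alpha> by (intro divide_neg_pos) (auto simp: J_def)
    with lim show "\<forall>\<^sub>F N in sequentially. \<psi> N l < 0" by (rule order_tendstoD)
  qed (simp add: J_def)
  then obtain N where N: "\<And>l. l \<in> J \<Longrightarrow> \<psi> N l < 0"
    by (auto simp: eventually_sequentially)
  define B where "B = (\<lambda>n. rank_update (X n) r \<theta> (u n) (v n))"
  define Y where "Y = (\<lambda>n l. nres (X n) n (m n) N z' (hv a \<theta> n l))"
  define \<rho> where "\<rho> = (\<lambda>n l j. complex_of_real (1 / z' ^ (2 * N)) * (S n ^^ N) (hv a \<theta> n l) j)"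
  define q where "q = (\<lambda>n x y. complex_of_real (z'\<^sup>2) * ip n x y - ip n (S n x) y)"
  define C where "C = (\<lambda>n l k. ip n (\<rho> n l) (\<rho> n k) / complex_of_real \<delta> + q n (Y n l) (Y n k) +
       complex_of_real (\<theta> l * \<theta> k) * ip (m n) (v n l) (v n k) - (if l = k then complex_of_real (2 * \<gamma>) else 0))"
  have lim: "(\<lambda>n. - C n l k) \<longlonglongrightarrow> (if l = k then complex_of_real (- \<psi> N l) else 0)"
    if lk: "l \<in> J" "k \<in> J" for l k
  proof -
    have lk': "l < r" "k < r" using lk by (auto simp: J_def)
    have "ip n (\<rho> n l) (\<rho> n k) = complex_of_real (1 / z' ^ (4 * N)) * ip n ((S n ^^ (N + N)) (hv a \<theta> n l)) (hv a \<theta> n k)" for n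
      unfolding \<rho>_def ip_scale_left ip_scale_right ip_gram_pow_pow
      by (simp add: power_add[symmetric])
    then have "(\<lambda>n. C n l k) \<longlonglongrightarrow>
        complex_of_real (1 / z' ^ (4 * N)) * (if l = k then complex_of_real (hmom a \<theta> l (N + N)) else 0) / complex_of_real \<delta> +
        (if l = k then complex_of_real (trunc (hmom a \<theta> l) N z' - tail (hmom a \<theta> l) N z') else 0) +
        complex_of_real (\<theta> l * \<theta> k) * (if l = k then 1 else 0) - (if l = k then complex_of_real (2 * \<gamma>) else 0)"
      unfolding C_def q_def Y_def using \<delta> z0
      by (simp only:) (intro tendsto_intros hv_hv nres_form v_orth lk'; simp)
    from tendsto_minus[OF this] show ?thesis
      by (cases "l = k") (simp_all add: \<psi>_def power2_eq_square)
  qed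
  have "\<forall>\<^sub>F n in sequentially. \<forall>c::nat \<Rightarrow> complex. (\<exists>j\<in>J. c j \<noteq> 0) \<longrightarrow>
      0 < Re (\<Sum>j\<in>J. \<Sum>k\<in>J. c j * cnj (c k) * - C n j k)"
    using eventually_form_positive[of J "\<lambda>n j k. - C n j k" "\<lambda>l. - \<psi> N l", OF _ lim] N
    by (simp add: J_def)
  then show ?thesis using eventually_gt_at_top[of i] norm_bound[OF z(1)]
  proof eventually_elim
    case (elim n)
    show ?case
    proof (intro ballI impI)
      fix A assume A: "A \<in> carrier_mat n (m n)" "entries A = rank_update (X n) r \<theta> (u n) (v n)"
      have "nsq (m n) (adjv (B n) n x) \<le> z\<^sup>2 * nsq n x"
        if x: "x \<in> vecs n" and orth: "\<forall>j<i. ip n x (u n j) = 0" for x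
      proof -
        define \<xi> where "\<xi> = (\<lambda>l. ip n x (u n l))"
        have "nsq (m n) (adjv (B n) n x) - (z'\<^sup>2 + \<delta>) * nsq n x \<le>
            Re (\<Sum>l<r. \<Sum>k<r. ip n x (u n l) * cnj (ip n x (u n k)) * C n l k)"
          unfolding B_def C_def q_def
        proof (rule form_completed_square)
          fix l assume l: "l < r"
          show "Y n l \<in> vecs n" unfolding Y_def by (intro nres_in_vecs kern hv_vec l)
          have "complex_of_real (z'\<^sup>2) * ip n (Y n l) x - ip n (S n (Y n l)) x =
              ip n (\<lambda>j. complex_of_real (z'\<^sup>2) * Y n l j - S n (Y n l) j) x"
            by (simp add: ip_diff_left ip_scale_left)
          also have "\<dots> = ip n (\<lambda>j. hv a \<theta> n l j - \<rho> n l j) x"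
            using z0 unfolding Y_def \<rho>_def by (subst nres_telescope) simp_all
          also have "\<dots> = complex_of_real \<gamma> * cnj (ip n x (u n l)) +
              complex_of_real (\<theta> l) * cnj (ip n x (xv n l)) - ip n (\<rho> n l) x"
            unfolding ip_diff_left cnj_ip by (simp add: hv_def a_def ip_add_left ip_scale_left)
          finally show "complex_of_real (z'\<^sup>2) * ip n (Y n l) x - ip n (S n (Y n l)) x =
              complex_of_real \<gamma> * cnj (ip n x (u n l)) +
              complex_of_real (\<theta> l) * cnj (ip n x (xv n l)) - ip n (\<rho> n l) x" .
        qed (use elim(3) x \<delta> in auto)
        also have "(\<Sum>l<r. \<Sum>k<r. ip n x (u n l) * cnj (ip n x (u n k)) * C n l k) =
            (\<Sum>l\<in>J. \<Sum>k\<in>J. \<xi> l * cnj (\<xi> k) * C n l k)"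
        proof -
          have "(\<Sum>k<r. \<xi> l * cnj (\<xi> k) * C n l k) = (\<Sum>k\<in>J. \<xi> l * cnj (\<xi> k) * C n l k)" for l
            using orth by (intro sum.mono_neutral_right) (auto simp: J_def \<xi>_def)
          moreover have "(\<Sum>l<r. \<Sum>k\<in>J. \<xi> l * cnj (\<xi> k) * C n l k) = (\<Sum>l\<in>J. \<Sum>k\<in>J. \<xi> l * cnj (\<xi> k) * C n l k)"
            using orth by (intro sum.mono_neutral_right) (auto simp: J_def \<xi>_def)
          ultimately show ?thesis by (simp add: \<xi>_def)
        qed
        also have "Re \<dots> \<le> 0"
        proof (cases "\<exists>j\<in>J. \<xi> j \<noteq> 0")
          case True
          then have "0 < Re (\<Sum>j\<in>J. \<Sum>k\<in>J. \<xi> j * cnj (\<xi> k) * - C n j k)" using elim(1) by blast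
          then show ?thesis by (simp only: mult_minus_right sum_negf uminus_complex.sel)
        qed simp
        finally show ?thesis by (simp add: \<delta>_def)
      qed
      then show "singular_value A (Suc i) \<le> z"
        using singular_value_le_iff[OF A(1) elim(2), of z] z z0 A(2) by (auto simp: B_def)
    qed
  qed
qed

end

section \<open>Moments from the log-Sobolev inequality\<close>

text \<open>The logarithm lies below its tangents, here read in the variable 1/x at 1/l. Integrating
  it replaces an appeal to Jensen's inequality.\<close>

lemma ln_ge_one_plus: "x > 0 \<Longrightarrow> l > 0 \<Longrightarrow> 1 + ln l - l / x \<le> ln (x::real)"
  using ln_le_minus_one[of "l / x"] by (simp add: ln_div)

text \<open>The truncation \<open>w\<close> of \<open>1 + \<bar>x\<bar>\<^sup>2\<close> satisfies \<open>\<bar>\<nabla>w\<^sup>j\<bar> \<le> 2 j w\<^sup>j\<close>, so the inequality for \<open>f = w\<^sup>j\<close> bounds the entropy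
  of \<open>f\<^sup>2\<close> by a multiple of \<open>m = \<integral> f\<^sup>2\<close>. By Jensen that entropy is at least \<open>m ln (m / (\<integral> f)\<^sup>2)\<close>. The bound on \<open>m\<close>
  is uniform in \<open>\<epsilon>\<close>.\<close>

lemma log_sobolev_moment_bound:
  fixes \<mu> :: "'a::euclidean_space measure"
  assumes \<mu>: "prob_space \<mu>" "sets \<mu> = sets borel"
    and C: "C > 0"
    and LSI: "\<And>(f::'a \<Rightarrow> real) g. (\<And>x. GDERIV f x :> g x) \<Longrightarrow> continuous_on UNIV g \<Longrightarrow>
        integrable \<mu> (\<lambda>x. (f x)\<^sup>2) \<Longrightarrow> integrable \<mu> (\<lambda>x. (norm (g x))\<^sup>2) \<Longrightarrow>
        integrable \<mu> (\<lambda>x. (f x)\<^sup>2 * ln ((f x)\<^sup>2 / (\<integral>y. (f y)\<^sup>2 \<partial>\<mu>))) \<and>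
        (\<integral>x. (f x)\<^sup>2 * ln ((f x)\<^sup>2 / (\<integral>y. (f y)\<^sup>2 \<partial>\<mu>)) \<partial>\<mu>) \<le> 2 * C * (\<integral>x. (norm (g x))\<^sup>2 \<partial>\<mu>)"
    and j: "j > 0" and int: "integrable \<mu> (\<lambda>x. (1 + (norm x)\<^sup>2) ^ j)" and \<epsilon>: "\<epsilon> > 0"
  defines "w \<equiv> \<lambda>x. (1 + (norm x)\<^sup>2) / (1 + \<epsilon> * (1 + (norm x)\<^sup>2))"
  shows "integrable \<mu> (\<lambda>x. w x ^ (2 * j))"
    and "(\<integral>x. w x ^ (2 * j) \<partial>\<mu>) \<le> exp (8 * C * (real j)\<^sup>2) * (\<integral>x. (1 + (norm x)\<^sup>2) ^ j \<partial>\<mu>)\<^sup>2"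
proof -
  interpret prob_space \<mu> by (rule \<mu>)
  have [measurable_cong]: "sets \<mu> = sets borel" by (rule \<mu>)
  define p :: "'a \<Rightarrow> real" where "p = (\<lambda>x. 1 + (norm x)\<^sup>2)"
  have p1: "1 \<le> p x" for x by (simp add: p_def)
  have den: "0 < 1 + \<epsilon> * p x" "1 \<le> 1 + \<epsilon> * p x" for x using \<epsilon> p1[of x] by (auto simp: add_pos_nonneg)
  have w_p: "w x = p x / (1 + \<epsilon> * p x)" for x by (simp add: w_def p_def)
  have w_pos: "0 < w x" for x using p1[of x] den[of x] by (simp add: w_p)
  have w_le: "w x \<le> p x" for x
    using p1[of x] den[of x] divide_left_mono[of 1 "1 + \<epsilon> * p x" "p x"] by (simp add: w_p)
  have w_bd: "w x \<le> 1 / \<epsilon>" for x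
    using \<epsilon> by (simp add: w_p pos_divide_le_eq[OF den(1)] distrib_left)
  have w_pow: "0 \<le> w x ^ k" "w x ^ k \<le> (1 / \<epsilon>) ^ k" "w x ^ k \<le> p x ^ k" for x k
    using w_pos[of x] w_le[of x] w_bd[of x] by (simp_all add: power_mono del: power_one_over)
  define f where "f = (\<lambda>x. w x ^ j)"
  define g where "g = (\<lambda>x. (real j * w x ^ (j - 1) / (1 + \<epsilon> * p x)\<^sup>2) *\<^sub>R (2 *\<^sub>R x))"
  have meas [measurable]: "w \<in> borel_measurable \<mu>" "f \<in> borel_measurable \<mu>" "g \<in> borel_measurable \<mu>"
    unfolding f_def g_def p_def w_def by measurable
  have f_pos: "0 < f x" for x by (simp add: f_def w_pos)
  have f2: "(f x)\<^sup>2 = w x ^ (2 * j)" for x by (simp add: f_def power_mult[symmetric] mult.commute)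
  have deriv: "GDERIV f x :> g x" for x
  proof -
    have 1: "GDERIV (\<lambda>x::'a. (norm x)\<^sup>2) x :> 2 *\<^sub>R x"
      unfolding gderiv_def power2_norm_eq_inner by (auto intro!: derivative_eq_intros simp: inner_commute)
    have "1 + \<epsilon> * (1 + (norm x)\<^sup>2) \<noteq> 0" using den[of x] by (simp add: p_def)
    then have "DERIV (\<lambda>s. (1 + s) / (1 + \<epsilon> * (1 + s))) ((norm x)\<^sup>2) :> 1 / (1 + \<epsilon> * p x)\<^sup>2"
      by (auto intro!: derivative_eq_intros simp: p_def power2_eq_square algebra_simps)
    from DERIV_power[OF this, of j]
    have "DERIV (\<lambda>s. ((1 + s) / (1 + \<epsilon> * (1 + s))) ^ j) ((norm x)\<^sup>2) :>
        real j * w x ^ (j - 1) / (1 + \<epsilon> * p x)\<^sup>2"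
      by (simp add: w_def mult_ac)
    from GDERIV_DERIV_compose[OF 1 this] show ?thesis by (simp add: f_def w_def g_def)
  qed
  have cont: "continuous_on UNIV g"
    unfolding g_def w_p using den by (intro continuous_intros) (auto simp: p_def intro!: continuous_intros less_imp_neq[symmetric])
  have g_le: "(norm (g x))\<^sup>2 \<le> 4 * (real j)\<^sup>2 * (f x)\<^sup>2" for x
  proof -
    have "(norm (g x))\<^sup>2 = 4 * (real j)\<^sup>2 * (w x ^ (j - 1))\<^sup>2 * (((norm x)\<^sup>2) / ((1 + \<epsilon> * p x)\<^sup>2)\<^sup>2)"
      by (simp add: g_def power_mult_distrib power_divide)
    also have "((norm x)\<^sup>2) / ((1 + \<epsilon> * p x)\<^sup>2)\<^sup>2 \<le> (p x)\<^sup>2 / (1 + \<epsilon> * p x)\<^sup>2"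
    proof (rule frac_le)
      show "(norm x)\<^sup>2 \<le> (p x)\<^sup>2" by (simp add: p_def power2_eq_square algebra_simps)
      show "(1 + \<epsilon> * p x)\<^sup>2 \<le> ((1 + \<epsilon> * p x)\<^sup>2)\<^sup>2"
        using den[of x] by (intro self_le_power) (auto intro: one_le_power)
    qed (use den[of x] in auto)
    also have "(p x)\<^sup>2 / (1 + \<epsilon> * p x)\<^sup>2 = (w x)\<^sup>2" by (simp add: w_p power_divide)
    also have "4 * (real j)\<^sup>2 * (w x ^ (j - 1))\<^sup>2 * (w x)\<^sup>2 = 4 * (real j)\<^sup>2 * (f x)\<^sup>2"
      using j by (simp add: f_def power_mult_distrib[symmetric] mult.assoc power_Suc2[symmetric] del: power_Suc)
    finally show ?thesis by (simp add: mult_left_mono)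
  qed
  show intf2: "integrable \<mu> (\<lambda>x. w x ^ (2 * j))"
    using w_pow by (intro integrable_const_bound[of _ "(1 / \<epsilon>) ^ (2 * j)"]) auto
  have intf2': "integrable \<mu> (\<lambda>x. (f x)\<^sup>2)" using intf2 by (simp add: f2)
  have intg: "integrable \<mu> (\<lambda>x. (norm (g x))\<^sup>2)"
    by (rule Bochner_Integration.integrable_bound[of _ "\<lambda>x. 4 * (real j)\<^sup>2 * (f x)\<^sup>2"])
      (use intf2' g_le in auto)
  have intf: "integrable \<mu> f"
    by (rule Bochner_Integration.integrable_bound[OF int])
      (use w_pow in \<open>auto simp: f_def p_def\<close>)
  define m where "m = (\<integral>x. (f x)\<^sup>2 \<partial>\<mu>)"
  define A where "A = (\<integral>x. f x \<partial>\<mu>)"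
  have pos_int: "0 < (\<integral>x. h x \<partial>\<mu>)" if h: "integrable \<mu> h" "\<And>x. 0 < h x" for h :: "'a \<Rightarrow> real"
  proof -
    have "(\<integral>x. h x \<partial>\<mu>) \<noteq> 0"
    proof
      assume "(\<integral>x. h x \<partial>\<mu>) = 0"
      then have "AE x in \<mu>. h x = 0"
        using h by (subst (asm) integral_nonneg_eq_0_iff_AE) (auto intro: less_imp_le)
      then have "AE x in \<mu>. False" by eventually_elim (use h(2) in \<open>metis less_irrefl\<close>)
      then show False by simp
    qed
    moreover have "0 \<le> (\<integral>x. h x \<partial>\<mu>)" using h by (intro integral_nonneg_AE) (auto intro: less_imp_le)
    ultimately show ?thesis by simp
  qed
  have m: "m > 0" unfolding m_def using f_pos by (intro pos_int intf2') (metis zero_less_power)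
  have A: "A > 0" unfolding A_def by (intro pos_int intf f_pos)
  \<comment> \<open>The tangent point: \<open>1 / l\<close> is the mean of 1/f under the probability
    measure with density f^2/m, which makes the integrated tangent bound equal to Jensen's.\<close>
  define l where "l = m / A"
  have l: "l > 0" using m A by (simp add: l_def)
  from LSI[OF deriv cont intf2' intg]
  have ent: "integrable \<mu> (\<lambda>x. (f x)\<^sup>2 * ln ((f x)\<^sup>2 / m))"
      "(\<integral>x. (f x)\<^sup>2 * ln ((f x)\<^sup>2 / m) \<partial>\<mu>) \<le> 2 * C * (\<integral>x. (norm (g x))\<^sup>2 \<partial>\<mu>)"
    by (simp_all add: m_def)
  have "(\<integral>x. (2 * (1 + ln l) - ln m) * (f x)\<^sup>2 - 2 * l * f x \<partial>\<mu>) \<le> (\<integral>x. (f x)\<^sup>2 * ln ((f x)\<^sup>2 / m) \<partial>\<mu>)"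
  proof (rule integral_mono)
    fix x
    have "(f x)\<^sup>2 * (2 * (1 + ln l - l / f x) - ln m) \<le> (f x)\<^sup>2 * (2 * ln (f x) - ln m)"
      using ln_ge_one_plus[OF f_pos l, of x] by (intro mult_left_mono) auto
    moreover have "(f x)\<^sup>2 * (2 * (1 + ln l - l / f x) - ln m) = (2 * (1 + ln l) - ln m) * (f x)\<^sup>2 - 2 * l * f x"
      using f_pos[of x] by (simp add: power2_eq_square field_simps)
    moreover have "ln ((f x)\<^sup>2 / m) = 2 * ln (f x) - ln m"
      using f_pos[of x] m by (simp add: ln_div ln_realpow)
    ultimately show "(2 * (1 + ln l) - ln m) * (f x)\<^sup>2 - 2 * l * f x \<le> (f x)\<^sup>2 * ln ((f x)\<^sup>2 / m)" by simp
  qed (use intf2' intf ent(1) in auto)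
  also have "(\<integral>x. (2 * (1 + ln l) - ln m) * (f x)\<^sup>2 - 2 * l * f x \<partial>\<mu>) = (2 * (1 + ln l) - ln m) * m - 2 * l * A"
    using intf2' intf by (simp add: m_def A_def)
  also have "\<dots> = m * (ln m - 2 * ln A)"
    using m A by (simp add: l_def ln_div algebra_simps)
  also note ent(2)
  also have "2 * C * (\<integral>x. (norm (g x))\<^sup>2 \<partial>\<mu>) \<le> 2 * C * (\<integral>x. 4 * (real j)\<^sup>2 * (f x)\<^sup>2 \<partial>\<mu>)"
    using C intg intf2' g_le by (intro mult_left_mono integral_mono) auto
  also have "\<dots> = m * (8 * C * (real j)\<^sup>2)" by (simp add: m_def)
  finally have "ln m \<le> 8 * C * (real j)\<^sup>2 + 2 * ln A" using m by simp
  then have "m \<le> exp (8 * C * (real j)\<^sup>2 + 2 * ln A)" using m by (metis exp_le_cancel_iff exp_ln)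
  also have "\<dots> = exp (8 * C * (real j)\<^sup>2) * A\<^sup>2" using A by (simp add: exp_add exp_double)
  also have "\<dots> \<le> exp (8 * C * (real j)\<^sup>2) * (\<integral>x. (1 + (norm x)\<^sup>2) ^ j \<partial>\<mu>)\<^sup>2"
  proof (intro mult_left_mono power_mono)
    show "A \<le> (\<integral>x. (1 + (norm x)\<^sup>2) ^ j \<partial>\<mu>)" unfolding A_def
      using w_pow by (intro integral_mono intf int) (auto simp: f_def p_def)
  qed (use A in auto)
  finally show "(\<integral>x. w x ^ (2 * j) \<partial>\<mu>) \<le> exp (8 * C * (real j)\<^sup>2) * (\<integral>x. (1 + (norm x)\<^sup>2) ^ j \<partial>\<mu>)\<^sup>2"
    by (simp add: m_def f2)
qed

text \<open>Fatou's lemma along \<epsilon> = 1/(i + 1): the truncations tend to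
  \<open>1 + (norm x)\<^sup>2\<close>, and the bound of their moments does not depend on
  \<epsilon>.\<close>

lemma log_sobolev_moment_double:
  fixes \<mu> :: "'a::euclidean_space measure"
  assumes \<mu>: "prob_space \<mu>" "sets \<mu> = sets borel" and LSI: "log_sobolev \<mu>"
    and j: "j > 0" and int: "integrable \<mu> (\<lambda>x. (1 + (norm x)\<^sup>2) ^ j)"
  shows "integrable \<mu> (\<lambda>x. (1 + (norm x)\<^sup>2) ^ (2 * j))"
proof -
  interpret prob_space \<mu> by (rule \<mu>)
  have [measurable_cong]: "sets \<mu> = sets borel" by (rule \<mu>)
  obtain C where C: "C > 0" and LS: "\<And>(f::'a \<Rightarrow> real) g. (\<And>x. GDERIV f x :> g x) \<Longrightarrow> continuous_on UNIV g \<Longrightarrow>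
        integrable \<mu> (\<lambda>x. (f x)\<^sup>2) \<Longrightarrow> integrable \<mu> (\<lambda>x. (norm (g x))\<^sup>2) \<Longrightarrow>
        integrable \<mu> (\<lambda>x. (f x)\<^sup>2 * ln ((f x)\<^sup>2 / (\<integral>y. (f y)\<^sup>2 \<partial>\<mu>))) \<and>
        (\<integral>x. (f x)\<^sup>2 * ln ((f x)\<^sup>2 / (\<integral>y. (f y)\<^sup>2 \<partial>\<mu>)) \<partial>\<mu>) \<le> 2 * C * (\<integral>x. (norm (g x))\<^sup>2 \<partial>\<mu>)"
    using LSI unfolding log_sobolev_def by blast
  define B where "B = exp (8 * C * (real j)\<^sup>2) * (\<integral>x. (1 + (norm x)\<^sup>2) ^ j \<partial>\<mu>)\<^sup>2"
  define w :: "nat \<Rightarrow> 'a \<Rightarrow> real" where "w = (\<lambda>i x. (1 + (norm x)\<^sup>2) / (1 + (1 / real (Suc i)) * (1 + (norm x)\<^sup>2)))"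
  have w_nonneg: "0 \<le> w i x" for i x by (simp add: w_def)
  have bd: "(\<integral>\<^sup>+x. ennreal (w i x ^ (2 * j)) \<partial>\<mu>) \<le> ennreal B" for i
  proof -
    note b = log_sobolev_moment_bound[OF \<mu> C LS j int, of "1 / real (Suc i)"]
    have "(\<integral>\<^sup>+x. ennreal (w i x ^ (2 * j)) \<partial>\<mu>) = ennreal (\<integral>x. w i x ^ (2 * j) \<partial>\<mu>)"
      using b(1) w_nonneg unfolding w_def by (intro nn_integral_eq_integral) auto
    also have "\<dots> \<le> ennreal B" using b(2) unfolding w_def B_def by (intro ennreal_leI) auto
    finally show ?thesis .
  qed
  have lim: "(\<lambda>i. ennreal (w i x ^ (2 * j))) \<longlonglongrightarrow> ennreal ((1 + (norm x)\<^sup>2) ^ (2 * j))" for x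
  proof -
    have "(\<lambda>i. 1 / real (Suc i)) \<longlonglongrightarrow> 0" by (rule LIMSEQ_Suc[OF lim_const_over_n])
    then have "(\<lambda>i. w i x ^ (2 * j)) \<longlonglongrightarrow> ((1 + (norm x)\<^sup>2) / (1 + 0 * (1 + (norm x)\<^sup>2))) ^ (2 * j)"
      unfolding w_def by (intro tendsto_intros) auto
    then show ?thesis by (intro tendsto_ennrealI) simp
  qed
  have "(\<integral>\<^sup>+x. ennreal ((1 + (norm x)\<^sup>2) ^ (2 * j)) \<partial>\<mu>) = (\<integral>\<^sup>+x. liminf (\<lambda>i. ennreal (w i x ^ (2 * j))) \<partial>\<mu>)"
    by (intro nn_integral_cong lim_imp_Liminf[symmetric] lim) simp
  also have "\<dots> \<le> liminf (\<lambda>i. \<integral>\<^sup>+x. ennreal (w i x ^ (2 * j)) \<partial>\<mu>)"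
    unfolding w_def by (intro nn_integral_liminf) measurable
  also have "\<dots> \<le> ennreal B"
  proof -
    have "liminf (\<lambda>i. \<integral>\<^sup>+x. ennreal (w i x ^ (2 * j)) \<partial>\<mu>) \<le> liminf (\<lambda>i::nat. ennreal B)"
      using bd by (intro Liminf_mono always_eventually allI)
    then show ?thesis by (simp add: Liminf_const)
  qed
  also have "\<dots> < \<infinity>" by simp
  finally have "(\<integral>\<^sup>+x. ennreal ((1 + (norm x)\<^sup>2) ^ (2 * j)) \<partial>\<mu>) < \<infinity>" .
  then show ?thesis by (intro integrableI_bounded) auto
qed

text \<open>Two doublings lead from the variance to order eight. For the real field the inequality
  concerns functions on the line, so the moments are taken for the law of the real part and
  transported back; almost surely the two agree.\<close>

lemma log_sobolev_on_eighth_moment: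
  assumes \<nu>: "prob_space \<nu>" "sets \<nu> = sets borel" "AE x in \<nu>. x \<in> K"
    and K: "K = \<real> \<or> K = UNIV" and LSI: "log_sobolev_on K \<nu>"
    and var: "integrable \<nu> (\<lambda>x. (cmod x)\<^sup>2)"
  shows "integrable \<nu> (\<lambda>x. (1 + (cmod x)\<^sup>2) ^ 4)"
proof (cases "K = \<real>")
  case True
  interpret prob_space \<nu> by (rule \<nu>)
  have [measurable_cong]: "sets \<nu> = sets borel" by (rule \<nu>)
  define \<mu> where "\<mu> = distr \<nu> borel Re"
  have \<mu>: "prob_space \<mu>" "sets \<mu> = sets borel" unfolding \<mu>_def by (auto intro!: prob_space_distr)
  have Re: "AE x in \<nu>. (1 + Re x * Re x) ^ k = (1 + (cmod x)\<^sup>2) ^ k" for k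
    using \<nu>(3) by eventually_elim (simp add: True complex_is_Real_iff cmod_def power2_eq_square)
  have iff: "integrable \<mu> (\<lambda>x. (1 + (norm x)\<^sup>2) ^ k) \<longleftrightarrow> integrable \<nu> (\<lambda>x. (1 + (cmod x)\<^sup>2) ^ k)" for k
  proof -
    have "integrable \<mu> (\<lambda>x. (1 + (norm x)\<^sup>2) ^ k) \<longleftrightarrow> integrable \<nu> (\<lambda>x. (1 + Re x * Re x) ^ k)"
      unfolding \<mu>_def by (subst integrable_distr_eq) (auto simp: power2_eq_square)
    also have "\<dots> \<longleftrightarrow> integrable \<nu> (\<lambda>x. (1 + (cmod x)\<^sup>2) ^ k)"
      using Re by (intro integrable_cong_AE) auto
    finally show ?thesis .
  qed
  have LS: "log_sobolev \<mu>" using LSI True by (simp add: log_sobolev_on_def \<mu>_def)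
  have "integrable \<mu> (\<lambda>x. (1 + (norm x)\<^sup>2) ^ 1)" unfolding iff using var by simp
  from log_sobolev_moment_double[OF \<mu> LS _ log_sobolev_moment_double[OF \<mu> LS _ this]]
  have "integrable \<mu> (\<lambda>x. (1 + (norm x)\<^sup>2) ^ 4)" by simp
  then show ?thesis by (simp only: iff)
next
  case False
  interpret prob_space \<nu> by (rule \<nu>)
  have LS: "log_sobolev \<nu>" using LSI False by (simp add: log_sobolev_on_def)
  have "integrable \<nu> (\<lambda>x. (1 + (norm x)\<^sup>2) ^ 1)" using var by simp
  from log_sobolev_moment_double[OF \<nu>(1,2) LS _ log_sobolev_moment_double[OF \<nu>(1,2) LS _ this]]
  show ?thesis by simp
qed

section \<open>Fourth moments of quadratic forms in independent variables\<close>

text \<open>The term linear in \<open>Z\<close> is kept exactly, since it integrates to 0 when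
  \<open>Z\<close> is centred. The other mixed terms are absorbed into even powers.\<close>

lemma cmod_add_power4_le:
  "cmod (Q + Z) ^ 4 \<le>
    cmod Q ^ 4 + 4 * (cmod Q)\<^sup>2 * Re (cnj Q * Z) + 8 * (cmod Q)\<^sup>2 * (cmod Z)\<^sup>2 + 3 * cmod Z ^ 4"
proof -
  define a b t where "a = cmod Q" and "b = cmod Z" and "t = Re (cnj Q * Z)"
  have t: "\<bar>t\<bar> \<le> a * b" unfolding a_def b_def t_def
    using abs_Re_le_cmod[of "cnj Q * Z"] by (simp add: norm_mult)
  have ab: "0 \<le> a" "0 \<le> b" by (auto simp: a_def b_def)
  have sq: "(cmod (Q + Z))\<^sup>2 = a\<^sup>2 + 2 * t + b\<^sup>2"
    by (simp add: cmod_power2 a_def b_def t_def) (simp add: power2_eq_square algebra_simps)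
  have "cmod (Q + Z) ^ 4 = (a\<^sup>2 + 2 * t + b\<^sup>2)\<^sup>2"
    unfolding sq[symmetric] by (simp add: power2_eq_square power4_eq_xxxx mult.assoc)
  also have "\<dots> = a ^ 4 + 4 * t\<^sup>2 + b ^ 4 + 4 * a\<^sup>2 * t + 2 * a\<^sup>2 * b\<^sup>2 + 4 * t * b\<^sup>2"
    by (simp add: power2_eq_square power4_eq_xxxx algebra_simps)
  also have "t\<^sup>2 \<le> a\<^sup>2 * b\<^sup>2"
    using t ab by (metis abs_le_square_iff abs_of_nonneg mult_nonneg_nonneg power_mult_distrib)
  also have "4 * t * b\<^sup>2 \<le> 2 * a\<^sup>2 * b\<^sup>2 + 2 * b ^ 4"
  proof -
    have "t * b\<^sup>2 \<le> (a * b) * b\<^sup>2" using t by (intro mult_right_mono) auto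
    moreover have "2 * ((a * b) * b\<^sup>2) \<le> a\<^sup>2 * b\<^sup>2 + b ^ 4"
      using sum_squares_bound[of "a * b" "b\<^sup>2"] by (simp add: power2_eq_square power4_eq_xxxx algebra_simps)
    ultimately show ?thesis by linarith
  qed
  finally show ?thesis by (simp add: a_def b_def t_def)
qed

lemma three_sum_square_le: "(x + y + z)\<^sup>2 \<le> 3 * (x\<^sup>2 + y\<^sup>2 + (z::real)\<^sup>2)"
  using sum_squares_bound[of x y] sum_squares_bound[of x z] sum_squares_bound[of y z]
  by (simp add: power2_eq_square algebra_simps)

text \<open>A power of \<open>1 + (cmod x)\<^sup>2\<close> dominates all lower moments at
  once.\<close>

locale unit_law = prob_space \<nu> for \<nu> :: "complex measure" +
  assumes sets_nu [measurable_cong]: "sets \<nu> = sets borel"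
    and mean: "integrable \<nu> (\<lambda>x. x)" "(\<integral>x. x \<partial>\<nu>) = 0"
    and variance_one: "(\<integral>x. (cmod x)\<^sup>2 \<partial>\<nu>) = 1"
    and moment8: "integrable \<nu> (\<lambda>x. (1 + (cmod x)\<^sup>2) ^ 4)"
begin

lemma integrable_moments:
  "integrable \<nu> (\<lambda>x. (1 + (cmod x)\<^sup>2)\<^sup>2)" "integrable \<nu> (\<lambda>x. (cmod x)\<^sup>2)"
proof -
  have 1: "1 + (cmod x)\<^sup>2 \<le> (1 + (cmod x)\<^sup>2)\<^sup>2" for x :: complex
    by (intro self_le_power) auto
  have 2: "(1 + (cmod x)\<^sup>2)\<^sup>2 \<le> (1 + (cmod x)\<^sup>2) ^ 4" for x :: complex
    by (intro power_increasing) auto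
  show *: "integrable \<nu> (\<lambda>x. (1 + (cmod x)\<^sup>2)\<^sup>2)"
    by (rule Bochner_Integration.integrable_bound[OF moment8]) (use 2 in auto)
  show "integrable \<nu> (\<lambda>x. (cmod x)\<^sup>2)"
  proof (rule Bochner_Integration.integrable_bound[OF *])
    have "(cmod x)\<^sup>2 \<le> (1 + (cmod x)\<^sup>2)\<^sup>2" for x :: complex using 1[of x] by linarith
    then show "AE x in \<nu>. norm ((cmod x)\<^sup>2) \<le> norm ((1 + (cmod x)\<^sup>2)\<^sup>2)" by simp
  qed simp
qed

text \<open>The factors are 24 = 8 * 3 and 27 = 3 * 9: the coefficients in
  \<open>cmod_add_power4_le\<close> times those in |Z|^2 <= 3 s P^2 and |Z|^4 <= 9 s^2 P^4 with P =
  1 + |x|^2. The summand 1 makes positivity immediate.\<close>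

definition step_const :: real where
  "step_const = 24 * (\<integral>x. (1 + (cmod x)\<^sup>2)\<^sup>2 \<partial>\<nu>) + 27 * (\<integral>x. (1 + (cmod x)\<^sup>2) ^ 4 \<partial>\<nu>) + 1"

lemma step_const_pos: "step_const > 0"
  unfolding step_const_def by (intro add_nonneg_pos add_nonneg_nonneg mult_nonneg_nonneg integral_nonneg_AE) auto

text \<open>The increment is what a centred quadratic form gains from one new variable. It has mean
  zero because \<open>x\<close> has mean zero and variance one; the mean of x^2 never enters, so
  real and complex entries are treated alike.\<close>

lemma fourth_moment_one_variable:
  fixes Q d L L' :: complex
  defines "s \<equiv> (cmod d)\<^sup>2 + (cmod L)\<^sup>2 + (cmod L')\<^sup>2"
  shows "(\<integral>\<^sup>+x. ennreal (cmod (Q + (d * (complex_of_real ((cmod x)\<^sup>2) - 1) + x * L + cnj x * L')) ^ 4) \<partial>\<nu>) \<le>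
    ennreal (cmod Q ^ 4 + step_const * ((cmod Q)\<^sup>2 * s) + step_const * s\<^sup>2)"
proof -
  define Z where "Z = (\<lambda>x. d * (complex_of_real ((cmod x)\<^sup>2) - 1) + x * L + cnj x * L')"
  define P where "P = (\<lambda>x. 1 + (cmod x)\<^sup>2)"
  define E2 where "E2 = (\<integral>x. (P x)\<^sup>2 \<partial>\<nu>)"
  define E4 where "E4 = (\<integral>x. (P x) ^ 4 \<partial>\<nu>)"
  have E: "E2 \<ge> 0" "E4 \<ge> 0" unfolding E2_def E4_def by (auto intro!: integral_nonneg_AE simp: P_def)
  have s0: "s \<ge> 0" by (simp add: s_def)
  have Z2: "(cmod (Z x))\<^sup>2 \<le> 3 * (s * (P x)\<^sup>2)" for x
  proof -
    have "cmod (Z x) \<le> cmod d * \<bar>(cmod x)\<^sup>2 - 1\<bar> + cmod x * cmod L + cmod x * cmod L'"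
    proof -
      have "cmod (complex_of_real ((cmod x)\<^sup>2) - 1) = \<bar>(cmod x)\<^sup>2 - 1\<bar>"
        by (metis norm_of_real of_real_1 of_real_diff)
      then show ?thesis unfolding Z_def
        by (intro order_trans[OF norm_triangle_ineq] add_mono) (simp_all add: norm_mult)
    qed
    then have "(cmod (Z x))\<^sup>2 \<le> (cmod d * \<bar>(cmod x)\<^sup>2 - 1\<bar> + cmod x * cmod L + cmod x * cmod L')\<^sup>2"
      by (intro power_mono) auto
    also have "\<dots> \<le> 3 * ((cmod d)\<^sup>2 * ((cmod x)\<^sup>2 - 1)\<^sup>2 + (cmod x)\<^sup>2 * (cmod L)\<^sup>2 + (cmod x)\<^sup>2 * (cmod L')\<^sup>2)"
      using three_sum_square_le[of "cmod d * \<bar>(cmod x)\<^sup>2 - 1\<bar>" "cmod x * cmod L" "cmod x * cmod L'"]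
      by (simp add: power_mult_distrib)
    also have "\<dots> \<le> 3 * ((cmod d)\<^sup>2 * (P x)\<^sup>2 + (P x)\<^sup>2 * (cmod L)\<^sup>2 + (P x)\<^sup>2 * (cmod L')\<^sup>2)"
    proof -
      have "((cmod x)\<^sup>2 - 1)\<^sup>2 \<le> (P x)\<^sup>2" unfolding P_def by (simp add: power2_eq_square algebra_simps)
      moreover have "(cmod x)\<^sup>2 \<le> (P x)\<^sup>2"
      proof -
        have "1 + (cmod x)\<^sup>2 \<le> (P x)\<^sup>2" unfolding P_def by (rule self_le_power) auto
        then show ?thesis by linarith
      qed
      ultimately show ?thesis by (intro mult_left_mono add_mono mult_right_mono) auto
    qed
    also have "\<dots> = 3 * (s * (P x)\<^sup>2)" by (simp add: s_def algebra_simps)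
    finally show ?thesis .
  qed
  have Z4: "cmod (Z x) ^ 4 \<le> 9 * (s\<^sup>2 * P x ^ 4)" for x
  proof -
    have "((cmod (Z x))\<^sup>2)\<^sup>2 \<le> (3 * (s * (P x)\<^sup>2))\<^sup>2" using Z2 by (intro power_mono) auto
    then show ?thesis by (simp add: power_mult_distrib)
  qed
  define R where "R = (\<lambda>x. cmod Q ^ 4 + 4 * (cmod Q)\<^sup>2 * Re (cnj Q * Z x) +
      24 * ((cmod Q)\<^sup>2 * s) * (P x)\<^sup>2 + 27 * s\<^sup>2 * P x ^ 4)"
  have le: "cmod (Q + Z x) ^ 4 \<le> R x" for x
  proof -
    have "8 * (cmod Q)\<^sup>2 * (cmod (Z x))\<^sup>2 \<le> 8 * (cmod Q)\<^sup>2 * (3 * (s * (P x)\<^sup>2))"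
      using Z2[of x] by (intro mult_left_mono) auto
    also have "\<dots> = 24 * ((cmod Q)\<^sup>2 * s) * (P x)\<^sup>2" by simp
    finally show ?thesis using cmod_add_power4_le[of Q "Z x"] Z4[of x] unfolding R_def by linarith
  qed
  have iZ: "integrable \<nu> Z" "(\<integral>x. Z x \<partial>\<nu>) = 0"
  proof -
    have i1: "integrable \<nu> (\<lambda>x. complex_of_real ((cmod x)\<^sup>2))"
      by (intro integrable_of_real integrable_moments)
    have i3: "integrable \<nu> (\<lambda>x. cnj x)" using mean(1) by simp
    have "(\<integral>x. complex_of_real ((cmod x)\<^sup>2) \<partial>\<nu>) = 1" by (simp only: integral_complex_of_real variance_one of_real_1)
    moreover have "(\<integral>x. cnj x \<partial>\<nu>) = 0" using mean by simp
    ultimately show "integrable \<nu> Z" "(\<integral>x. Z x \<partial>\<nu>) = 0"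
      unfolding Z_def using i1 i3 mean by (simp_all add: prob_space)
  qed
  have iR: "integrable \<nu> R"
    unfolding R_def P_def using iZ integrable_moments moment8 by (intro Bochner_Integration.integrable_add integrable_mult_right integrable_Re) auto
  have "(\<integral>x. R x \<partial>\<nu>) = cmod Q ^ 4 + 4 * (cmod Q)\<^sup>2 * (\<integral>x. Re (cnj Q * Z x) \<partial>\<nu>) +
      24 * ((cmod Q)\<^sup>2 * s) * E2 + 27 * s\<^sup>2 * E4"
  proof -
    have "integrable \<nu> (\<lambda>x. Re (cnj Q * Z x))" using iZ(1) by (intro integrable_Re integrable_mult_right) auto
    then show ?thesis
      unfolding R_def E2_def E4_def P_def using integrable_moments(1) moment8 by (simp add: prob_space)
  qed
  also have "(\<integral>x. Re (cnj Q * Z x) \<partial>\<nu>) = 0"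
    using iZ by (subst integral_Re) auto
  finally have intR: "(\<integral>x. R x \<partial>\<nu>) = cmod Q ^ 4 + 24 * ((cmod Q)\<^sup>2 * s) * E2 + 27 * s\<^sup>2 * E4" by simp
  have "(\<integral>\<^sup>+x. ennreal (cmod (Q + Z x) ^ 4) \<partial>\<nu>) \<le> (\<integral>\<^sup>+x. ennreal (R x) \<partial>\<nu>)"
    using le by (intro nn_integral_mono ennreal_leI) auto
  also have "\<dots> = ennreal (\<integral>x. R x \<partial>\<nu>)"
    using le by (intro nn_integral_eq_integral iR AE_I2) (metis order_trans zero_le_power norm_ge_zero)
  also have "\<dots> \<le> ennreal (cmod Q ^ 4 + step_const * ((cmod Q)\<^sup>2 * s) + step_const * s\<^sup>2)"
  proof (intro ennreal_leI)
    have k: "24 * E2 \<le> step_const" "27 * E4 \<le> step_const"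
      using E unfolding step_const_def E2_def E4_def P_def by auto
    have "(24 * E2) * ((cmod Q)\<^sup>2 * s) \<le> step_const * ((cmod Q)\<^sup>2 * s)"
      using k s0 by (intro mult_right_mono) auto
    moreover have "(27 * E4) * s\<^sup>2 \<le> step_const * s\<^sup>2" using k by (intro mult_right_mono) auto
    ultimately show "(\<integral>x. R x \<partial>\<nu>) \<le> cmod Q ^ 4 + step_const * ((cmod Q)\<^sup>2 * s) + step_const * s\<^sup>2"
      unfolding intR by (simp add: mult_ac)
  qed
  finally show ?thesis unfolding Z_def .
qed

lemma component_measurable: "p \<in> I \<Longrightarrow> (\<lambda>x. x p) \<in> borel_measurable (PiM I (\<lambda>_. \<nu>))"
  using measurable_component_singleton[of p I "\<lambda>_. \<nu>"] by (simp add: measurable_def sets_nu sets_eq_imp_space_eq[OF sets_nu])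

lemma cnj_component_measurable: "p \<in> I \<Longrightarrow> (\<lambda>x. cnj (x p)) \<in> borel_measurable (PiM I (\<lambda>_. \<nu>))"
  by (rule measurable_compose[OF component_measurable]) (auto intro!: borel_measurable_continuous_onI continuous_intros)

text \<open>Induction step over the variables: \<open>F\<close> and \<open>\<delta>\<close> bound the squared Frobenius norms of the old part and of
  the new row and column. The mixed moment of \<open>\<bar>Q\<bar>\<^sup>2\<close> and \<open>s\<close> is split by a weighted mean inequality with
  weight \<open>\<delta> / F\<close>, so that the bounds add up to a square.\<close>

lemma fourth_moment_add_variable:
  fixes Q d L L' :: "('i \<Rightarrow> complex) \<Rightarrow> complex" and T :: "('i \<Rightarrow> complex) \<Rightarrow> complex"
  defines "s \<equiv> \<lambda>x. (cmod (d x))\<^sup>2 + (cmod (L x))\<^sup>2 + (cmod (L' x))\<^sup>2"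
  assumes I: "finite I" "o' \<notin> I"
    and T: "T \<in> borel_measurable (PiM (insert o' I) (\<lambda>_. \<nu>))"
    and meas: "Q \<in> borel_measurable (PiM I (\<lambda>_. \<nu>))" "d \<in> borel_measurable (PiM I (\<lambda>_. \<nu>))"
      "L \<in> borel_measurable (PiM I (\<lambda>_. \<nu>))" "L' \<in> borel_measurable (PiM I (\<lambda>_. \<nu>))"
    and upd: "\<And>x y. T (x(o' := y)) = Q x + (d x * (complex_of_real ((cmod y)\<^sup>2) - 1) + y * L x + cnj y * L' x)"
    and F: "F > 0" "\<delta> > 0"
    and Q4: "(\<integral>\<^sup>+x. ennreal (cmod (Q x) ^ 4) \<partial>PiM I (\<lambda>_. \<nu>)) \<le> ennreal (K * F\<^sup>2)"
    and s2: "(\<integral>\<^sup>+x. ennreal ((s x)\<^sup>2) \<partial>PiM I (\<lambda>_. \<nu>)) \<le> ennreal (K' * \<delta>\<^sup>2)"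
    and K: "K' \<ge> 0" "K \<ge> step_const\<^sup>2 * K'" "K \<ge> step_const * K'"
  shows "(\<integral>\<^sup>+x. ennreal (cmod (T x) ^ 4) \<partial>PiM (insert o' I) (\<lambda>_. \<nu>)) \<le> ennreal (K * (F + \<delta>)\<^sup>2)"
proof -
  interpret product_sigma_finite "\<lambda>_::'i. \<nu>" ..
  note [measurable] = meas T
  define C where "C = step_const"
  have C: "C > 0" using step_const_pos by (simp add: C_def)
  have K0: "K \<ge> 0" using K step_const_pos by (meson mult_nonneg_nonneg order_trans less_imp_le)
  have s0: "s x \<ge> 0" for x by (simp add: s_def)
  have [measurable]: "s \<in> borel_measurable (PiM I (\<lambda>_. \<nu>))" unfolding s_def by measurable
  define A where "A = 1 + \<delta> / F"
  define B where "B = C\<^sup>2 * F / (4 * \<delta>) + C"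
  have AB: "A > 0" "B > 0" using C F by (auto simp: A_def B_def add_pos_nonneg add_nonneg_pos)
  have pt: "cmod (Q x) ^ 4 + C * ((cmod (Q x))\<^sup>2 * s x) + C * (s x)\<^sup>2 \<le> A * cmod (Q x) ^ 4 + B * (s x)\<^sup>2" for x
  proof -
    define a where "a = (cmod (Q x))\<^sup>2"
    have "0 \<le> (\<delta> / F) * (a - C * F / (2 * \<delta>) * s x)\<^sup>2" using F by simp
    also have "\<dots> = (\<delta> / F) * a\<^sup>2 - C * (a * s x) + C\<^sup>2 * F / (4 * \<delta>) * (s x)\<^sup>2"
      using F by (simp add: power2_eq_square field_simps)
    finally have "C * (a * s x) \<le> (\<delta> / F) * a\<^sup>2 + C\<^sup>2 * F / (4 * \<delta>) * (s x)\<^sup>2" by simp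
    moreover have "cmod (Q x) ^ 4 = a\<^sup>2" by (simp add: a_def)
    ultimately show ?thesis by (simp add: A_def B_def a_def[symmetric] algebra_simps)
  qed
  have "(\<integral>\<^sup>+x. ennreal (cmod (T x) ^ 4) \<partial>PiM (insert o' I) (\<lambda>_. \<nu>)) =
      (\<integral>\<^sup>+x. (\<integral>\<^sup>+y. ennreal (cmod (T (x(o' := y))) ^ 4) \<partial>\<nu>) \<partial>PiM I (\<lambda>_. \<nu>))"
    by (rule product_nn_integral_insert[OF I]) measurable
  also have "\<dots> \<le> (\<integral>\<^sup>+x. ennreal A * ennreal (cmod (Q x) ^ 4) + ennreal B * ennreal ((s x)\<^sup>2) \<partial>PiM I (\<lambda>_. \<nu>))"
  proof (intro nn_integral_mono)
    fix x
    have "(\<integral>\<^sup>+y. ennreal (cmod (T (x(o' := y))) ^ 4) \<partial>\<nu>) \<le>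
        ennreal (cmod (Q x) ^ 4 + C * ((cmod (Q x))\<^sup>2 * s x) + C * (s x)\<^sup>2)"
      unfolding upd s_def C_def by (rule fourth_moment_one_variable)
    also have "\<dots> \<le> ennreal (A * cmod (Q x) ^ 4 + B * (s x)\<^sup>2)" using pt by (intro ennreal_leI)
    also have "\<dots> = ennreal A * ennreal (cmod (Q x) ^ 4) + ennreal B * ennreal ((s x)\<^sup>2)"
      using AB by (simp add: ennreal_plus ennreal_mult less_imp_le)
    finally show "(\<integral>\<^sup>+y. ennreal (cmod (T (x(o' := y))) ^ 4) \<partial>\<nu>) \<le> \<dots>" .
  qed
  also have "\<dots> = ennreal A * (\<integral>\<^sup>+x. ennreal (cmod (Q x) ^ 4) \<partial>PiM I (\<lambda>_. \<nu>)) +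
      ennreal B * (\<integral>\<^sup>+x. ennreal ((s x)\<^sup>2) \<partial>PiM I (\<lambda>_. \<nu>))"
    by (subst nn_integral_add) (simp_all add: nn_integral_cmult)
  also have "\<dots> \<le> ennreal A * ennreal (K * F\<^sup>2) + ennreal B * ennreal (K' * \<delta>\<^sup>2)"
    by (intro add_mono mult_left_mono Q4 s2) auto
  also have "\<dots> = ennreal (A * (K * F\<^sup>2) + B * (K' * \<delta>\<^sup>2))"
    using AB K K0 by (simp add: ennreal_plus ennreal_mult less_imp_le)
  also have "\<dots> \<le> ennreal (K * (F + \<delta>)\<^sup>2)"
  proof (intro ennreal_leI)
    \<comment> \<open>The mixed terms amount to at most 5/4 K F \<delta>, within the 2 K F \<delta>
      that the square offers.\<close>
    have "A * (K * F\<^sup>2) + B * (K' * \<delta>\<^sup>2) = K * F\<^sup>2 + K * (F * \<delta>) + (C\<^sup>2 * K') * (F * \<delta>) / 4 + (C * K') * \<delta>\<^sup>2"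
      using F by (simp add: A_def B_def power2_eq_square field_simps)
    also have "\<dots> \<le> K * F\<^sup>2 + K * (F * \<delta>) + K * (F * \<delta>) / 4 + K * \<delta>\<^sup>2"
      using K F unfolding C_def by (intro add_mono divide_right_mono mult_right_mono) auto
    also have "\<dots> \<le> K * (F + \<delta>)\<^sup>2"
      using K0 F by (simp add: power2_eq_square algebra_simps)
    finally show "A * (K * F\<^sup>2) + B * (K' * \<delta>\<^sup>2) \<le> K * (F + \<delta>)\<^sup>2" .
  qed
  finally show ?thesis .
qed

definition linear_const :: real where "linear_const = step_const\<^sup>2 + step_const"

lemma linear_form_fourth_moment:
  fixes l :: "'i \<Rightarrow> complex"
  assumes "finite I" "(\<Sum>p\<in>I. (cmod (l p))\<^sup>2) < F"
  shows "(\<integral>\<^sup>+x. ennreal (cmod (\<Sum>p\<in>I. l p * x p) ^ 4) \<partial>PiM I (\<lambda>_. \<nu>)) \<le> ennreal (linear_const * F\<^sup>2)"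
  using assms
proof (induction I arbitrary: F rule: finite_induct)
  case (insert j I)
  interpret P: prob_space "PiM I (\<lambda>_. \<nu>)" by (intro prob_space_PiM prob_space_axioms)
  \<comment> \<open>Half of the slack in the strict bound \<open>F\<close> goes to the old variables
    and half to the new one. Thus both weights are positive even if all coefficients vanish, as the
    weighted mean inequality requires.\<close>
  define g where "g = (F - (\<Sum>p\<in>insert j I. (cmod (l p))\<^sup>2)) / 2"
  have g: "g > 0" using insert.prems by (simp add: g_def)
  define F1 where "F1 = (\<Sum>p\<in>I. (cmod (l p))\<^sup>2) + g"
  define \<delta> where "\<delta> = (cmod (l j))\<^sup>2 + g"
  have F: "F = F1 + \<delta>" using insert.hyps by (simp add: F1_def \<delta>_def g_def field_simps)
  have pos: "F1 > 0" "\<delta> > 0" using g by (auto simp: F1_def \<delta>_def intro!: add_nonneg_pos sum_nonneg)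
  show ?case unfolding F
  proof (rule fourth_moment_add_variable[where Q = "\<lambda>x. \<Sum>p\<in>I. l p * x p" and d = "\<lambda>_. 0" and L = "\<lambda>_. l j" and L' = "\<lambda>_. 0" and K' = 1])
    show "(\<lambda>x. \<Sum>p\<in>insert j I. l p * x p) \<in> borel_measurable (PiM (insert j I) (\<lambda>_. \<nu>))"
      by (intro borel_measurable_sum borel_measurable_times borel_measurable_const component_measurable)
    show "(\<lambda>x. \<Sum>p\<in>I. l p * x p) \<in> borel_measurable (PiM I (\<lambda>_. \<nu>))"
      by (intro borel_measurable_sum borel_measurable_times borel_measurable_const component_measurable)
    fix x :: "'i \<Rightarrow> complex" and y
    have "(\<Sum>p\<in>I. l p * (x(j := y)) p) = (\<Sum>p\<in>I. l p * x p)"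
      using insert.hyps by (intro sum.cong) auto
    then show "(\<Sum>p\<in>insert j I. l p * (x(j := y)) p) =
        (\<Sum>p\<in>I. l p * x p) + (0 * (complex_of_real ((cmod y)\<^sup>2) - 1) + y * l j + cnj y * 0)"
      using insert.hyps by simp
  next
    show "(\<integral>\<^sup>+x. ennreal (cmod (\<Sum>p\<in>I. l p * x p) ^ 4) \<partial>PiM I (\<lambda>_. \<nu>)) \<le> ennreal (linear_const * F1\<^sup>2)"
      using g by (intro insert.IH) (simp add: F1_def)
    have "((cmod (l j))\<^sup>2)\<^sup>2 \<le> \<delta>\<^sup>2" using g by (intro power_mono) (auto simp: \<delta>_def)
    then show "(\<integral>\<^sup>+x. ennreal (((cmod 0)\<^sup>2 + (cmod (l j))\<^sup>2 + (cmod 0)\<^sup>2)\<^sup>2) \<partial>PiM I (\<lambda>_. \<nu>)) \<le> ennreal (1 * \<delta>\<^sup>2)"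
      by (simp add: P.emeasure_space_1 ennreal_leI)
  qed (use insert.hyps pos step_const_pos in \<open>auto simp: linear_const_def\<close>)
qed simp

text \<open>The last factor bounds the mean square of the new row and column: 3 from
  \<open>three_sum_square_le\<close>, 1 for the diagonal entry, and \<open>linear_const\<close> for
  each of the two linear forms.\<close>

definition quadratic_const :: real where
  "quadratic_const = (step_const\<^sup>2 + step_const) * (3 * (1 + 2 * linear_const))"

text \<open>Adding the index \<open>j\<close> contributes \<open>a j j\<close> times the centred
  square of the new variable, plus that variable and its conjugate times linear forms
  \<open>L\<close> and \<open>L'\<close> in the old ones. Those are controlled by
  \<open>linear_form_fourth_moment\<close>, and subtracting the trace keeps every stage
  centred.\<close>

lemma quadratic_form_fourth_moment:
  fixes a :: "'i \<Rightarrow> 'i \<Rightarrow> complex"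
  assumes "finite I" "(\<Sum>p\<in>I. \<Sum>q\<in>I. (cmod (a p q))\<^sup>2) < F"
  shows "(\<integral>\<^sup>+x. ennreal (cmod ((\<Sum>p\<in>I. \<Sum>q\<in>I. a p q * x p * cnj (x q)) - (\<Sum>p\<in>I. a p p)) ^ 4) \<partial>PiM I (\<lambda>_. \<nu>))
    \<le> ennreal (quadratic_const * F\<^sup>2)"
  using assms
proof (induction I arbitrary: F rule: finite_induct)
  case (insert j I)
  interpret P: prob_space "PiM I (\<lambda>_. \<nu>)" by (intro prob_space_PiM prob_space_axioms)
  define G where "G = (cmod (a j j))\<^sup>2 + (\<Sum>q\<in>I. (cmod (a j q))\<^sup>2) + (\<Sum>p\<in>I. (cmod (a p j))\<^sup>2)"
  define S where "S = (\<Sum>p\<in>I. \<Sum>q\<in>I. (cmod (a p q))\<^sup>2)"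
  have SG: "(\<Sum>p\<in>insert j I. \<Sum>q\<in>insert j I. (cmod (a p q))\<^sup>2) = S + G"
    using insert.hyps by (simp add: S_def G_def sum.distrib)
  define g where "g = (F - (S + G)) / 2"
  have g: "g > 0" using insert.prems unfolding SG by (simp add: g_def)
  define F1 where "F1 = S + g"
  define \<delta> where "\<delta> = G + g"
  have F: "F = F1 + \<delta>" by (simp add: F1_def \<delta>_def g_def field_simps)
  have SG0: "S \<ge> 0" "G \<ge> 0" by (auto simp: S_def G_def intro!: sum_nonneg add_nonneg_nonneg)
  have pos: "F1 > 0" "\<delta> > 0" using g SG0 by (auto simp: F1_def \<delta>_def)
  define T where "T = (\<lambda>I (x :: 'i \<Rightarrow> complex). (\<Sum>p\<in>I. \<Sum>q\<in>I. a p q * x p * cnj (x q)) - (\<Sum>p\<in>I. a p p))"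
  define L where "L = (\<lambda>x :: 'i \<Rightarrow> complex. \<Sum>q\<in>I. a j q * cnj (x q))"
  define L' where "L' = (\<lambda>x :: 'i \<Rightarrow> complex. \<Sum>p\<in>I. a p j * x p)"
  have T_meas: "T H \<in> borel_measurable (PiM H (\<lambda>_. \<nu>))" for H
    unfolding T_def
    by (intro borel_measurable_diff borel_measurable_sum borel_measurable_times borel_measurable_const
        component_measurable cnj_component_measurable)
  have L_meas: "L \<in> borel_measurable (PiM I (\<lambda>_. \<nu>))" "L' \<in> borel_measurable (PiM I (\<lambda>_. \<nu>))"
    unfolding L_def L'_def
    by (intro borel_measurable_sum borel_measurable_times borel_measurable_const
        component_measurable cnj_component_measurable; assumption)+
  have row: "(\<Sum>q\<in>I. (cmod (a j q))\<^sup>2) < \<delta>" and col: "(\<Sum>p\<in>I. (cmod (a p j))\<^sup>2) < \<delta>"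
  proof -
    have "(\<Sum>q\<in>I. (cmod (a j q))\<^sup>2) \<le> G" "(\<Sum>p\<in>I. (cmod (a p j))\<^sup>2) \<le> G"
      by (simp_all add: G_def sum_nonneg)
    then show "(\<Sum>q\<in>I. (cmod (a j q))\<^sup>2) < \<delta>" "(\<Sum>p\<in>I. (cmod (a p j))\<^sup>2) < \<delta>"
      using g by (simp_all add: \<delta>_def)
  qed
  have "(\<integral>\<^sup>+x. ennreal (cmod (L x) ^ 4) \<partial>PiM I (\<lambda>_. \<nu>)) =
      (\<integral>\<^sup>+x. ennreal (cmod (\<Sum>q\<in>I. cnj (a j q) * x q) ^ 4) \<partial>PiM I (\<lambda>_. \<nu>))"
  proof -
    have "cmod (L x) = cmod (\<Sum>q\<in>I. cnj (a j q) * x q)" for x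
      unfolding L_def by (subst complex_mod_cnj[symmetric]) (simp del: complex_mod_cnj)
    then show ?thesis by simp
  qed
  also have "\<dots> \<le> ennreal (linear_const * \<delta>\<^sup>2)"
    using insert.hyps row by (intro linear_form_fourth_moment) simp_all
  finally have L4: "(\<integral>\<^sup>+x. ennreal (cmod (L x) ^ 4) \<partial>PiM I (\<lambda>_. \<nu>)) \<le> ennreal (linear_const * \<delta>\<^sup>2)" .
  have L'4: "(\<integral>\<^sup>+x. ennreal (cmod (L' x) ^ 4) \<partial>PiM I (\<lambda>_. \<nu>)) \<le> ennreal (linear_const * \<delta>\<^sup>2)"
    unfolding L'_def using insert.hyps col by (intro linear_form_fourth_moment) simp_all
  have e3: "ennreal 3 * (ennreal x + ennreal y + ennreal z) = ennreal (3 * (x + y + z))"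
    if "0 \<le> x" "0 \<le> y" "0 \<le> z" for x y z
    using that by (simp add: ennreal_mult' del: distrib_left_numeral)
  have lin0: "linear_const \<ge> 0" using step_const_pos by (simp add: linear_const_def)
  have dj: "cmod (a j j) ^ 4 \<le> \<delta>\<^sup>2"
  proof -
    have "((cmod (a j j))\<^sup>2)\<^sup>2 \<le> \<delta>\<^sup>2"
      using g by (intro power_mono) (auto simp: \<delta>_def G_def intro!: add_nonneg_nonneg sum_nonneg)
    then show ?thesis by simp
  qed
  have "(\<integral>\<^sup>+x. ennreal (cmod (T (insert j I) x) ^ 4) \<partial>PiM (insert j I) (\<lambda>_. \<nu>)) \<le> ennreal (quadratic_const * (F1 + \<delta>)\<^sup>2)"
  proof (rule fourth_moment_add_variable[where Q = "T I" and d = "\<lambda>_. a j j" and L = L and L' = L'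
        and K' = "3 * (1 + 2 * linear_const)"])
    fix x :: "'i \<Rightarrow> complex" and y
    have ne: "p \<in> I \<Longrightarrow> p \<noteq> j" for p using insert.hyps by auto
    have sq: "complex_of_real ((cmod y)\<^sup>2) = y * cnj y" by (rule complex_norm_square)
    have "T (insert j I) (x(j := y)) = a j j * y * cnj y + (\<Sum>q\<in>I. a j q * y * cnj (x q)) +
        (\<Sum>p\<in>I. a p j * x p * cnj y + (\<Sum>q\<in>I. a p q * x p * cnj (x q))) - (a j j + (\<Sum>p\<in>I. a p p))"
      unfolding T_def using insert.hyps
      by (simp add: ne sum.distrib cong: sum.cong)
    also have "\<dots> = T I x + (a j j * (complex_of_real ((cmod y)\<^sup>2) - 1) + y * L x + cnj y * L' x)"
      unfolding T_def L_def L'_def sq sum_distrib_left sum.distrib by (simp add: algebra_simps)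
    finally show "T (insert j I) (x(j := y)) =
        T I x + (a j j * (complex_of_real ((cmod y)\<^sup>2) - 1) + y * L x + cnj y * L' x)" .
  next
    show "(\<integral>\<^sup>+x. ennreal (cmod (T I x) ^ 4) \<partial>PiM I (\<lambda>_. \<nu>)) \<le> ennreal (quadratic_const * F1\<^sup>2)"
      unfolding T_def using g by (intro insert.IH) (simp add: F1_def S_def)
    have "(\<integral>\<^sup>+x. ennreal (((cmod (a j j))\<^sup>2 + (cmod (L x))\<^sup>2 + (cmod (L' x))\<^sup>2)\<^sup>2) \<partial>PiM I (\<lambda>_. \<nu>)) \<le>
        (\<integral>\<^sup>+x. ennreal 3 * (ennreal (\<delta>\<^sup>2) + ennreal (cmod (L x) ^ 4) + ennreal (cmod (L' x) ^ 4)) \<partial>PiM I (\<lambda>_. \<nu>))"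
    proof (intro nn_integral_mono)
      fix x
      have "((cmod (a j j))\<^sup>2 + (cmod (L x))\<^sup>2 + (cmod (L' x))\<^sup>2)\<^sup>2 \<le> 3 * (\<delta>\<^sup>2 + cmod (L x) ^ 4 + cmod (L' x) ^ 4)"
        using three_sum_square_le[of "(cmod (a j j))\<^sup>2" "(cmod (L x))\<^sup>2" "(cmod (L' x))\<^sup>2"] dj by simp
      then show "ennreal (((cmod (a j j))\<^sup>2 + (cmod (L x))\<^sup>2 + (cmod (L' x))\<^sup>2)\<^sup>2) \<le>
          ennreal 3 * (ennreal (\<delta>\<^sup>2) + ennreal (cmod (L x) ^ 4) + ennreal (cmod (L' x) ^ 4))"
        by (subst e3) (auto intro!: ennreal_leI simp del: ennreal_plus distrib_left_numeral)
    qed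
    also have "\<dots> = ennreal 3 * (ennreal (\<delta>\<^sup>2) + (\<integral>\<^sup>+x. ennreal (cmod (L x) ^ 4) \<partial>PiM I (\<lambda>_. \<nu>)) +
        (\<integral>\<^sup>+x. ennreal (cmod (L' x) ^ 4) \<partial>PiM I (\<lambda>_. \<nu>)))"
    proof -
      note [measurable] = L_meas
      show ?thesis by (simp add: nn_integral_cmult nn_integral_add P.emeasure_space_1)
    qed
    also have "\<dots> \<le> ennreal 3 * (ennreal (\<delta>\<^sup>2) + ennreal (linear_const * \<delta>\<^sup>2) + ennreal (linear_const * \<delta>\<^sup>2))"
      by (intro mult_left_mono add_mono L4 L'4) auto
    also have "\<dots> = ennreal (3 * (1 + 2 * linear_const) * \<delta>\<^sup>2)"
      using lin0 by (subst e3) (simp_all add: algebra_simps del: ennreal_plus)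
    finally show "(\<integral>\<^sup>+x. ennreal (((cmod (a j j))\<^sup>2 + (cmod (L x))\<^sup>2 + (cmod (L' x))\<^sup>2)\<^sup>2) \<partial>PiM I (\<lambda>_. \<nu>)) \<le>
        ennreal (3 * (1 + 2 * linear_const) * \<delta>\<^sup>2)" .
  next
    show "step_const\<^sup>2 * (3 * (1 + 2 * linear_const)) \<le> quadratic_const"
      "step_const * (3 * (1 + 2 * linear_const)) \<le> quadratic_const"
      unfolding quadratic_const_def using lin0 step_const_pos by (auto intro!: mult_right_mono)
  qed (use insert.hyps pos lin0 T_meas L_meas in auto)
  then show ?case unfolding F T_def .
qed simp

end

section \<open>Spectral limits of the unperturbed matrices\<close>

lemma singular_value_nonneg_antimono:
  assumes A: "A \<in> carrier_mat n m"
  shows singular_value_nonneg: "i < n \<Longrightarrow> 0 \<le> singular_value A (Suc i)"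
    and singular_value_antimono: "i \<le> j \<Longrightarrow> j < n \<Longrightarrow> singular_value A (Suc j) \<le> singular_value A (Suc i)"
proof -
  obtain e where "singular_system n m (entries A) e (\<lambda>i. singular_value A (Suc i))"
    using singular_system_exists[OF A] by blast
  then interpret singular_system n m "entries A" e "\<lambda>i. singular_value A (Suc i)" .
  show "i < n \<Longrightarrow> 0 \<le> singular_value A (Suc i)" by (rule s_nonneg)
  show "i \<le> j \<Longrightarrow> j < n \<Longrightarrow> singular_value A (Suc j) \<le> singular_value A (Suc i)" by (rule s_antimono)
qed

text \<open>Interlacing: the \<open>r\<close> extra constraints of orthogonality to the
  \<open>u l\<close> make the update invisible, at the price of moving the index by
  \<open>r\<close>.\<close>

lemma singular_value_rank_update_le:
  assumes A: "A \<in> carrier_mat n m" and Y: "Y \<in> carrier_mat n m"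
    and AY: "entries A = rank_update (entries Y) r \<theta> u v" and i: "i + r < n"
    and s: "0 \<le> s" "singular_value A (Suc i) \<le> s"
  shows "singular_value Y (Suc (i + r)) \<le> s"
proof -
  obtain g where g: "\<And>x. x \<in> vecs n \<Longrightarrow> \<forall>j<i. ip n x (g j) = 0 \<Longrightarrow>
      nsq m (adjv (entries A) n x) \<le> s\<^sup>2 * nsq n x"
    using singular_value_le_iff[OF A _ s(1), of i] i s(2) by auto
  have "nsq m (adjv (entries Y) n x) \<le> s\<^sup>2 * nsq n x"
    if x: "x \<in> vecs n" and orth: "\<forall>j<i + r. ip n x (if j < i then g j else u (j - i)) = 0" for x
  proof -
    have 1: "ip n x (g j) = 0" if "j < i" for j using orth[rule_format, of j] that by simp
    have 2: "ip n x (u l) = 0" if "l < r" for l using orth[rule_format, of "i + l"] that by simp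
    have "adjv (entries A) n x = adjv (entries Y) n x"
      unfolding AY adjv_rank_update by (simp add: lc_def 2)
    then show ?thesis using g[OF x] 1 by simp
  qed
  then show ?thesis
    by (intro iffD2[OF singular_value_le_iff[OF Y i s(1)]] exI[of _ "\<lambda>j. if j < i then g j else u (j - i)"]) blast
qed

locale spectral_limit =
  fixes m :: "nat \<Rightarrow> nat" and Y :: "nat \<Rightarrow> complex mat" and \<mu> :: "real measure" and b :: real
  assumes Y: "Y n \<in> carrier_mat n (m n)"
    and weak: "weak_conv_m (\<lambda>n. singular_value_distribution (Y n)) \<mu>"
    and \<mu>: "prob_space \<mu>" "sets \<mu> = sets borel" "compact (measure_support \<mu>)"
    and b: "b = Sup (measure_support \<mu>)"
    and largest: "(\<lambda>n. singular_value (Y n) 1) \<longlonglongrightarrow> b"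
begin

abbreviation \<sigma> :: "nat \<Rightarrow> nat \<Rightarrow> real" where "\<sigma> n i \<equiv> singular_value (Y n) (Suc i)"

lemma weak_integral:
  fixes f :: "real \<Rightarrow> real"
  assumes f: "\<And>x. isCont f x" "\<And>x. \<bar>f x\<bar> \<le> B"
  shows "(\<lambda>n. (\<Sum>i<n. f (\<sigma> n i)) / real n) \<longlonglongrightarrow> (\<integral>x. f x \<partial>\<mu>)"
proof -
  \<comment> \<open>The sequence starts at size 1: for size 0 the empty family of singular values
    gives no probability measure.\<close>
  define D where "D = (\<lambda>n. singular_value_distribution (Y (Suc n)))"
  have "real_distribution (D n)" for n
  proof -
    have "prob_space (uniform_count_measure {1..Suc n})"
      by (intro prob_space_uniform_count_measure) auto
    then interpret U: prob_space "uniform_count_measure {1..Suc n}" .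
    have "prob_space (D n)" unfolding D_def singular_value_distribution_def
      using Y[of "Suc n"]
      by (simp only: carrier_matD, intro U.prob_space_distr)
        (auto simp: measurable_def sets_uniform_count_measure space_uniform_count_measure)
    then show ?thesis unfolding real_distribution_def real_distribution_axioms_def
      by (simp add: D_def singular_value_distribution_def)
  qed
  moreover have "real_distribution \<mu>"
    using \<mu> by (simp add: real_distribution_def real_distribution_axioms_def)
  moreover have "weak_conv_m D \<mu>"
    using weak unfolding weak_conv_m_def weak_conv_def D_def by (auto intro!: LIMSEQ_Suc)
  ultimately have lim: "(\<lambda>n. integral\<^sup>L (D n) f) \<longlonglongrightarrow> integral\<^sup>L \<mu> f"
    using f by (intro weak_conv_imp_integral_bdd_continuous_conv[where B = B]) auto
  have "integral\<^sup>L (D n) f = (\<Sum>i<Suc n. f (\<sigma> (Suc n) i)) / real (Suc n)" for n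
  proof -
    have fm: "f \<in> borel_measurable borel"
      using f(1) by (intro borel_measurable_continuous_onI continuous_at_imp_continuous_on) auto
    have "integral\<^sup>L (D n) f = (\<integral>i. f (singular_value (Y (Suc n)) i) \<partial>uniform_count_measure {1..Suc n})"
      unfolding D_def singular_value_distribution_def using Y[of "Suc n"]
      by (subst integral_distr) (auto simp: fm)
    also have "\<dots> = (\<Sum>i\<in>{1..Suc n}. f (singular_value (Y (Suc n)) i)) / real (Suc n)"
      by (subst integral_uniform_count_measure) auto
    also have "(\<Sum>i\<in>{1..Suc n}. f (singular_value (Y (Suc n)) i)) = (\<Sum>i<Suc n. f (\<sigma> (Suc n) i))"
      by (rule sum.reindex_bij_witness[of _ Suc "\<lambda>i. i - 1"]) auto
    finally show ?thesis .
  qed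
  with lim show ?thesis
    by (subst filterlim_sequentially_Suc[symmetric]) (simp only:)
qed

lemma AE_nonneg: "AE t in \<mu>. 0 \<le> t"
proof -
  interpret prob_space \<mu> by (rule \<mu>)
  define f where "f = (\<lambda>t::real. min (max (- t) 0) 1)"
  have c: "isCont f x" for x unfolding f_def by (intro continuous_intros)
  have "(\<Sum>i<n. f (\<sigma> n i)) = 0" for n
    by (intro sum.neutral) (auto simp: f_def singular_value_nonneg[OF Y])
  then have "(\<integral>t. f t \<partial>\<mu>) = 0"
    using LIMSEQ_unique[OF weak_integral[of f 1, OF c]] by (force simp: f_def)
  moreover have "integrable \<mu> f"
    using c by (intro integrable_const_bound[of _ 1])
      (auto simp: f_def measurable_cong_sets[OF \<mu>(2) refl] intro!: borel_measurable_continuous_onI continuous_intros)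
  ultimately have "AE t in \<mu>. f t = 0"
    by (subst (asm) integral_nonneg_eq_0_iff_AE) (auto simp: f_def)
  then show ?thesis by eventually_elim (auto simp: f_def min_def max_def split: if_splits)
qed

lemma AE_le: "AE t in \<mu>. t \<le> b"
proof -
  interpret prob_space \<mu> by (rule \<mu>)
  have "AE t in \<mu>. t \<le> b + 1 / real (Suc k)" for k
  proof -
    define s where "s = b + 1 / real (Suc k)"
    \<comment> \<open>This test function vanishes up to \<open>s\<close>. Since the largest singular
      value is eventually below \<open>s\<close>, its empirical means are eventually 0, and so is
      its integral.\<close>
    define f where "f = (\<lambda>t::real. min (max (t - s) 0) 1)"
    have c: "isCont f x" for x unfolding f_def by (intro continuous_intros)
    have "\<forall>\<^sub>F n in sequentially. singular_value (Y n) 1 < s"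
      using largest by (intro order_tendstoD) (auto simp: s_def)
    then have "\<forall>\<^sub>F n in sequentially. (\<Sum>i<n. f (\<sigma> n i)) / real n = 0"
    proof eventually_elim
      case (elim n)
      have "f (\<sigma> n i) = 0" if "i < n" for i
        using singular_value_antimono[OF Y, of 0 i n] that elim by (simp add: f_def)
      then show ?case by simp
    qed
    then have "(\<lambda>n. (\<Sum>i<n. f (\<sigma> n i)) / real n) \<longlonglongrightarrow> 0"
      by (rule tendsto_eventually)
    then have "(\<integral>t. f t \<partial>\<mu>) = 0"
      using LIMSEQ_unique[OF weak_integral[of f 1, OF c]] by (force simp: f_def)
    moreover have "integrable \<mu> f"
      using c by (intro integrable_const_bound[of _ 1])
        (auto simp: f_def measurable_cong_sets[OF \<mu>(2) refl] intro!: borel_measurable_continuous_onI continuous_intros)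
    ultimately have "AE t in \<mu>. f t = 0"
      by (subst (asm) integral_nonneg_eq_0_iff_AE) (auto simp: f_def)
    then show ?thesis by eventually_elim (auto simp: f_def s_def min_def max_def split: if_splits)
  qed
  then have "AE t in \<mu>. \<forall>k. t \<le> b + 1 / real (Suc k)" by (simp add: AE_all_countable)
  then show ?thesis
  proof eventually_elim
    case (elim t)
    have "(\<lambda>k. b + 1 / real (Suc k)) \<longlonglongrightarrow> b + 0"
      by (intro tendsto_intros LIMSEQ_Suc[OF lim_const_over_n])
    then show ?case using elim LIMSEQ_le_const by fastforce
  qed
qed

lemma b_nonneg: "0 \<le> b"
proof (rule LIMSEQ_le_const[OF largest])
  show "\<exists>N. \<forall>n\<ge>N. 0 \<le> singular_value (Y n) 1"
    using singular_value_nonneg[OF Y, of 0] by (intro exI[of _ 1]) auto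
qed

definition mom :: "nat \<Rightarrow> real" where "mom k = (\<integral>t. t ^ (2 * k) \<partial>\<mu>)"

lemma integrable_pow: "integrable \<mu> (\<lambda>t. t ^ k)"
proof -
  interpret prob_space \<mu> by (rule \<mu>)
  have "AE t in \<mu>. norm (t ^ k) \<le> b ^ k"
    using AE_nonneg AE_le by eventually_elim (simp add: power_mono)
  then show ?thesis by (intro integrable_const_bound) (auto simp: measurable_cong_sets[OF \<mu>(2) refl])
qed

lemma mom_bounds: "0 \<le> mom k" "mom k \<le> b ^ (2 * k)" "mom 0 = 1"
proof -
  interpret prob_space \<mu> by (rule \<mu>)
  show "0 \<le> mom k" unfolding mom_def by (intro integral_nonneg_AE) auto
  have "mom k \<le> (\<integral>t. b ^ (2 * k) \<partial>\<mu>)" unfolding mom_def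
    using AE_nonneg AE_le by (intro integral_mono_AE integrable_pow) (auto elim!: eventually_elim2 simp: power_mono)
  then show "mom k \<le> b ^ (2 * k)" by (simp add: prob_space)
  show "mom 0 = 1" by (simp add: mom_def prob_space)
qed

lemma eventually_largest_le: "b < s \<Longrightarrow> \<forall>\<^sub>F n in sequentially. \<forall>i<n. \<sigma> n i \<le> s"
  using order_tendstoD(2)[OF largest, of s]
proof (rule eventually_mono)
  fix n assume "singular_value (Y n) 1 < s"
  then show "\<forall>i<n. \<sigma> n i \<le> s"
    using singular_value_antimono[OF Y, of 0 _ n] by fastforce
qed

text \<open>Weak convergence speaks of bounded functions only. The power is cut off at
  \<open>b + 1\<close>, a level that eventually no singular value exceeds and that exceeds almost
  every point of the limit law.\<close>

lemma moment_limit: "(\<lambda>n. (\<Sum>i<n. \<sigma> n i ^ (2 * k)) / real n) \<longlonglongrightarrow> mom k"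
proof -
  define f where "f = (\<lambda>t::real. (min (max t 0) (b + 1)) ^ (2 * k))"
  have c: "isCont f x" for x unfolding f_def by (intro continuous_intros)
  have bd: "\<bar>f x\<bar> \<le> (b + 1) ^ (2 * k)" for x
    using b_nonneg by (auto simp: f_def intro!: power_mono)
  have "(\<lambda>n. (\<Sum>i<n. f (\<sigma> n i)) / real n) \<longlonglongrightarrow> (\<integral>t. f t \<partial>\<mu>)"
    by (rule weak_integral[OF c bd])
  moreover have "\<forall>\<^sub>F n in sequentially. (\<Sum>i<n. f (\<sigma> n i)) / real n = (\<Sum>i<n. \<sigma> n i ^ (2 * k)) / real n"
    using eventually_largest_le[of "b + 1", simplified]
  proof eventually_elim
    case (elim n)
    then have "f (\<sigma> n i) = \<sigma> n i ^ (2 * k)" if "i < n" for i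
      using singular_value_nonneg[OF Y that] that by (auto simp: f_def)
    then show ?case by simp
  qed
  moreover have "(\<integral>t. f t \<partial>\<mu>) = mom k"
    unfolding mom_def
    using AE_nonneg AE_le c
    by (intro integral_cong_AE)
      (auto simp: f_def measurable_cong_sets[OF \<mu>(2) refl] elim!: eventually_elim2
        intro!: borel_measurable_continuous_onI continuous_intros)
  ultimately show ?thesis using Lim_transform_eventually by fastforce
qed

lemma norm_bound:
  assumes "b < s"
  shows "\<forall>\<^sub>F n in sequentially. \<forall>x\<in>vecs n. nsq (m n) (adjv (entries (Y n)) n x) \<le> s\<^sup>2 * nsq n x"
  using eventually_largest_le[OF assms] eventually_gt_at_top[of 0]
proof eventually_elim
  case (elim n)
  then show ?case
    using singular_value_le_iff[OF Y, of 0 n s] assms b_nonneg by auto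
qed

text \<open>Otherwise open null sets would cover the line, and by Lindelof countably many of them
  would suffice. Without this the supremum \<open>b\<close> would say nothing about \<mu>.\<close>

lemma support_nonempty: "measure_support \<mu> \<noteq> {}"
proof
  interpret prob_space \<mu> by (rule \<mu>)
  assume "measure_support \<mu> = {}"
  then have ex: "\<exists>U. open U \<and> x \<in> U \<and> emeasure \<mu> U = 0" for x
    by (auto simp: measure_support_def zero_less_iff_neq_zero)
  define F where "F = {U. open U \<and> emeasure \<mu> U = 0}"
  obtain F' where F': "F' \<subseteq> F" "countable F'" "\<Union>F' = \<Union>F"
    by (rule Lindelof[of F]) (auto simp: F_def)
  have "\<Union>F = UNIV" using ex by (force simp: F_def)
  moreover have "(\<Union>U\<in>F'. U) \<in> null_sets \<mu>"
    using F' by (intro null_sets_UN') (auto simp: F_def null_sets_def \<mu>(2))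
  ultimately have "UNIV \<in> null_sets \<mu>" using F'(3) by simp
  then show False using emeasure_space_1 sets_eq_imp_space_eq[OF \<mu>(2)] by auto
qed

lemma measure_above: "s < b \<Longrightarrow> emeasure \<mu> {s<..} > 0"
proof -
  assume "s < b"
  then obtain x where "x \<in> measure_support \<mu>" "s < x"
    unfolding b using support_nonempty less_cSupD by blast
  then show ?thesis by (auto simp: measure_support_def)
qed

text \<open>The limit law charges every left neighbourhood of \<open>b\<close>, so a positive
  fraction of the singular values eventually exceeds \<open>s\<close>, hence more than any fixed
  number \<open>i\<close> of them.\<close>

lemma eventually_singular_value_gt_bulk:
  assumes "s < b"
  shows "\<forall>\<^sub>F n in sequentially. s < \<sigma> n i"
proof -
  interpret prob_space \<mu> by (rule \<mu>)
  define s' where "s' = (s + b) / 2"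
  have s': "s < s'" "s' < b" using assms by (auto simp: s'_def)
  define f where "f = (\<lambda>t::real. min (max ((t - s) / (s' - s)) 0) 1)"
  have c: "isCont f x" for x unfolding f_def using s' by (intro continuous_intros) auto
  have f01: "0 \<le> f t" "f t \<le> 1" for t by (auto simp: f_def)
  define p where "p = (\<integral>t. f t \<partial>\<mu>)"
  have fm: "f \<in> borel_measurable \<mu>"
    using c by (simp add: measurable_cong_sets[OF \<mu>(2) refl] borel_measurable_continuous_onI continuous_at_imp_continuous_on)
  have "0 < measure \<mu> {s'<..}" using measure_above[OF s'(2)] by (simp add: emeasure_eq_measure)
  also have "\<dots> = (\<integral>t. indicator {s'<..} t \<partial>\<mu>)" by (simp add: sets_eq_imp_space_eq[OF \<mu>(2)])
  also have "\<dots> \<le> p" unfolding p_def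
  proof (rule integral_mono)
    show "integrable \<mu> (indicator {s'<..} :: real \<Rightarrow> real)"
      by (intro integrable_real_indicator) (auto simp: \<mu>(2) emeasure_eq_measure)
    show "integrable \<mu> f" using fm f01 by (intro integrable_const_bound[of _ 1]) auto
    fix t show "indicator {s'<..} t \<le> f t"
      using s' f01 by (auto simp: f_def indicator_def)
  qed
  finally have p: "p > 0" .
  have "\<forall>\<^sub>F n in sequentially. p / 2 < (\<Sum>i<n. f (\<sigma> n i)) / real n"
    using weak_integral[of f 1, OF c] f01 p by (intro order_tendstoD(1)[of _ p]) (auto simp: p_def)
  moreover have "\<forall>\<^sub>F n in sequentially. real i / real n < p / 2"
    using p lim_const_over_n[of "real i"] by (intro order_tendstoD(2)) auto
  ultimately show ?thesis using eventually_gt_at_top[of i]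
  proof eventually_elim
    case (elim n)
    show ?case
    proof (rule ccontr)
      assume "\<not> s < \<sigma> n i"
      then have z: "f (\<sigma> n j) = 0" if "i \<le> j" "j < n" for j
        using singular_value_antimono[OF Y that] s' by (simp add: f_def divide_le_0_iff)
      have "(\<Sum>j<n. f (\<sigma> n j)) = (\<Sum>j<i. f (\<sigma> n j))"
        using elim(3) z by (intro sum.mono_neutral_right) auto
      also have "\<dots> \<le> (\<Sum>j<i. 1)" by (intro sum_mono f01)
      finally have "(\<Sum>j<n. f (\<sigma> n j)) / real n \<le> real i / real n" by (simp add: divide_right_mono)
      then show False using elim by simp
    qed
  qed
qed

text \<open>Interlacing moves the index by \<open>r\<close>, and a fixed index \<open>i + r\<close>
  is as good as \<open>i\<close> for the bulk. No information about the vectors of the update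
  enters, so one index n serves all of them.\<close>

lemma eventually_updated_singular_value_gt:
  assumes "s < b"
  shows "\<forall>\<^sub>F n in sequentially. \<forall>A\<in>carrier_mat n (m n). \<forall>u v.
    entries A = rank_update (entries (Y n)) r \<theta> u v \<longrightarrow> s < singular_value A (Suc i)"
  using eventually_singular_value_gt_bulk[OF assms, of "i + r"] eventually_gt_at_top[of "i + r"]
proof eventually_elim
  case (elim n)
  show ?case
  proof (intro ballI allI impI)
    fix A u v assume A: "A \<in> carrier_mat n (m n)" "entries A = rank_update (entries (Y n)) r \<theta> u v"
    show "s < singular_value A (Suc i)"
    proof (cases "0 \<le> s")
      case True
      then show ?thesis
        using singular_value_rank_update_le[OF A(1) Y A(2) elim(2), of s] elim(1) by force
    next
      case False
      then show ?thesis using singular_value_nonneg[OF A(1), of i] elim(2) by simp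
    qed
  qed
qed

lemma scaled_moment_limit:
  assumes "(\<lambda>n. real n / real (m n)) \<longlonglongrightarrow> c"
  shows "(\<lambda>n. (\<Sum>i<n. \<sigma> n i ^ (2 * k)) / real (m n)) \<longlonglongrightarrow> c * mom k"
proof -
  have "(\<lambda>n. real n / real (m n) * ((\<Sum>i<n. \<sigma> n i ^ (2 * k)) / real n)) \<longlonglongrightarrow> c * mom k"
    by (intro tendsto_mult assms moment_limit)
  moreover have "real n / real (m n) * ((\<Sum>i<n. \<sigma> n i ^ (2 * k)) / real n) =
      (\<Sum>i<n. \<sigma> n i ^ (2 * k)) / real (m n)" for n
    by (cases "n = 0") auto
  ultimately show ?thesis by simp
qed

end

section \<open>Almost sure convergence of the quadratic forms\<close>

locale random_setting = prob_space M + unit_law: unit_law \<nu>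
  for M :: "'w measure" and \<nu> :: "complex measure" +
  fixes K :: "complex set" and m :: "nat \<Rightarrow> nat" and r :: nat and X Gu Gv :: "nat \<Rightarrow> 'w \<Rightarrow> complex mat"
  assumes m: "n \<le> m n" and r: "1 \<le> r"
    and X: "random_matrix M K n (m n) (X n)"
    and Gu: "random_matrix M K n r (Gu n)" and Gv: "random_matrix M K (m n) r (Gv n)"
    and iid: "iid_matrix_pair M \<nu> n (m n) r (Gu n) (Gv n)"
    and indep: "indep_families M m r X Gu Gv"
begin

abbreviation I :: "nat \<Rightarrow> (nat \<times> nat + nat \<times> nat) set" where "I n \<equiv> pair_index n (m n) r"
text \<open>The positions in \<open>X n\<close> are tagged because the library's independence of two random variables
  requires both to take values in the same type.\<close>

abbreviation J :: "nat \<Rightarrow> (nat \<times> nat + nat \<times> nat) set" where "J n \<equiv> Inl ` ({..<n} \<times> {..<m n})"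
abbreviation g :: "nat \<Rightarrow> 'w \<Rightarrow> nat \<times> nat + nat \<times> nat \<Rightarrow> complex" where
  "g n \<omega> \<equiv> pair_entry (Gu n \<omega>) (Gv n \<omega>)"

lemma X_carrier: "\<omega> \<in> space M \<Longrightarrow> X n \<omega> \<in> carrier_mat n (m n)"
  using X[of n] by (auto simp: random_matrix_def)

lemma X_measurable: "p \<in> J n \<Longrightarrow> (\<lambda>\<omega>. X n \<omega> $$ projl p) \<in> borel_measurable M"
  using X[of n] by (auto simp: random_matrix_def)

lemma g_measurable: "p \<in> I n \<Longrightarrow> (\<lambda>\<omega>. g n \<omega> p) \<in> borel_measurable M"
  using Gu[of n] Gv[of n] by (auto simp: random_matrix_def pair_index_def pair_entry_def)

lemma finite_I: "finite (I n)"
  by (simp add: pair_index_def)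

definition Xr :: "nat \<Rightarrow> 'w \<Rightarrow> nat \<times> nat + nat \<times> nat \<Rightarrow> complex" where
  "Xr n \<omega> = restrict (\<lambda>p. X n \<omega> $$ projl p) (J n)"

definition gr :: "nat \<Rightarrow> 'w \<Rightarrow> nat \<times> nat + nat \<times> nat \<Rightarrow> complex" where
  "gr n \<omega> = restrict (g n \<omega>) (I n)"

text \<open>Independence of the whole sequences passes to their n-th members, whose coordinates
  generate smaller \<sigma>-algebras.\<close>

lemma indep_Xr_gr: "indep_var (PiM (J n) (\<lambda>_. borel)) (Xr n) (PiM (I n) (\<lambda>_. borel)) (gr n)"
proof -
  define IX where "IX = (SIGMA n:UNIV. {..<n} \<times> {..<m n})"
  define IG where "IG = (SIGMA n:UNIV. pair_index n (m n) r)"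
  define GX where "GX = (\<lambda>\<omega>. restrict (\<lambda>(n, p). X n \<omega> $$ p) IX)"
  define GG where "GG = (\<lambda>\<omega>. restrict (\<lambda>(n, p). pair_entry (Gu n \<omega>) (Gv n \<omega>) p) IG)"
  define VX where "VX = vimage_algebra (space M) GX (PiM IX (\<lambda>_. borel))"
  define VG where "VG = vimage_algebra (space M) GG (PiM IG (\<lambda>_. borel))"
  have ind: "indep_set (sets VX) (sets VG)"
    using indep unfolding indep_families_def Let_def VX_def VG_def GX_def GG_def IX_def IG_def .
  have X_V: "Xr n \<in> measurable VX (PiM (J n) (\<lambda>_. borel))"
    unfolding Xr_def
  proof (rule measurable_restrict)
    fix p assume p: "p \<in> J n"
    have "(\<lambda>h. h (n, projl p)) \<in> measurable (PiM IX (\<lambda>_. borel)) borel"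
      using p by (intro measurable_component_singleton) (auto simp: IX_def)
    moreover have "GX \<in> measurable VX (PiM IX (\<lambda>_. borel))"
      unfolding VX_def by (rule measurable_vimage_algebra1) (auto simp: GX_def space_PiM)
    ultimately have "(\<lambda>\<omega>. GX \<omega> (n, projl p)) \<in> measurable VX borel" by (rule measurable_compose[rotated])
    moreover have "GX \<omega> (n, projl p) = X n \<omega> $$ projl p" for \<omega> using p by (auto simp: GX_def IX_def)
    ultimately show "(\<lambda>\<omega>. X n \<omega> $$ projl p) \<in> borel_measurable VX" by simp
  qed
  have G_V: "gr n \<in> measurable VG (PiM (I n) (\<lambda>_. borel))"
    unfolding gr_def
  proof (rule measurable_restrict)
    fix p assume p: "p \<in> I n"
    have "(\<lambda>h. h (n, p)) \<in> measurable (PiM IG (\<lambda>_. borel)) borel"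
      using p by (intro measurable_component_singleton) (auto simp: IG_def)
    moreover have "GG \<in> measurable VG (PiM IG (\<lambda>_. borel))"
      unfolding VG_def by (rule measurable_vimage_algebra1) (auto simp: GG_def space_PiM)
    ultimately have "(\<lambda>\<omega>. GG \<omega> (n, p)) \<in> measurable VG borel" by (rule measurable_compose[rotated])
    moreover have "GG \<omega> (n, p) = g n \<omega> p" for \<omega> using p by (auto simp: GG_def IG_def)
    ultimately show "(\<lambda>\<omega>. g n \<omega> p) \<in> borel_measurable VG" by simp
  qed
  have sp: "space VX = space M" "space VG = space M" by (simp_all add: VX_def VG_def)
  have "sigma_sets (space M) {Xr n -` A \<inter> space M |A. A \<in> sets (PiM (J n) (\<lambda>_. borel))} \<subseteq> sets VX"
    using measurable_sets[OF X_V] sets.sigma_sets_subset[of _ VX] unfolding sp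
    by (intro sets.sigma_sets_subset[of _ VX, unfolded sp]) blast
  moreover have "sigma_sets (space M) {gr n -` A \<inter> space M |A. A \<in> sets (PiM (I n) (\<lambda>_. borel))} \<subseteq> sets VG"
    using measurable_sets[OF G_V] unfolding sp
    by (intro sets.sigma_sets_subset[of _ VG, unfolded sp]) blast
  ultimately have "indep_set (sigma_sets (space M) {Xr n -` A \<inter> space M |A. A \<in> sets (PiM (J n) (\<lambda>_. borel))})
      (sigma_sets (space M) {gr n -` A \<inter> space M |A. A \<in> sets (PiM (I n) (\<lambda>_. borel))})"
    using ind unfolding indep_set_def by (elim indep_sets_mono_sets) (auto split: bool.splits)
  moreover have "Xr n \<in> measurable M (PiM (J n) (\<lambda>_. borel))"
    unfolding Xr_def by (intro measurable_restrict X_measurable)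
  moreover have "gr n \<in> measurable M (PiM (I n) (\<lambda>_. borel))"
    unfolding gr_def by (intro measurable_restrict g_measurable)
  ultimately show ?thesis by (simp add: indep_var_eq)
qed

lemma distr_gr:
  assumes "0 < n"
  shows "distr M (PiM (I n) (\<lambda>_. borel)) (gr n) = PiM (I n) (\<lambda>_. \<nu>)"
proof -
  have ne: "I n \<noteq> {}" using assms r by (auto simp: pair_index_def lessThan_empty_iff)
  have iv: "indep_vars (\<lambda>_. borel) (\<lambda>p \<omega>. g n \<omega> p) (I n)" and law: "\<And>p. p \<in> I n \<Longrightarrow> distr M borel (\<lambda>\<omega>. g n \<omega> p) = \<nu>"
    using iid[of n] by (auto simp: iid_matrix_pair_def)
  have "distr M (PiM (I n) (\<lambda>_. borel)) (gr n) = (\<Pi>\<^sub>M p\<in>I n. distr M borel (\<lambda>\<omega>. g n \<omega> p))"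
    using iffD1[OF indep_vars_iff_distr_eq_PiM'[OF ne g_measurable] iv] by (simp add: gr_def[abs_def])
  also have "\<dots> = PiM (I n) (\<lambda>_. \<nu>)" by (intro PiM_cong refl law)
  finally show ?thesis .
qed

text \<open>By independence the joint law is a product, so a bound valid for every frozen value
  \<xi> of the matrix survives integration over \<xi>.\<close>

lemma nn_integral_Xr_gr:
  assumes n: "0 < n"
    and F: "F \<in> borel_measurable (PiM (J n) (\<lambda>_. borel) \<Otimes>\<^sub>M PiM (I n) (\<lambda>_. borel))"
    and le: "\<And>\<xi>. (\<integral>\<^sup>+y. F (\<xi>, y) \<partial>PiM (I n) (\<lambda>_. \<nu>)) \<le> C"
  shows "(\<integral>\<^sup>+\<omega>. F (Xr n \<omega>, gr n \<omega>) \<partial>M) \<le> C"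
proof -
  define S where "S = PiM (J n) (\<lambda>_. borel :: complex measure)"
  define T where "T = PiM (I n) (\<lambda>_. borel :: complex measure)"
  have dist: "distr M S (Xr n) \<Otimes>\<^sub>M PiM (I n) (\<lambda>_. \<nu>) = distr M (S \<Otimes>\<^sub>M T) (\<lambda>\<omega>. (Xr n \<omega>, gr n \<omega>))"
    and rv: "Xr n \<in> measurable M S" "gr n \<in> measurable M T"
    using indep_Xr_gr[of n] unfolding indep_var_distribution_eq distr_gr[OF n] S_def T_def by auto
  interpret D: prob_space "distr M S (Xr n)" by (rule prob_space_distr[OF rv(1)])
  interpret N: prob_space "PiM (I n) (\<lambda>_. \<nu>)" by (intro prob_space_PiM unit_law.prob_space_axioms)
  have F': "F \<in> borel_measurable (distr M S (Xr n) \<Otimes>\<^sub>M PiM (I n) (\<lambda>_. \<nu>))"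
    unfolding dist using F by (simp add: S_def T_def)
  have "(\<integral>\<^sup>+\<omega>. F (Xr n \<omega>, gr n \<omega>) \<partial>M) = (\<integral>\<^sup>+z. F z \<partial>distr M (S \<Otimes>\<^sub>M T) (\<lambda>\<omega>. (Xr n \<omega>, gr n \<omega>)))"
    using F rv by (subst nn_integral_distr) (auto simp: S_def T_def)
  also have "\<dots> = (\<integral>\<^sup>+\<xi>. (\<integral>\<^sup>+y. F (\<xi>, y) \<partial>PiM (I n) (\<lambda>_. \<nu>)) \<partial>distr M S (Xr n))"
    unfolding dist[symmetric] using N.nn_integral_fst[OF F'] by simp
  also have "\<dots> \<le> (\<integral>\<^sup>+\<xi>. C \<partial>distr M S (Xr n))" by (intro nn_integral_mono le)
  also have "\<dots> = C" using D.emeasure_space_1 by simp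
  finally show ?thesis .
qed

text \<open>Recovers the matrix from a point of the product space, so that coefficients depending on
  the matrix become functions there and their measurability can be stated.\<close>

definition of_point :: "nat \<Rightarrow> (nat \<times> nat + nat \<times> nat \<Rightarrow> complex) \<Rightarrow> nat \<Rightarrow> nat \<Rightarrow> complex" where
  "of_point n \<xi> = (\<lambda>j k. if j < n \<and> k < m n then \<xi> (Inl (j, k)) else 0)"

lemma entries_X: "\<omega> \<in> space M \<Longrightarrow> entries (X n \<omega>) = of_point n (Xr n \<omega>)"
  using X_carrier[of \<omega> n] by (auto simp: entries_def of_point_def Xr_def fun_eq_iff)

definition form :: "(nat \<Rightarrow> (nat \<Rightarrow> nat \<Rightarrow> complex) \<Rightarrow> nat \<times> nat + nat \<times> nat \<Rightarrow> nat \<times> nat + nat \<times> nat \<Rightarrow> complex) \<Rightarrow>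
    nat \<Rightarrow> 'w \<Rightarrow> complex" where
  "form A n \<omega> = (\<Sum>p\<in>I n. \<Sum>q\<in>I n. A n (entries (X n \<omega>)) p q * g n \<omega> p * cnj (g n \<omega> q)) -
     (\<Sum>p\<in>I n. A n (entries (X n \<omega>)) p p)"

text \<open>The coefficients depend on \<open>X\<close>, which is independent of the variables. Cutting off where the squared
  Frobenius norm exceeds \<open>B / n\<close> makes the fourth moments \<open>O(n\<^sup>-\<^sup>2)\<close>, hence summable.\<close>

lemma forms_tendsto_0:
  assumes meas: "\<And>n p q. (\<lambda>\<xi>. A n (of_point n \<xi>) p q) \<in> borel_measurable (PiM (J n) (\<lambda>_. borel))"
    and bound: "AE \<omega> in M. \<exists>B. \<forall>\<^sub>F n in sequentially.
      (\<Sum>p\<in>I n. \<Sum>q\<in>I n. (cmod (A n (entries (X n \<omega>)) p q))\<^sup>2) < B / real n"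
  shows "AE \<omega> in M. (\<lambda>n. form A n \<omega>) \<longlonglongrightarrow> 0"
proof -
  define frob where "frob = (\<lambda>n Z. \<Sum>p\<in>I n. \<Sum>q\<in>I n. (cmod (A n Z p q))\<^sup>2)"
  define Q where "Q = (\<lambda>n Z y. (\<Sum>p\<in>I n. \<Sum>q\<in>I n. A n Z p q * y p * cnj (y q)) - (\<Sum>p\<in>I n. A n Z p p))"
  define h where "h = (\<lambda>B n \<omega>. cmod (form A n \<omega>) ^ 4 * (if frob n (entries (X n \<omega>)) < B / real n then 1 else 0))"
  define F where "F = (\<lambda>B n (\<xi>, y). ennreal (cmod (Q n (of_point n \<xi>) y) ^ 4 *
      (if frob n (of_point n \<xi>) < B / real n then 1 else 0)))"
  have form_Q: "form A n \<omega> = Q n (entries (X n \<omega>)) (gr n \<omega>)" for n \<omega>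
    by (simp add: form_def Q_def gr_def)
  have F_meas: "F B n \<in> borel_measurable (PiM (J n) (\<lambda>_. borel) \<Otimes>\<^sub>M PiM (I n) (\<lambda>_. borel))" for B n
  proof -
    let ?P = "PiM (J n) (\<lambda>_. borel :: complex measure) \<Otimes>\<^sub>M PiM (I n) (\<lambda>_. borel :: complex measure)"
    have a: "(\<lambda>z. A n (of_point n (fst z)) p q) \<in> borel_measurable ?P" for p q
      by (rule measurable_compose[OF measurable_fst meas])
    have y: "(\<lambda>z. snd z p) \<in> borel_measurable ?P" if "p \<in> I n" for p
      by (rule measurable_compose[OF measurable_snd measurable_component_singleton[OF that]])
    have cy: "(\<lambda>z. cnj (snd z p)) \<in> borel_measurable ?P" if "p \<in> I n" for p
      by (rule measurable_compose[OF y[OF that]]) (auto intro!: borel_measurable_continuous_onI continuous_intros)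
    have 1: "(\<lambda>z. Q n (of_point n (fst z)) (snd z)) \<in> borel_measurable ?P"
      unfolding Q_def by (intro borel_measurable_diff borel_measurable_sum borel_measurable_times a y cy)
    have 2: "(\<lambda>z. frob n (of_point n (fst z))) \<in> borel_measurable ?P"
      unfolding frob_def by (intro borel_measurable_sum borel_measurable_power measurable_compose[OF a borel_measurable_norm])
    note [measurable] = 1 2
    have "(\<lambda>z. ennreal (cmod (Q n (of_point n (fst z)) (snd z)) ^ 4 *
      (if frob n (of_point n (fst z)) < B / real n then 1 else 0))) \<in> borel_measurable ?P"
      by measurable
    then show ?thesis by (simp add: F_def case_prod_beta')
  qed
  have int_h: "(\<integral>\<^sup>+\<omega>. ennreal (h B n \<omega>) \<partial>M) \<le> ennreal (unit_law.quadratic_const * (B / real n)\<^sup>2)" if n: "0 < n" for B n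
  proof -
    have "(\<integral>\<^sup>+\<omega>. ennreal (h B n \<omega>) \<partial>M) = (\<integral>\<^sup>+\<omega>. F B n (Xr n \<omega>, gr n \<omega>) \<partial>M)"
      by (intro nn_integral_cong) (simp add: h_def F_def form_Q entries_X)
    also have "\<dots> \<le> ennreal (unit_law.quadratic_const * (B / real n)\<^sup>2)"
    proof (rule nn_integral_Xr_gr[OF n F_meas])
      fix \<xi>
      show "(\<integral>\<^sup>+y. F B n (\<xi>, y) \<partial>PiM (I n) (\<lambda>_. \<nu>)) \<le> ennreal (unit_law.quadratic_const * (B / real n)\<^sup>2)"
      proof (cases "frob n (of_point n \<xi>) < B / real n")
        case True
        then show ?thesis
          using unit_law.quadratic_form_fourth_moment[OF finite_I, where a = "A n (of_point n \<xi>)" and F = "B / real n"]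
          by (simp add: F_def Q_def frob_def)
      qed (simp add: F_def)
    qed
    finally show ?thesis .
  qed
  have h_meas: "(\<lambda>\<omega>. ennreal (h B n \<omega>)) \<in> borel_measurable M" for B n
  proof -
    have "(\<lambda>\<omega>. F B n (Xr n \<omega>, gr n \<omega>)) \<in> borel_measurable M"
    proof (rule measurable_compose[OF _ F_meas])
      show "(\<lambda>\<omega>. (Xr n \<omega>, gr n \<omega>)) \<in> measurable M (PiM (J n) (\<lambda>_. borel) \<Otimes>\<^sub>M PiM (I n) (\<lambda>_. borel))"
        unfolding Xr_def gr_def by (intro measurable_Pair measurable_restrict X_measurable g_measurable)
    qed
    then show ?thesis
      by (rule measurable_cong[THEN iffD1, rotated]) (simp add: h_def F_def form_Q entries_X)
  qed
  \<comment> \<open>The Frobenius bound \<open>B\<close> may depend on \<omega>. Restricting it to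
    natural numbers leaves countably many null sets to discard.\<close>
  have AE_B: "AE \<omega> in M. (\<lambda>n. h (real B) n \<omega>) \<longlonglongrightarrow> 0" for B :: nat
  proof -
    define qc where "qc = unit_law.quadratic_const"
    have qc: "qc \<ge> 0" unfolding qc_def unit_law.quadratic_const_def unit_law.linear_const_def
      using unit_law.step_const_pos by simp
    have "(\<integral>\<^sup>+\<omega>. (\<Sum>n. ennreal (h B (Suc n) \<omega>)) \<partial>M) = (\<Sum>n. \<integral>\<^sup>+\<omega>. ennreal (h B (Suc n) \<omega>) \<partial>M)"
      by (intro nn_integral_suminf h_meas)
    also have "\<dots> \<le> (\<Sum>n. ennreal (qc * (B / real (Suc n))\<^sup>2))"
      unfolding qc_def by (intro suminf_le int_h) auto
    also have "\<dots> < \<infinity>"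
    proof -
      have "summable (\<lambda>n. qc * (real B)\<^sup>2 * (1 / real (Suc n) ^ 2))"
        using inverse_power_summable[of 2, where 'a = real]
        by (intro summable_mult) (subst summable_Suc_iff, simp add: field_simps)
      then have "summable (\<lambda>n. qc * (B / real (Suc n))\<^sup>2)" by (simp add: power_divide)
      then show ?thesis using qc by (subst suminf_ennreal2) auto
    qed
    finally have "(\<integral>\<^sup>+\<omega>. (\<Sum>n. ennreal (h B (Suc n) \<omega>)) \<partial>M) \<noteq> \<infinity>" by simp
    then have "AE \<omega> in M. (\<Sum>n. ennreal (h B (Suc n) \<omega>)) \<noteq> \<infinity>"
    proof (rule nn_integral_PInf_AE[rotated])
      note h_meas [measurable]
      show "(\<lambda>\<omega>. \<Sum>n. ennreal (h B (Suc n) \<omega>)) \<in> borel_measurable M" by measurable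
    qed
    then show ?thesis
    proof eventually_elim
      case (elim \<omega>)
      have "summable (\<lambda>n. h B (Suc n) \<omega>)"
        using elim by (intro summable_suminf_not_top) (auto simp: h_def)
      then have "(\<lambda>n. h B (Suc n) \<omega>) \<longlonglongrightarrow> 0" by (rule summable_LIMSEQ_zero)
      then show ?case by (rule LIMSEQ_imp_Suc)
    qed
  qed
  then have "AE \<omega> in M. \<forall>B::nat. (\<lambda>n. h (real B) n \<omega>) \<longlonglongrightarrow> 0" by (simp add: AE_all_countable)
  with bound show ?thesis
  proof eventually_elim
    case (elim \<omega>)
    then obtain B where B: "\<forall>\<^sub>F n in sequentially. frob n (entries (X n \<omega>)) < B / real n"
      by (auto simp: frob_def)
    obtain B' :: nat where B': "B \<le> real B'" using real_arch_simple by blast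
    have "\<forall>\<^sub>F n in sequentially. h (real B') n \<omega> = cmod (form A n \<omega>) ^ 4"
      using B
    proof eventually_elim
      case (elim n)
      then have "frob n (entries (X n \<omega>)) < real B' / real n"
        using B' by (meson divide_right_mono less_le_trans of_nat_0_le_iff)
      then show ?case by (simp add: h_def)
    qed
    then have "(\<lambda>n. cmod (form A n \<omega>) ^ 4) \<longlonglongrightarrow> 0"
      by (rule Lim_transform_eventually[OF elim(2)[rule_format, of B']])
    then have "(\<lambda>n. root 4 (cmod (form A n \<omega>) ^ 4)) \<longlonglongrightarrow> root 4 0" by (intro tendsto_real_root)
    then have "(\<lambda>n. cmod (form A n \<omega>)) \<longlonglongrightarrow> 0" by (simp add: real_root_power_cancel)
    then show ?case by (rule tendsto_norm_zero_cancel)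
  qed
qed

end

section \<open>One quadratic form in the joint i.i.d. family of entries\<close>

lemma sum_pair_index_column:
  fixes G :: "nat \<times> nat + nat \<times> nat \<Rightarrow> 'b::comm_monoid_add"
  assumes i: "i < r" and z: "\<And>a i'. i' \<noteq> i \<Longrightarrow> G (Inl (a, i')) = 0" "\<And>a i'. i' \<noteq> i \<Longrightarrow> G (Inr (a, i')) = 0"
  shows "(\<Sum>p\<in>pair_index n m r. G p) = (\<Sum>a<n. G (Inl (a, i))) + (\<Sum>a<m. G (Inr (a, i)))"
proof -
  have col: "(\<Sum>p\<in>A \<times> {..<r}. H p) = (\<Sum>a\<in>A. H (a, i))"
    if "\<And>a i'. i' \<noteq> i \<Longrightarrow> H (a, i') = 0" for H :: "nat \<times> nat \<Rightarrow> 'b" and A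
  proof -
    have "(\<Sum>p\<in>A \<times> {..<r}. H p) = (\<Sum>a\<in>A. \<Sum>i'<r. H (a, i'))"
      by (simp add: sum.cartesian_product)
    also have "\<dots> = (\<Sum>a\<in>A. \<Sum>i'\<in>{i}. H (a, i'))"
      using i that by (intro sum.cong refl sum.mono_neutral_right) auto
    finally show ?thesis by simp
  qed
  show ?thesis
    unfolding pair_index_def
    by (subst sum.Plus) (simp_all add: col[of "\<lambda>p. G (Inl p)"] col[of "\<lambda>p. G (Inr p)"] z)
qed

text \<open>Forms in column \<open>i\<close> on the left and column \<open>j\<close> on the right
  are read as one form in all entries of both matrices. The block with u on the left and v on the
  right is 0, since such forms are conjugates of those in the \<open>kvu\<close> block.\<close>

definition block_kernel ::
  "nat \<Rightarrow> nat \<Rightarrow> (nat \<Rightarrow> nat \<Rightarrow> complex) \<Rightarrow> (nat \<Rightarrow> nat \<Rightarrow> complex) \<Rightarrow> (nat \<Rightarrow> nat \<Rightarrow> complex) \<Rightarrow>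
   nat \<times> nat + nat \<times> nat \<Rightarrow> nat \<times> nat + nat \<times> nat \<Rightarrow> complex" where
  "block_kernel i j kuu kvv kvu p q = (case p of
     Inl (a, i') \<Rightarrow> (case q of Inl (b, j') \<Rightarrow> if i' = i \<and> j' = j then kuu a b else 0 | Inr _ \<Rightarrow> 0)
   | Inr (a, i') \<Rightarrow> (case q of Inl (b, j') \<Rightarrow> if i' = i \<and> j' = j then kvu a b else 0
                            | Inr (b, j') \<Rightarrow> if i' = i \<and> j' = j then kvv a b else 0))"

lemma sum_block_kernel:
  fixes F :: "complex \<Rightarrow> nat \<times> nat + nat \<times> nat \<Rightarrow> nat \<times> nat + nat \<times> nat \<Rightarrow> 'b::comm_monoid_add"
  assumes ij: "i < r" "j < r" and F: "\<And>p q. F 0 p q = 0"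
  shows "(\<Sum>p\<in>pair_index n m r. \<Sum>q\<in>pair_index n m r. F (block_kernel i j kuu kvv kvu p q) p q) =
    (\<Sum>a<n. \<Sum>b<n. F (kuu a b) (Inl (a, i)) (Inl (b, j))) +
    ((\<Sum>a<m. \<Sum>b<n. F (kvu a b) (Inr (a, i)) (Inl (b, j))) +
     (\<Sum>a<m. \<Sum>b<m. F (kvv a b) (Inr (a, i)) (Inr (b, j))))"
proof -
  have "(\<Sum>q\<in>pair_index n m r. F (block_kernel i j kuu kvv kvu p q) p q) =
      (\<Sum>b<n. F (block_kernel i j kuu kvv kvu p (Inl (b, j))) p (Inl (b, j))) +
      (\<Sum>b<m. F (block_kernel i j kuu kvv kvu p (Inr (b, j))) p (Inr (b, j)))" for p
    by (rule sum_pair_index_column[OF ij(2)]) (auto simp: block_kernel_def F split: sum.splits)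
  then show ?thesis
    by (simp, subst sum_pair_index_column[OF ij(1)]) (auto simp: block_kernel_def F sum.distrib)
qed

text \<open>The centring term decides the limits. For different columns no nonzero position lies on
  the diagonal, and the \<open>kvu\<close> block has none there at all; this is why the mixed forms
  tend to 0.\<close>

lemma trace_block_kernel:
  assumes ij: "i < r" "j < r"
  shows "(\<Sum>p\<in>pair_index n m r. block_kernel i j kuu kvv kvu p p) =
    (if i = j then (\<Sum>a<n. kuu a a) + (\<Sum>a<m. kvv a a) else 0)"
  by (subst sum_pair_index_column[OF ij(1)]) (auto simp: block_kernel_def)

section \<open>Traces and Frobenius norms of the coefficient kernels\<close>

context singular_system
begin

lemma nsq_adjv_eigen: "i < n \<Longrightarrow> nsq m (adjv X n (e i)) = (s i)\<^sup>2"
proof -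
  assume i: "i < n"
  have "complex_of_real (nsq m (adjv X n (e i))) = ip n (gram X n m (e i)) (e i)"
    by (simp add: ip_self ip_gram)
  also have "\<dots> = complex_of_real ((s i)\<^sup>2)"
    using i orthonormalD(2)[OF basis, of i i] by (simp add: eigen ip_scale_left)
  finally show ?thesis using of_real_eq_iff by blast
qed

lemma trace_mulv:
  "(\<Sum>a<m. ip n ((gram X n m ^^ p) (mulv X m (unitv a))) (mulv X m (unitv a))) =
    complex_of_real (\<Sum>i<n. s i ^ (2 * p + 2))"
proof -
  have ipe: "ip n (mulv X m (unitv a)) (e i) = cnj (adjv X n (e i) a)" if "a < m" for a i
    unfolding ip_mulv using that by (subst cnj_ip[symmetric]) (simp add: ip_unitv_right)
  have "(\<Sum>a<m. ip n ((gram X n m ^^ p) (mulv X m (unitv a))) (mulv X m (unitv a))) =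
    (\<Sum>a<m. \<Sum>i<n. complex_of_real (s i ^ (2 * p)) * (adjv X n (e i) a * cnj (adjv X n (e i) a)))"
    by (intro sum.cong refl, subst ip_gram_pow) (simp_all add: mulv_in_vecs kern ipe mult_ac)
  also have "\<dots> = (\<Sum>i<n. complex_of_real (s i ^ (2 * p)) * ip m (adjv X n (e i)) (adjv X n (e i)))"
    unfolding ip_def sum_distrib_left by (rule sum.swap)
  also have "\<dots> = complex_of_real (\<Sum>i<n. s i ^ (2 * p + 2))"
    by (simp add: ip_self nsq_adjv_eigen power_add power2_eq_square mult_ac)
  finally show ?thesis .
qed

text \<open>The squared Frobenius norm of a power of a self-adjoint operator is the trace of the
  doubled power.\<close>

lemma frobenius_uu:
  "(\<Sum>a<n. \<Sum>b<n. (cmod (ip n ((gram X n m ^^ p) (unitv a)) (unitv b)))\<^sup>2) = (\<Sum>i<n. s i ^ (4 * p))"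
proof -
  have "complex_of_real (\<Sum>a<n. \<Sum>b<n. (cmod (ip n ((gram X n m ^^ p) (unitv a)) (unitv b)))\<^sup>2) =
      (\<Sum>a<n. complex_of_real (nsq n ((gram X n m ^^ p) (unitv a))))"
    by (simp add: nsq_def ip_unitv_right)
  also have "\<dots> = complex_of_real (\<Sum>i<n. s i ^ (4 * p))"
    using trace_gram_pow[of "p + p"] by (simp add: ip_self[symmetric] ip_gram_pow_pow mult_2[symmetric])
  finally show ?thesis using of_real_eq_iff by blast
qed

lemma frobenius_vu:
  "(\<Sum>a<m. \<Sum>b<n. (cmod (ip n ((gram X n m ^^ p) (mulv X m (unitv a))) (unitv b)))\<^sup>2) = (\<Sum>i<n. s i ^ (4 * p + 2))"
proof -
  have "complex_of_real (\<Sum>a<m. \<Sum>b<n. (cmod (ip n ((gram X n m ^^ p) (mulv X m (unitv a))) (unitv b)))\<^sup>2) =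
      (\<Sum>a<m. complex_of_real (nsq n ((gram X n m ^^ p) (mulv X m (unitv a)))))"
    by (simp add: nsq_def ip_unitv_right)
  also have "\<dots> = complex_of_real (\<Sum>i<n. s i ^ (4 * p + 2))"
    using trace_mulv[of "p + p"] by (simp add: ip_self[symmetric] ip_gram_pow_pow mult_2[symmetric])
  finally show ?thesis using of_real_eq_iff by blast
qed

lemma frobenius_vv:
  "(\<Sum>a<m. \<Sum>b<m. (cmod (ip n ((gram X n m ^^ p) (mulv X m (unitv a))) (mulv X m (unitv b))))\<^sup>2) =
    (\<Sum>i<n. s i ^ (4 * p + 4))"
proof -
  have sq: "(\<Sum>b<m. (cmod (ip n y (mulv X m (unitv b))))\<^sup>2) = nsq m (adjv X n y)" for y
    by (simp add: nsq_def ip_adjv[symmetric] ip_unitv_right)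
  have step: "complex_of_real (nsq m (adjv X n ((gram X n m ^^ p) y))) = ip n ((gram X n m ^^ (Suc p + p)) y) y" for y
  proof -
    have "complex_of_real (nsq m (adjv X n ((gram X n m ^^ p) y))) = ip n ((gram X n m ^^ Suc p) y) ((gram X n m ^^ p) y)"
      by (simp add: ip_self[symmetric] ip_gram)
    then show ?thesis by (simp only: ip_gram_pow_pow)
  qed
  have "complex_of_real (\<Sum>a<m. \<Sum>b<m. (cmod (ip n ((gram X n m ^^ p) (mulv X m (unitv a))) (mulv X m (unitv b))))\<^sup>2) =
      (\<Sum>a<m. ip n ((gram X n m ^^ (Suc p + p)) (mulv X m (unitv a))) (mulv X m (unitv a)))"
    unfolding sq of_real_sum step ..
  also have "\<dots> = complex_of_real (\<Sum>i<n. s i ^ (2 * (Suc p + p) + 2))" by (rule trace_mulv)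
  finally have "(\<Sum>a<m. \<Sum>b<m. (cmod (ip n ((gram X n m ^^ p) (mulv X m (unitv a))) (mulv X m (unitv b))))\<^sup>2) =
      (\<Sum>i<n. s i ^ (2 * (Suc p + p) + 2))" using of_real_eq_iff by blast
  also have "2 * (Suc p + p) + 2 = 4 * p + 4" by simp
  finally show ?thesis .
qed

end

section \<open>Measurability in the matrix entries\<close>

lemma mulv_measurable:
  assumes "\<And>j k. (\<lambda>w. X w j k) \<in> borel_measurable N" "\<And>j. (\<lambda>w. y w j) \<in> borel_measurable N"
  shows "(\<lambda>w. mulv (X w) m (y w) j) \<in> borel_measurable N"
  unfolding mulv_def by (intro borel_measurable_sum borel_measurable_times assms)

lemma borel_measurable_cnj_comp:
  fixes f :: "'a \<Rightarrow> complex"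
  shows "f \<in> borel_measurable N \<Longrightarrow> (\<lambda>w. cnj (f w)) \<in> borel_measurable N"
  by (erule measurable_compose) (auto intro!: borel_measurable_continuous_onI continuous_intros)

lemma adjv_measurable:
  assumes "\<And>j k. (\<lambda>w. X w j k) \<in> borel_measurable N" "\<And>j. (\<lambda>w. y w j) \<in> borel_measurable N"
  shows "(\<lambda>w. adjv (X w) n (y w) j) \<in> borel_measurable N"
  unfolding adjv_def by (intro borel_measurable_sum borel_measurable_times borel_measurable_cnj_comp assms)

lemma gram_pow_measurable:
  assumes X: "\<And>j k. (\<lambda>w. X w j k) \<in> borel_measurable N" and y: "\<And>j. (\<lambda>w. y w j) \<in> borel_measurable N"
  shows "(\<lambda>w. (gram (X w) n m ^^ p) (y w) j) \<in> borel_measurable N"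
proof (induction p arbitrary: j)
  case (Suc p)
  then show ?case unfolding funpow.simps o_def gram_def
    by (intro mulv_measurable adjv_measurable X) (simp add: gram_def)
qed (simp add: y)

lemma ip_measurable:
  assumes "\<And>j. (\<lambda>w. x w j) \<in> borel_measurable N" "\<And>j. (\<lambda>w. y w j) \<in> borel_measurable N"
  shows "(\<lambda>w. ip n (x w) (y w)) \<in> borel_measurable N"
  unfolding ip_def by (intro borel_measurable_sum borel_measurable_times borel_measurable_cnj_comp assms)

definition scaled_column :: "nat \<Rightarrow> complex mat \<Rightarrow> nat \<Rightarrow> nat \<Rightarrow> complex" where
  "scaled_column n G i = (\<lambda>a. if a < n then G $$ (a, i) / complex_of_real (sqrt (real n)) else 0)"

lemma scaled_column_lc: "scaled_column n G i = lc n (\<lambda>a. G $$ (a, i) / complex_of_real (sqrt (real n))) unitv"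
  by (auto simp: scaled_column_def lc_def unitv_def if_distrib fun_eq_iff cong: if_cong)

lemma mulv_scaled_column:
  "mulv X m (scaled_column m G i) = lc m (\<lambda>a. G $$ (a, i) / complex_of_real (sqrt (real m))) (\<lambda>a. mulv X m (unitv a))"
  unfolding scaled_column_lc mulv_lc ..

section \<open>Almost sure limits of the four families of forms\<close>

context random_setting
begin

lemma block_forms_tendsto:
  fixes kuu kvv kvu :: "nat \<Rightarrow> (nat \<Rightarrow> nat \<Rightarrow> complex) \<Rightarrow> nat \<Rightarrow> nat \<Rightarrow> complex"
  assumes ij: "i < r" "j < r"
    and meas: "\<And>n a b. (\<lambda>\<xi>. kuu n (of_point n \<xi>) a b) \<in> borel_measurable (PiM (J n) (\<lambda>_. borel))"
      "\<And>n a b. (\<lambda>\<xi>. kvv n (of_point n \<xi>) a b) \<in> borel_measurable (PiM (J n) (\<lambda>_. borel))"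
      "\<And>n a b. (\<lambda>\<xi>. kvu n (of_point n \<xi>) a b) \<in> borel_measurable (PiM (J n) (\<lambda>_. borel))"
    and bound: "AE \<omega> in M. \<exists>B. \<forall>\<^sub>F n in sequentially.
      (\<Sum>a<n. \<Sum>b<n. (cmod (kuu n (entries (X n \<omega>)) a b))\<^sup>2) +
      ((\<Sum>a<m n. \<Sum>b<n. (cmod (kvu n (entries (X n \<omega>)) a b))\<^sup>2) +
       (\<Sum>a<m n. \<Sum>b<m n. (cmod (kvv n (entries (X n \<omega>)) a b))\<^sup>2)) < B / real n"
    and trace: "AE \<omega> in M. (\<lambda>n. (\<Sum>a<n. kuu n (entries (X n \<omega>)) a a) +
      (\<Sum>a<m n. kvv n (entries (X n \<omega>)) a a)) \<longlonglongrightarrow> L"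
  shows "AE \<omega> in M. (\<lambda>n.
      (\<Sum>a<n. \<Sum>b<n. kuu n (entries (X n \<omega>)) a b * Gu n \<omega> $$ (a, i) * cnj (Gu n \<omega> $$ (b, j))) +
      ((\<Sum>a<m n. \<Sum>b<n. kvu n (entries (X n \<omega>)) a b * Gv n \<omega> $$ (a, i) * cnj (Gu n \<omega> $$ (b, j))) +
       (\<Sum>a<m n. \<Sum>b<m n. kvv n (entries (X n \<omega>)) a b * Gv n \<omega> $$ (a, i) * cnj (Gv n \<omega> $$ (b, j)))))
    \<longlonglongrightarrow> (if i = j then L else 0)"
proof -
  define A where "A = (\<lambda>n Z. block_kernel i j (kuu n Z) (kvv n Z) (kvu n Z))"
  have "AE \<omega> in M. (\<lambda>n. form A n \<omega>) \<longlonglongrightarrow> 0"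
  proof (rule forms_tendsto_0)
    show "(\<lambda>\<xi>. A n (of_point n \<xi>) p q) \<in> borel_measurable (PiM (J n) (\<lambda>_. borel))" for n p q
    proof -
      have const_if: "(\<lambda>\<xi>. if P then f \<xi> else 0) \<in> borel_measurable (PiM (J n) (\<lambda>_. borel))"
        if "f \<in> borel_measurable (PiM (J n) (\<lambda>_. borel))" for P and f :: "_ \<Rightarrow> complex"
        using that by (cases P) simp_all
      show ?thesis
        unfolding A_def block_kernel_def
        by (cases p; cases q) (auto split: prod.split intro!: const_if meas)
    qed
    show "AE \<omega> in M. \<exists>B. \<forall>\<^sub>F n in sequentially.
        (\<Sum>p\<in>I n. \<Sum>q\<in>I n. (cmod (A n (entries (X n \<omega>)) p q))\<^sup>2) < B / real n"
      using bound unfolding A_def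
      by (subst sum_block_kernel[OF ij, where F = "\<lambda>z _ _. (cmod z)\<^sup>2"]) simp_all
  qed
  then show ?thesis using trace
  proof eventually_elim
    case (elim \<omega>)
    have "(\<lambda>n. form A n \<omega> + (if i = j then (\<Sum>a<n. kuu n (entries (X n \<omega>)) a a) +
        (\<Sum>a<m n. kvv n (entries (X n \<omega>)) a a) else 0)) \<longlonglongrightarrow> 0 + (if i = j then L else 0)"
      using elim by (intro tendsto_add) auto
    moreover have "(\<Sum>p\<in>I n. \<Sum>q\<in>I n. A n (entries (X n \<omega>)) p q * g n \<omega> p * cnj (g n \<omega> q)) =
      (\<Sum>a<n. \<Sum>b<n. kuu n (entries (X n \<omega>)) a b * Gu n \<omega> $$ (a, i) * cnj (Gu n \<omega> $$ (b, j))) +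
      ((\<Sum>a<m n. \<Sum>b<n. kvu n (entries (X n \<omega>)) a b * Gv n \<omega> $$ (a, i) * cnj (Gu n \<omega> $$ (b, j))) +
       (\<Sum>a<m n. \<Sum>b<m n. kvv n (entries (X n \<omega>)) a b * Gv n \<omega> $$ (a, i) * cnj (Gv n \<omega> $$ (b, j))))" for n
      unfolding A_def
      by (subst sum_block_kernel[OF ij, where F = "\<lambda>z p q. z * g n \<omega> p * cnj (g n \<omega> q)"]) (simp_all add: pair_entry_def)
    moreover have "(\<Sum>p\<in>I n. A n (entries (X n \<omega>)) p p) =
        (if i = j then (\<Sum>a<n. kuu n (entries (X n \<omega>)) a a) + (\<Sum>a<m n. kvv n (entries (X n \<omega>)) a a) else 0)" for n
      unfolding A_def by (rule trace_block_kernel[OF ij])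
    ultimately show ?case by (simp add: form_def)
  qed
qed

lemma of_point_measurable: "(\<lambda>\<xi>. of_point n \<xi> j k) \<in> borel_measurable (PiM (J n) (\<lambda>_. borel))"
  unfolding of_point_def by (cases "j < n \<and> k < m n") (auto intro!: measurable_component_singleton)

lemma ip_gram_pow_measurable:
  assumes "\<And>j. (\<lambda>\<xi>. x \<xi> j) \<in> borel_measurable (PiM (J n) (\<lambda>_. borel))"
    "\<And>j. (\<lambda>\<xi>. y \<xi> j) \<in> borel_measurable (PiM (J n) (\<lambda>_. borel))"
  shows "(\<lambda>\<xi>. ip n' ((gram (of_point n \<xi>) n' m' ^^ k) (x \<xi>)) (y \<xi>) / z) \<in> borel_measurable (PiM (J n) (\<lambda>_. borel))"
  by (intro borel_measurable_divide borel_measurable_const ip_measurable gram_pow_measurable of_point_measurable assms)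

end

lemma (in spectral_limit) eventually_power_sum_le:
  "\<forall>\<^sub>F n in sequentially. (\<Sum>i<n. \<sigma> n i ^ q) \<le> real n * (b + 1) ^ q"
  using eventually_largest_le[of "b + 1", simplified]
proof eventually_elim
  case (elim n)
  then have "(\<Sum>i<n. \<sigma> n i ^ q) \<le> (\<Sum>i<n. (b + 1) ^ q)"
    using singular_value_nonneg[OF Y] by (intro sum_mono power_mono) auto
  then show ?case by simp
qed

text \<open>The \<open>+ 1\<close> gives the strict inequality that the moment bound demands, also
  when \<open>R = 0\<close>.\<close>

lemma scaled_le:
  assumes n: "0 < n" and S: "S \<le> real n * R" and d: "real n * real n \<le> d" and R: "0 \<le> R"
  shows "S / d < (R + 1) / real n"
proof -
  have "S / d \<le> real n * R / (real n * real n)"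
    using assms by (intro frac_le mult_nonneg_nonneg mult_pos_pos) auto
  also have "\<dots> = R / real n" using n by simp
  also have "\<dots> < (R + 1) / real n" using n by (intro divide_strict_right_mono) auto
  finally show ?thesis .
qed

locale random_setting_limit = random_setting M \<nu> K m r X Gu Gv
  for M :: "'w measure" and \<nu> K m r X Gu Gv +
  fixes \<mu> :: "real measure" and b c :: real
  assumes spectral: "AE \<omega> in M. spectral_limit m (\<lambda>n. X n \<omega>) \<mu> b"
    and c: "(\<lambda>n. real n / real (m n)) \<longlonglongrightarrow> c"
begin

abbreviation Z :: "nat \<Rightarrow> 'w \<Rightarrow> nat \<Rightarrow> nat \<Rightarrow> complex" where "Z n \<omega> \<equiv> entries (X n \<omega>)"
abbreviation S :: "nat \<Rightarrow> 'w \<Rightarrow> (nat \<Rightarrow> complex) \<Rightarrow> nat \<Rightarrow> complex" where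
  "S n \<omega> \<equiv> gram (Z n \<omega>) n (m n)"
abbreviation ug :: "nat \<Rightarrow> 'w \<Rightarrow> nat \<Rightarrow> nat \<Rightarrow> complex" where "ug n \<omega> \<equiv> scaled_column n (Gu n \<omega>)"
abbreviation vg :: "nat \<Rightarrow> 'w \<Rightarrow> nat \<Rightarrow> nat \<Rightarrow> complex" where "vg n \<omega> \<equiv> scaled_column (m n) (Gv n \<omega>)"

lemma spectral_system:
  assumes "spectral_limit m (\<lambda>n. X n \<omega>) \<mu> b"
  shows "\<exists>e. singular_system n (m n) (Z n \<omega>) e (\<lambda>i. singular_value (X n \<omega>) (Suc i))"
  using singular_system_exists[OF spectral_limit.Y[OF assms]] by blast

text \<open>\<open>d\<close> is the squared normalization of the two vectors involved, namely n^2, m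
  n or m^2, and is at least n^2 because n <= m. The power sum of the singular values is eventually
  at most n (b + 1)^q, so the quotient is O(1/n).\<close>

lemma AE_frobenius_bound:
  assumes d: "\<And>n. real n * real n \<le> d n"
    and frob: "\<And>\<omega> n e. singular_system n (m n) (Z n \<omega>) e (\<lambda>i. singular_value (X n \<omega>) (Suc i)) \<Longrightarrow>
      frob n \<omega> = (\<Sum>i<n. singular_value (X n \<omega>) (Suc i) ^ q) / d n"
  shows "AE \<omega> in M. \<exists>B. \<forall>\<^sub>F n in sequentially. frob n \<omega> < B / real n"
  using spectral
proof eventually_elim
  case (elim \<omega>)
  interpret L: spectral_limit m "\<lambda>n. X n \<omega>" \<mu> b by (rule elim)
  have "\<forall>\<^sub>F n in sequentially. frob n \<omega> < ((b + 1) ^ q + 1) / real n"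
    using L.eventually_power_sum_le[of q] eventually_gt_at_top[of 0]
  proof eventually_elim
    case (elim n)
    obtain e where "singular_system n (m n) (Z n \<omega>) e (\<lambda>i. singular_value (X n \<omega>) (Suc i))"
      using spectral_system[OF L.spectral_limit_axioms] by blast
    from frob[OF this] show ?case
      using elim L.b_nonneg d[of n] by (simp only:) (intro scaled_le, auto)
  qed
  then show ?case by blast
qed

lemma uu_limit:
  assumes ij: "i < r" "j < r"
  shows "AE \<omega> in M. (\<lambda>n. ip n ((S n \<omega> ^^ k) (ug n \<omega> i)) (ug n \<omega> j)) \<longlonglongrightarrow>
    (if i = j then complex_of_real (\<integral>t. t ^ (2 * k) \<partial>\<mu>) else 0)"
proof -
  define kuu where "kuu = (\<lambda>n Z a b. ip n ((gram Z n (m n) ^^ k) (unitv a)) (unitv b) / complex_of_real (real n))"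
  have "AE \<omega> in M. (\<lambda>n.
      (\<Sum>a<n. \<Sum>b<n. kuu n (Z n \<omega>) a b * Gu n \<omega> $$ (a, i) * cnj (Gu n \<omega> $$ (b, j))) +
      ((\<Sum>a<m n. \<Sum>b<n. 0 * Gv n \<omega> $$ (a, i) * cnj (Gu n \<omega> $$ (b, j))) +
       (\<Sum>a<m n. \<Sum>b<m n. 0 * Gv n \<omega> $$ (a, i) * cnj (Gv n \<omega> $$ (b, j)))))
    \<longlonglongrightarrow> (if i = j then complex_of_real (\<integral>t. t ^ (2 * k) \<partial>\<mu>) else 0)"
  proof (rule block_forms_tendsto[OF ij])
    show "(\<lambda>\<xi>. kuu n (of_point n \<xi>) a b) \<in> borel_measurable (PiM (J n) (\<lambda>_. borel))" for n a b
      unfolding kuu_def by (intro ip_gram_pow_measurable borel_measurable_const)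
    show "AE \<omega> in M. \<exists>B. \<forall>\<^sub>F n in sequentially.
        (\<Sum>a<n. \<Sum>b<n. (cmod (kuu n (Z n \<omega>) a b))\<^sup>2) +
        ((\<Sum>a<m n. \<Sum>b<n. (cmod 0)\<^sup>2) + (\<Sum>a<m n. \<Sum>b<m n. (cmod 0)\<^sup>2)) < B / real n"
    proof (rule AE_frobenius_bound[where d = "\<lambda>n. real n * real n" and q = "4 * k"])
      fix \<omega> n e
      assume "singular_system n (m n) (Z n \<omega>) e (\<lambda>i. singular_value (X n \<omega>) (Suc i))"
      then interpret E: singular_system n "m n" "Z n \<omega>" e "\<lambda>i. singular_value (X n \<omega>) (Suc i)" .
      show "(\<Sum>a<n. \<Sum>b<n. (cmod (kuu n (Z n \<omega>) a b))\<^sup>2) +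
        ((\<Sum>a<m n. \<Sum>b<n. (cmod 0)\<^sup>2) + (\<Sum>a<m n. \<Sum>b<m n. (cmod 0)\<^sup>2)) = (\<Sum>i<n. singular_value (X n \<omega>) (Suc i) ^ (4 * k)) / (real n * real n)"
        unfolding E.frobenius_uu[symmetric] kuu_def
        by (simp add: norm_divide norm_mult power_divide power_mult_distrib power2_eq_square[of "real _"] sum_divide_distrib)
    qed (use m in \<open>auto intro!: mult_mono\<close>)
    show "AE \<omega> in M. (\<lambda>n. (\<Sum>a<n. kuu n (Z n \<omega>) a a) + (\<Sum>a<m n. 0)) \<longlonglongrightarrow> complex_of_real (\<integral>t. t ^ (2 * k) \<partial>\<mu>)"
      using spectral
    proof eventually_elim
      case (elim \<omega>)
      interpret L: spectral_limit m "\<lambda>n. X n \<omega>" \<mu> b by (rule elim)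
      have "(\<Sum>a<n. kuu n (Z n \<omega>) a a) = complex_of_real ((\<Sum>i<n. singular_value (X n \<omega>) (Suc i) ^ (2 * k)) / real n)" for n
      proof -
        obtain e where "singular_system n (m n) (Z n \<omega>) e (\<lambda>i. singular_value (X n \<omega>) (Suc i))"
          using spectral_system[OF L.spectral_limit_axioms] by blast
        then interpret E: singular_system n "m n" "Z n \<omega>" e "\<lambda>i. singular_value (X n \<omega>) (Suc i)" .
        show ?thesis unfolding kuu_def sum_divide_distrib[symmetric] E.trace_gram_pow by simp
      qed
      then show ?case
        using tendsto_of_real[OF L.moment_limit[of k], where 'a = complex] by (simp add: L.mom_def)
    qed
  qed simp_all
  moreover have "(\<Sum>a<n. \<Sum>b<n. kuu n (Z n \<omega>) a b * Gu n \<omega> $$ (a, i) * cnj (Gu n \<omega> $$ (b, j))) =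
      ip n ((S n \<omega> ^^ k) (ug n \<omega> i)) (ug n \<omega> j)" for n \<omega>
  proof -
    have sq: "complex_of_real (sqrt (real n)) * complex_of_real (sqrt (real n)) = of_nat n"
      by (simp add: of_real_mult[symmetric] del: of_real_mult)
    show ?thesis
      unfolding scaled_column_lc gram_pow_lc ip_lc_left
      by (simp add: ip_lc_right kuu_def sum_distrib_left mult_ac sq)
  qed
  ultimately show ?thesis by simp
qed

text \<open>The trace runs over \<open>m n\<close> unit vectors but only n singular values
  contribute, so normalizing by \<open>m n\<close> produces the factor \<open>c\<close>.\<close>

lemma vv_limit:
  assumes ij: "i < r" "j < r"
  shows "AE \<omega> in M. (\<lambda>n. ip n ((S n \<omega> ^^ k) (mulv (Z n \<omega>) (m n) (vg n \<omega> i))) (mulv (Z n \<omega>) (m n) (vg n \<omega> j))) \<longlonglongrightarrow>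
    (if i = j then complex_of_real (c * (\<integral>t. t ^ (2 * Suc k) \<partial>\<mu>)) else 0)"
proof -
  define kvv where "kvv = (\<lambda>n Z a b. ip n ((gram Z n (m n) ^^ k) (mulv Z (m n) (unitv a))) (mulv Z (m n) (unitv b)) /
      complex_of_real (real (m n)))"
  have "AE \<omega> in M. (\<lambda>n.
      (\<Sum>a<n. \<Sum>b<n. 0 * Gu n \<omega> $$ (a, i) * cnj (Gu n \<omega> $$ (b, j))) +
      ((\<Sum>a<m n. \<Sum>b<n. 0 * Gv n \<omega> $$ (a, i) * cnj (Gu n \<omega> $$ (b, j))) +
       (\<Sum>a<m n. \<Sum>b<m n. kvv n (Z n \<omega>) a b * Gv n \<omega> $$ (a, i) * cnj (Gv n \<omega> $$ (b, j)))))
    \<longlonglongrightarrow> (if i = j then complex_of_real (c * (\<integral>t. t ^ (2 * Suc k) \<partial>\<mu>)) else 0)"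
  proof (rule block_forms_tendsto[OF ij])
    show "(\<lambda>\<xi>. kvv n (of_point n \<xi>) a b) \<in> borel_measurable (PiM (J n) (\<lambda>_. borel))" for n a b
      unfolding kvv_def by (intro ip_gram_pow_measurable mulv_measurable of_point_measurable borel_measurable_const)
    show "AE \<omega> in M. \<exists>B. \<forall>\<^sub>F n in sequentially.
        (\<Sum>a<n. \<Sum>b<n. (cmod 0)\<^sup>2) +
        ((\<Sum>a<m n. \<Sum>b<n. (cmod 0)\<^sup>2) + (\<Sum>a<m n. \<Sum>b<m n. (cmod (kvv n (Z n \<omega>) a b))\<^sup>2)) < B / real n"
    proof (rule AE_frobenius_bound[where d = "\<lambda>n. real (m n) * real (m n)" and q = "4 * k + 4"])
      fix \<omega> n e
      assume "singular_system n (m n) (Z n \<omega>) e (\<lambda>i. singular_value (X n \<omega>) (Suc i))"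
      then interpret E: singular_system n "m n" "Z n \<omega>" e "\<lambda>i. singular_value (X n \<omega>) (Suc i)" .
      show "(\<Sum>a<n. \<Sum>b<n. (cmod 0)\<^sup>2) +
        ((\<Sum>a<m n. \<Sum>b<n. (cmod 0)\<^sup>2) + (\<Sum>a<m n. \<Sum>b<m n. (cmod (kvv n (Z n \<omega>) a b))\<^sup>2)) = (\<Sum>i<n. singular_value (X n \<omega>) (Suc i) ^ (4 * k + 4)) / (real (m n) * real (m n))"
        unfolding E.frobenius_vv[symmetric] kvv_def
        by (simp add: norm_divide norm_mult power_divide power_mult_distrib power2_eq_square[of "real _"] sum_divide_distrib)
    qed (use m in \<open>auto intro!: mult_mono\<close>)
    show "AE \<omega> in M. (\<lambda>n. (\<Sum>a<n. 0) + (\<Sum>a<m n. kvv n (Z n \<omega>) a a)) \<longlonglongrightarrow> complex_of_real (c * (\<integral>t. t ^ (2 * Suc k) \<partial>\<mu>))"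
      using spectral
    proof eventually_elim
      case (elim \<omega>)
      interpret L: spectral_limit m "\<lambda>n. X n \<omega>" \<mu> b by (rule elim)
      have "(\<Sum>a<m n. kvv n (Z n \<omega>) a a) =
          complex_of_real ((\<Sum>i<n. singular_value (X n \<omega>) (Suc i) ^ (2 * Suc k)) / real (m n))" for n
      proof -
        obtain e where "singular_system n (m n) (Z n \<omega>) e (\<lambda>i. singular_value (X n \<omega>) (Suc i))"
          using spectral_system[OF L.spectral_limit_axioms] by blast
        then interpret E: singular_system n "m n" "Z n \<omega>" e "\<lambda>i. singular_value (X n \<omega>) (Suc i)" .
        show ?thesis unfolding kvv_def sum_divide_distrib[symmetric] E.trace_mulv by simp
      qed
      then show ?case
        using tendsto_of_real[OF L.scaled_moment_limit[OF c, of "Suc k"], where 'a = complex] by (simp add: L.mom_def)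
    qed
  qed simp_all
  moreover have "(\<Sum>a<m n. \<Sum>b<m n. kvv n (Z n \<omega>) a b * Gv n \<omega> $$ (a, i) * cnj (Gv n \<omega> $$ (b, j))) =
      ip n ((S n \<omega> ^^ k) (mulv (Z n \<omega>) (m n) (vg n \<omega> i))) (mulv (Z n \<omega>) (m n) (vg n \<omega> j))" for n \<omega>
  proof -
    have sq: "complex_of_real (sqrt (real (m n))) * complex_of_real (sqrt (real (m n))) = of_nat (m n)"
      by (simp add: of_real_mult[symmetric] del: of_real_mult)
    show ?thesis
      unfolding mulv_scaled_column gram_pow_lc ip_lc_left
      by (simp add: ip_lc_right kvv_def sum_distrib_left mult_ac sq)
  qed
  ultimately show ?thesis by simp
qed

lemma vu_limit:
  assumes ij: "i < r" "j < r"
  shows "AE \<omega> in M. (\<lambda>n. ip n ((S n \<omega> ^^ k) (mulv (Z n \<omega>) (m n) (vg n \<omega> i))) (ug n \<omega> j)) \<longlonglongrightarrow> 0"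
proof -
  define kvu where "kvu = (\<lambda>n Z a b. ip n ((gram Z n (m n) ^^ k) (mulv Z (m n) (unitv a))) (unitv b) /
      complex_of_real (sqrt (real (m n)) * sqrt (real n)))"
  have "AE \<omega> in M. (\<lambda>n.
      (\<Sum>a<n. \<Sum>b<n. 0 * Gu n \<omega> $$ (a, i) * cnj (Gu n \<omega> $$ (b, j))) +
      ((\<Sum>a<m n. \<Sum>b<n. kvu n (Z n \<omega>) a b * Gv n \<omega> $$ (a, i) * cnj (Gu n \<omega> $$ (b, j))) +
       (\<Sum>a<m n. \<Sum>b<m n. 0 * Gv n \<omega> $$ (a, i) * cnj (Gv n \<omega> $$ (b, j)))))
    \<longlonglongrightarrow> (if i = j then 0 else 0)"
  proof (rule block_forms_tendsto[OF ij])
    show "(\<lambda>\<xi>. kvu n (of_point n \<xi>) a b) \<in> borel_measurable (PiM (J n) (\<lambda>_. borel))" for n a b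
      unfolding kvu_def by (intro ip_gram_pow_measurable mulv_measurable of_point_measurable borel_measurable_const)
    show "AE \<omega> in M. \<exists>B. \<forall>\<^sub>F n in sequentially.
        (\<Sum>a<n. \<Sum>b<n. (cmod 0)\<^sup>2) +
        ((\<Sum>a<m n. \<Sum>b<n. (cmod (kvu n (Z n \<omega>) a b))\<^sup>2) + (\<Sum>a<m n. \<Sum>b<m n. (cmod 0)\<^sup>2)) < B / real n"
    proof (rule AE_frobenius_bound[where d = "\<lambda>n. real (m n) * real n" and q = "4 * k + 2"])
      fix \<omega> n e
      assume "singular_system n (m n) (Z n \<omega>) e (\<lambda>i. singular_value (X n \<omega>) (Suc i))"
      then interpret E: singular_system n "m n" "Z n \<omega>" e "\<lambda>i. singular_value (X n \<omega>) (Suc i)" .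
      show "(\<Sum>a<n. \<Sum>b<n. (cmod 0)\<^sup>2) +
        ((\<Sum>a<m n. \<Sum>b<n. (cmod (kvu n (Z n \<omega>) a b))\<^sup>2) + (\<Sum>a<m n. \<Sum>b<m n. (cmod 0)\<^sup>2)) = (\<Sum>i<n. singular_value (X n \<omega>) (Suc i) ^ (4 * k + 2)) / (real (m n) * real n)"
        unfolding E.frobenius_vu[symmetric] kvu_def
        by (simp add: norm_divide norm_mult power_divide power_mult_distrib power2_eq_square[of "real _"] sum_divide_distrib)
    qed (use m in \<open>auto intro!: mult_mono\<close>)
  qed simp_all
  moreover have "(\<Sum>a<m n. \<Sum>b<n. kvu n (Z n \<omega>) a b * Gv n \<omega> $$ (a, i) * cnj (Gu n \<omega> $$ (b, j))) =
      ip n ((S n \<omega> ^^ k) (mulv (Z n \<omega>) (m n) (vg n \<omega> i))) (ug n \<omega> j)" for n \<omega>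
    unfolding mulv_scaled_column gram_pow_lc ip_lc_left scaled_column_lc[of n]
    by (simp add: ip_lc_right kvu_def sum_distrib_left mult_ac)
  ultimately show ?thesis by simp
qed

text \<open>A law of large numbers: the kernel is the identity divided by m, with trace 1 and
  squared Frobenius norm 1/m <= 1/n, and does not involve the random matrix.\<close>

lemma v_orthonormal_limit:
  assumes ij: "i < r" "j < r"
  shows "AE \<omega> in M. (\<lambda>n. ip (m n) (vg n \<omega> i) (vg n \<omega> j)) \<longlonglongrightarrow> (if i = j then 1 else 0)"
proof -
  define kvv where "kvv = (\<lambda>n (Z :: nat \<Rightarrow> nat \<Rightarrow> complex) (a :: nat) b. if a = b then 1 / complex_of_real (real (m n)) else 0)"
  have "AE \<omega> in M. (\<lambda>n.
      (\<Sum>a<n. \<Sum>b<n. 0 * Gu n \<omega> $$ (a, i) * cnj (Gu n \<omega> $$ (b, j))) +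
      ((\<Sum>a<m n. \<Sum>b<n. 0 * Gv n \<omega> $$ (a, i) * cnj (Gu n \<omega> $$ (b, j))) +
       (\<Sum>a<m n. \<Sum>b<m n. kvv n (Z n \<omega>) a b * Gv n \<omega> $$ (a, i) * cnj (Gv n \<omega> $$ (b, j)))))
    \<longlonglongrightarrow> (if i = j then 1 else 0)"
  proof (rule block_forms_tendsto[OF ij])
    have tr: "(\<Sum>a<m n. kvv n Y a a) = 1" if "0 < n" for n Y
      using that m[of n] by (simp add: kvv_def)
    have fr: "(\<Sum>a<m n. \<Sum>b<m n. (cmod (kvv n Y a b))\<^sup>2) < 2 / real n" if n: "0 < n" for n Y
    proof -
      have "(\<Sum>a<m n. \<Sum>b<m n. (cmod (kvv n Y a b))\<^sup>2) = (\<Sum>a<m n. (1 / real (m n))\<^sup>2)"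
      proof (intro sum.cong refl)
        fix a assume "a \<in> {..<m n}"
        moreover have "(cmod (kvv n Y a b))\<^sup>2 = (if a = b then (1 / real (m n))\<^sup>2 else 0)" for b
          by (simp add: kvv_def norm_divide)
        ultimately show "(\<Sum>b<m n. (cmod (kvv n Y a b))\<^sup>2) = (1 / real (m n))\<^sup>2" by simp
      qed
      also have "\<dots> = 1 / real (m n)" by (simp add: power2_eq_square)
      also have "\<dots> \<le> 1 / real n" using n m[of n] by (intro divide_left_mono) auto
      also have "\<dots> < 2 / real n" using n by (intro divide_strict_right_mono) auto
      finally show ?thesis .
    qed
    show "AE \<omega> in M. \<exists>B. \<forall>\<^sub>F n in sequentially.
        (\<Sum>a<n. \<Sum>b<n. (cmod 0)\<^sup>2) +
        ((\<Sum>a<m n. \<Sum>b<n. (cmod 0)\<^sup>2) + (\<Sum>a<m n. \<Sum>b<m n. (cmod (kvv n (Z n \<omega>) a b))\<^sup>2)) < B / real n"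
      using fr by (intro AE_I2 exI[of _ 2] eventually_mono[OF eventually_gt_at_top[of 0]]) simp
    show "AE \<omega> in M. (\<lambda>n. (\<Sum>a<n. 0) + (\<Sum>a<m n. kvv n (Z n \<omega>) a a)) \<longlonglongrightarrow> 1"
      using tr by (intro AE_I2 tendsto_eventually eventually_mono[OF eventually_gt_at_top[of 0]]) simp
    show "(\<lambda>\<xi>. kvv n (of_point n \<xi>) a b) \<in> borel_measurable (PiM (J n) (\<lambda>_. borel))" for n a b
      by (simp add: kvv_def)
  qed simp_all
  moreover have "(\<Sum>a<m n. \<Sum>b<m n. kvv n (Z n \<omega>) a b * Gv n \<omega> $$ (a, i) * cnj (Gv n \<omega> $$ (b, j))) =
      ip (m n) (vg n \<omega> i) (vg n \<omega> j)" for n \<omega>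
  proof -
    have sq: "complex_of_real (sqrt (real (m n))) * complex_of_real (sqrt (real (m n))) = of_nat (m n)"
      by (simp add: of_real_mult[symmetric] del: of_real_mult)
    have "(\<Sum>b<m n. kvv n (Z n \<omega>) a b * Gv n \<omega> $$ (a, i) * cnj (Gv n \<omega> $$ (b, j))) =
        vg n \<omega> i a * cnj (vg n \<omega> j a)" if "a < m n" for a
      using that by (simp add: kvv_def scaled_column_def if_distrib if_distribR sq cong: if_cong)
    then show ?thesis by (simp add: ip_def)
  qed
  ultimately show ?thesis by simp
qed

end

section \<open>Gram-Schmidt orthonormalization\<close>

text \<open>Covers both models. The coefficient matrix is the identity in the i.i.d. model, and
  tends to it under Gram-Schmidt because the Gram matrix of the scaled columns does; limits of
  sesquilinear forms do not see the difference.\<close>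

definition asymptotic_combination ::
  "nat \<Rightarrow> (nat \<Rightarrow> nat \<Rightarrow> nat \<Rightarrow> complex) \<Rightarrow> (nat \<Rightarrow> nat \<Rightarrow> nat \<Rightarrow> complex) \<Rightarrow> bool" where
  "asymptotic_combination r w y \<longleftrightarrow> (\<exists>T. (\<forall>i<r. \<forall>l<r. (\<lambda>n. T i l n) \<longlonglongrightarrow> (if i = l then 1 else 0)) \<and>
     (\<forall>\<^sub>F n in sequentially. \<forall>i<r. y n i = lc r (\<lambda>l. T i l n) (w n)))"

lemma lc_delta: "i < r \<Longrightarrow> lc r (\<lambda>l. if i = l then 1 else 0) w = w i"
  by (simp add: lc_def if_distrib[of "\<lambda>x. x * _"] cong: if_cong)

lemma asymptotic_combination_refl:
  assumes "\<forall>\<^sub>F n in sequentially. \<forall>i<r. y n i = w n i"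
  shows "asymptotic_combination r w y"
  unfolding asymptotic_combination_def
  by (rule exI[of _ "\<lambda>i l n. if i = l then 1 else 0"])
    (use assms in \<open>auto simp: lc_delta elim!: eventually_mono\<close>)

lemma asymptotic_combination_limit:
  fixes B :: "nat \<Rightarrow> (nat \<Rightarrow> complex) \<Rightarrow> (nat \<Rightarrow> complex) \<Rightarrow> complex"
  assumes y: "asymptotic_combination r w y" and y': "asymptotic_combination r w' y'"
    and left: "\<And>n c x z. B n (lc r c x) z = (\<Sum>l<r. c l * B n (x l) z)"
    and right: "\<And>n c x z. B n z (lc r c x) = (\<Sum>l<r. cnj (c l) * B n z (x l))"
    and lim: "\<And>i j. i < r \<Longrightarrow> j < r \<Longrightarrow> (\<lambda>n. B n (w n i) (w' n j)) \<longlonglongrightarrow> \<beta> i j"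
    and ij: "i < r" "j < r"
  shows "(\<lambda>n. B n (y n i) (y' n j)) \<longlonglongrightarrow> \<beta> i j"
proof -
  obtain T where T: "\<And>i l. i < r \<Longrightarrow> l < r \<Longrightarrow> (\<lambda>n. T i l n) \<longlonglongrightarrow> (if i = l then 1 else 0)"
      "\<forall>\<^sub>F n in sequentially. \<forall>i<r. y n i = lc r (\<lambda>l. T i l n) (w n)"
    using y unfolding asymptotic_combination_def by blast
  obtain T' where T': "\<And>i l. i < r \<Longrightarrow> l < r \<Longrightarrow> (\<lambda>n. T' i l n) \<longlonglongrightarrow> (if i = l then 1 else 0)"
      "\<forall>\<^sub>F n in sequentially. \<forall>i<r. y' n i = lc r (\<lambda>l. T' i l n) (w' n)"
    using y' unfolding asymptotic_combination_def by blast
  have "(\<lambda>n. \<Sum>l<r. T i l n * (\<Sum>h<r. cnj (T' j h n) * B n (w n l) (w' n h))) \<longlonglongrightarrow>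
      (\<Sum>l<r. (if i = l then 1 else 0) * (\<Sum>h<r. cnj (if j = h then 1 else 0) * \<beta> l h))"
    by (intro tendsto_intros T(1) T'(1) lim ij) auto
  moreover have "(\<Sum>l<r. (if i = l then 1 else 0) * (\<Sum>h<r. cnj (if j = h then 1 else 0) * \<beta> l h)) = \<beta> i j"
    using ij by (simp add: if_distrib[of "\<lambda>x. x * _"] if_distrib[of cnj] cong: if_cong)
  ultimately have "(\<lambda>n. \<Sum>l<r. T i l n * (\<Sum>h<r. cnj (T' j h n) * B n (w n l) (w' n h))) \<longlonglongrightarrow> \<beta> i j"
    by simp
  moreover have "\<forall>\<^sub>F n in sequentially. (\<Sum>l<r. T i l n * (\<Sum>h<r. cnj (T' j h n) * B n (w n l) (w' n h))) =
      B n (y n i) (y' n j)"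
    using T(2) T'(2)
  proof eventually_elim
    case (elim n)
    then have eq: "y n i = lc r (\<lambda>l. T i l n) (w n)" "y' n j = lc r (\<lambda>h. T' j h n) (w' n)"
      using ij by auto
    have "B n (lc r c x) (lc r d z) = (\<Sum>l<r. c l * (\<Sum>h<r. cnj (d h) * B n (x l) (z h)))" for c d x z
      by (subst left) (simp only: right)
    then show ?case unfolding eq by simp
  qed
  ultimately show ?thesis by (rule Lim_transform_eventually)
qed

text \<open>Confines the recursive calls under the sum below to indices smaller than
  \<open>k\<close>, which gives termination.\<close>

declare sum.cong [fundef_cong]

text \<open>A vanishing denominator contributes 0, as in the library function \<open>gram_schmidt\<close>.\<close>

fun orthogonalize :: "nat \<Rightarrow> (nat \<Rightarrow> nat \<Rightarrow> complex) \<Rightarrow> nat \<Rightarrow> nat \<Rightarrow> complex" where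
  "orthogonalize N w k = (\<lambda>a. w k a - (\<Sum>l<k. ip N (w k) (orthogonalize N w l) /
     ip N (orthogonalize N w l) (orthogonalize N w l) * orthogonalize N w l a))"

declare orthogonalize.simps [simp del]

definition orthonormalize :: "nat \<Rightarrow> (nat \<Rightarrow> nat \<Rightarrow> complex) \<Rightarrow> nat \<Rightarrow> nat \<Rightarrow> complex" where
  "orthonormalize N w k = (\<lambda>a. orthogonalize N w k a / complex_of_real (sqrt (nsq N (orthogonalize N w k))))"

text \<open>Inductively the earlier vectors are asymptotically equal to the earlier columns. Their
  inner products with column \<open>k\<close> tend to 0 and their squared norms to 1, so the
  correction coefficients \<rho> tend to 0.\<close>

lemma orthogonalize_combination:
  assumes gram: "\<And>i j. i < r \<Longrightarrow> j < r \<Longrightarrow> (\<lambda>n. ip (N n) (w n i) (w n j)) \<longlonglongrightarrow> (if i = j then 1 else 0)"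
    and k: "k < r"
  shows "\<exists>T. (\<forall>l<r. (\<lambda>n. T l n) \<longlonglongrightarrow> (if k = l then 1 else 0)) \<and>
    (\<forall>n. orthogonalize (N n) (w n) k = lc r (\<lambda>l. T l n) (w n))"
  using k
proof (induction k rule: less_induct)
  case (less k)
  define \<gamma> where "\<gamma> = (\<lambda>n. orthogonalize (N n) (w n))"
  have "\<forall>l. \<exists>T. l < k \<longrightarrow> (\<forall>h<r. (\<lambda>n. T h n) \<longlonglongrightarrow> (if l = h then 1 else 0)) \<and> (\<forall>n. \<gamma> n l = lc r (\<lambda>h. T h n) (w n))"
    unfolding \<gamma>_def using less by auto
  then obtain T where T: "\<And>l h. l < k \<Longrightarrow> h < r \<Longrightarrow> (\<lambda>n. T l h n) \<longlonglongrightarrow> (if l = h then 1 else 0)"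
      "\<And>l n. l < k \<Longrightarrow> \<gamma> n l = lc r (\<lambda>h. T l h n) (w n)"
    by metis
  define \<rho> where "\<rho> = (\<lambda>l n. ip (N n) (w n k) (\<gamma> n l) / ip (N n) (\<gamma> n l) (\<gamma> n l))"
  have \<rho>: "(\<lambda>n. \<rho> l n) \<longlonglongrightarrow> 0" if l: "l < k" for l
  proof -
    have lr: "l < r" using l less.prems by simp
    have ip_w: "(\<lambda>n. ip (N n) (w n i) (\<gamma> n l)) \<longlonglongrightarrow> (if i = l then 1 else 0)" if i: "i < r" for i
    proof -
      have "(\<lambda>n. \<Sum>h<r. cnj (T l h n) * ip (N n) (w n i) (w n h)) \<longlonglongrightarrow>
          (\<Sum>h<r. cnj (if l = h then 1 else 0) * (if i = h then 1 else 0))"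
        by (intro tendsto_intros T(1) gram i l) auto
      moreover have "(\<Sum>h<r. cnj (if l = h then 1 else 0) * (if i = h then 1 else 0)) = (if i = l then 1 else 0 :: complex)"
        using lr i by (auto simp: if_distrib[of "\<lambda>x. x * _"] if_distrib[of cnj] cong: if_cong)
      ultimately show ?thesis by (simp add: T(2)[OF l] ip_lc_right)
    qed
    have "(\<lambda>n. \<Sum>h<r. T l h n * ip (N n) (w n h) (\<gamma> n l)) \<longlonglongrightarrow>
        (\<Sum>h<r. (if l = h then 1 else 0) * (if h = l then 1 else 0))"
      by (intro tendsto_intros T(1) ip_w l) auto
    moreover have "(\<Sum>h<r. (if l = h then 1 else 0) * (if h = l then 1 else 0)) = (1::complex)"
      using lr by (auto simp: if_distrib[of "\<lambda>x. x * _"] cong: if_cong)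
    moreover have "ip (N n) (\<gamma> n l) (\<gamma> n l) = (\<Sum>h<r. T l h n * ip (N n) (w n h) (\<gamma> n l))" for n
      by (subst (1) T(2)[OF l]) (simp add: ip_lc_left)
    ultimately have "(\<lambda>n. ip (N n) (\<gamma> n l) (\<gamma> n l)) \<longlonglongrightarrow> 1" by simp
    from tendsto_divide[OF ip_w[OF less.prems] this] show ?thesis using l by (simp add: \<rho>_def)
  qed
  define T' where "T' = (\<lambda>h n. (if k = h then 1 else 0) - (\<Sum>l<k. \<rho> l n * T l h n))"
  have "(\<lambda>n. T' h n) \<longlonglongrightarrow> (if k = h then 1 else 0) - (\<Sum>l<k. 0 * (if l = h then 1 else 0))" if "h < r" for h
    unfolding T'_def by (intro tendsto_intros \<rho> T(1) that) auto
  moreover have "\<gamma> n k = lc r (\<lambda>h. T' h n) (w n)" for n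
  proof
    fix a
    have "\<gamma> n k a = w n k a - (\<Sum>l<k. \<rho> l n * lc r (\<lambda>h. T l h n) (w n) a)"
    proof -
      have "orthogonalize (N n) (w n) l = \<gamma> n l" for l by (simp add: \<gamma>_def)
      then show ?thesis
        by (subst (1) \<gamma>_def, subst orthogonalize.simps) (simp add: \<rho>_def T(2)[symmetric])
    qed
    also have "(\<Sum>l<k. \<rho> l n * lc r (\<lambda>h. T l h n) (w n) a) = (\<Sum>h<r. (\<Sum>l<k. \<rho> l n * T l h n) * w n h a)"
      unfolding lc_def sum_distrib_left sum_distrib_right by (subst sum.swap) (simp add: mult_ac)
    also have "w n k a = (\<Sum>h<r. (if k = h then 1 else 0) * w n h a)"
      using less.prems by (simp add: if_distrib[of "\<lambda>x. x * _"] cong: if_cong)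
    finally show "\<gamma> n k a = lc r (\<lambda>h. T' h n) (w n) a"
      by (simp add: lc_def T'_def left_diff_distrib sum_subtractf)
  qed
  ultimately show ?case unfolding \<gamma>_def by (intro exI[of _ T']) auto
qed

lemma orthonormalize_combination:
  assumes gram: "\<And>i j. i < r \<Longrightarrow> j < r \<Longrightarrow> (\<lambda>n. ip (N n) (w n i) (w n j)) \<longlonglongrightarrow> (if i = j then 1 else 0)"
    and y: "\<forall>\<^sub>F n in sequentially. \<forall>k<r. y n k = orthonormalize (N n) (w n) k"
  shows "asymptotic_combination r w y"
proof -
  have "\<forall>k. \<exists>T. k < r \<longrightarrow> (\<forall>l<r. (\<lambda>n. T l n) \<longlonglongrightarrow> (if k = l then 1 else 0)) \<and>
      (\<forall>n. orthogonalize (N n) (w n) k = lc r (\<lambda>l. T l n) (w n))"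
    using orthogonalize_combination[of r N w] gram by blast
  then obtain T where T: "\<And>k l. k < r \<Longrightarrow> l < r \<Longrightarrow> (\<lambda>n. T k l n) \<longlonglongrightarrow> (if k = l then 1 else 0)"
      "\<And>k n. k < r \<Longrightarrow> orthogonalize (N n) (w n) k = lc r (\<lambda>l. T k l n) (w n)"
    by metis
  define z where "z = (\<lambda>n. orthogonalize (N n) (w n))"
  have comb: "asymptotic_combination r w z"
    unfolding asymptotic_combination_def z_def using T by (intro exI[of _ T]) auto
  have nz: "(\<lambda>n. ip (N n) (z n k) (z n k)) \<longlonglongrightarrow> 1" if "k < r" for k
    using asymptotic_combination_limit[OF comb comb, of "\<lambda>n. ip (N n)" "\<lambda>i j. if i = j then 1 else 0" k k] gram that
    by (simp add: ip_lc_left ip_lc_right)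
  have norm: "(\<lambda>n. complex_of_real (sqrt (nsq (N n) (z n k)))) \<longlonglongrightarrow> 1" if k: "k < r" for k
  proof -
    have "(\<lambda>n. nsq (N n) (z n k)) \<longlonglongrightarrow> 1"
      using tendsto_Re[OF nz[OF k]] by (simp add: ip_self)
    then have "(\<lambda>n. complex_of_real (sqrt (nsq (N n) (z n k)))) \<longlonglongrightarrow> complex_of_real (sqrt 1)"
      by (intro tendsto_of_real tendsto_real_sqrt)
    then show ?thesis by simp
  qed
  define T' where "T' = (\<lambda>k l n. T k l n / complex_of_real (sqrt (nsq (N n) (z n k))))"
  have "(\<lambda>n. T' k l n) \<longlonglongrightarrow> (if k = l then 1 else 0) / 1" if "k < r" "l < r" for k l
    unfolding T'_def by (intro tendsto_divide T(1) norm that) auto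
  moreover have "orthonormalize (N n) (w n) k = lc r (\<lambda>l. T' k l n) (w n)" if "k < r" for n k
    unfolding orthonormalize_def T'_def z_def T(2)[OF that]
    by (simp add: lc_def sum_divide_distrib)
  ultimately show ?thesis
    unfolding asymptotic_combination_def using y by (intro exI[of _ T']) (auto elim!: eventually_mono)
qed

section \<open>Comparison with the Gram-Schmidt process on matrices\<close>

lemma gram_schmidt_sub_append:
  "gram_schmidt_sub n us (xs @ [x]) =
    (adjuster n x (gram_schmidt_sub n us xs) + x) # gram_schmidt_sub n us xs"
  by (induction xs arbitrary: us) auto

lemma length_gram_schmidt_sub: "length (gram_schmidt_sub n us xs) = length us + length xs"
  by (induction xs arbitrary: us) auto

lemma gram_schmidt_snoc:
  "gram_schmidt n (xs @ [x]) = gram_schmidt n xs @ [adjuster n x (rev (gram_schmidt n xs)) + x]"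
  by (simp add: gram_schmidt_def gram_schmidt_sub_append)

text \<open>Removes the accumulator, which holds the results in reverse order, and leaves a
  recursion on the earlier results as in \<open>orthogonalize\<close>.\<close>

lemma gram_schmidt_nth:
  assumes "k < length ws"
  shows "gram_schmidt n ws ! k =
    adjuster n (ws ! k) (rev (map (\<lambda>l. gram_schmidt n ws ! l) [0..<k])) + ws ! k"
  using assms
proof (induction ws rule: rev_induct)
  case (snoc x xs)
  have len: "length (gram_schmidt n xs) = length xs"
    by (simp add: gram_schmidt_def length_gram_schmidt_sub)
  have pre: "gram_schmidt n (xs @ [x]) ! l = gram_schmidt n xs ! l" if "l < length xs" for l
    using that by (simp add: gram_schmidt_snoc nth_append len)
  have m: "map (\<lambda>l. gram_schmidt n (xs @ [x]) ! l) [0..<k] = map (\<lambda>l. gram_schmidt n xs ! l) [0..<k]"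
    using snoc.prems by (intro map_cong refl pre) auto
  show ?case
  proof (cases "k < length xs")
    case True
    then show ?thesis unfolding m using snoc.IH by (simp add: pre nth_append)
  next
    case False
    then have k: "k = length xs" using snoc.prems by simp
    have "map (\<lambda>l. gram_schmidt n xs ! l) [0..<k] = gram_schmidt n xs"
      using map_nth[of "gram_schmidt n xs"] by (simp add: k len)
    then show ?thesis unfolding m by (simp add: k gram_schmidt_snoc nth_append len)
  qed
qed simp

lemma index_adjuster:
  assumes "set us \<subseteq> carrier_vec n" "a < n"
  shows "adjuster n w us \<in> carrier_vec n \<and>
    adjuster n w us $ a = (\<Sum>u\<leftarrow>us. - (w \<bullet>c u) / (u \<bullet>c u) * u $ a)"
  using assms by (induction us) auto

lemma scalar_prod_conjugate:
  assumes "x \<in> carrier_vec n" "y \<in> carrier_vec n"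
  shows "x \<bullet>c y = ip n (\<lambda>a. x $ a) (\<lambda>a. y $ a)"
  using assms by (simp add: scalar_prod_def ip_def lessThan_atLeast0)

text \<open>The projection coefficients are homogeneous of degree 0, so scaling all columns by
  \<open>1 / sqrt n\<close> just scales the result. The scaled columns are the ones whose Gram
  matrix converges.\<close>

lemma gram_schmidt_eq_orthogonalize:
  assumes G: "G \<in> carrier_mat n r" and n: "0 < n" and k: "k < r"
  shows "gram_schmidt n (cols G) ! k \<in> carrier_vec n \<and>
    orthogonalize n (scaled_column n G) k =
      (\<lambda>a. if a < n then gram_schmidt n (cols G) ! k $ a / complex_of_real (sqrt (real n)) else 0)"
  using k
proof (induction k rule: less_induct)
  case (less k)
  define g where "g = (\<lambda>l. gram_schmidt n (cols G) ! l)"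
  define s where "s = complex_of_real (sqrt (real n))"
  have s: "s \<noteq> 0" "s * cnj s = of_nat n" "cnj s = s"
    using n by (auto simp: s_def of_real_mult[symmetric] simp del: of_real_mult)
  have gl: "g l \<in> carrier_vec n" "orthogonalize n (scaled_column n G) l = (\<lambda>a. if a < n then g l $ a / s else 0)"
    if "l < k" for l using less.IH[OF that] less.prems that by (auto simp: g_def s_def)
  have len: "length (cols G) = r" using G by simp
  have ck: "cols G ! k = col G k" "col G k \<in> carrier_vec n" using G less.prems by auto
  have gk: "g k = adjuster n (col G k) (rev (map g [0..<k])) + col G k"
    unfolding g_def by (subst gram_schmidt_nth) (use less.prems len ck in auto)
  have us: "set (rev (map g [0..<k])) \<subseteq> carrier_vec n" using gl(1) by auto
  have adj: "adjuster n (col G k) (rev (map g [0..<k])) \<in> carrier_vec n"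
    using index_adjuster[OF us n] by blast
  have carr: "g k \<in> carrier_vec n" unfolding gk using adj ck by simp
  have ratio: "(col G k \<bullet>c g l) / (g l \<bullet>c g l) =
      ip n (scaled_column n G k) (orthogonalize n (scaled_column n G) l) /
      ip n (orthogonalize n (scaled_column n G) l) (orthogonalize n (scaled_column n G) l)" if l: "l < k" for l
  proof -
    have 1: "ip n (scaled_column n G k) (orthogonalize n (scaled_column n G) l) = (col G k \<bullet>c g l) / of_nat n"
      unfolding scalar_prod_conjugate[OF ck(2) gl(1)[OF l]] gl(2)[OF l] s(2)[symmetric]
      using less.prems G by (simp add: ip_def scaled_column_def s_def[symmetric] sum_divide_distrib)
    have 2: "ip n (orthogonalize n (scaled_column n G) l) (orthogonalize n (scaled_column n G) l) = (g l \<bullet>c g l) / of_nat n"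
      unfolding scalar_prod_conjugate[OF gl(1)[OF l] gl(1)[OF l]] gl(2)[OF l] s(2)[symmetric]
      by (simp add: ip_def sum_divide_distrib)
    show ?thesis unfolding 1 2 using n by simp
  qed
  have "orthogonalize n (scaled_column n G) k a = (if a < n then g k $ a / s else 0)" for a
  proof (cases "a < n")
    case True
    have "g k $ a = (\<Sum>u\<leftarrow>rev (map g [0..<k]). - (col G k \<bullet>c u) / (u \<bullet>c u) * u $ a) + col G k $ a"
      unfolding gk using index_adjuster[OF us True] ck adj True G by simp
    also have "(\<Sum>u\<leftarrow>rev (map g [0..<k]). - (col G k \<bullet>c u) / (u \<bullet>c u) * u $ a) =
        (\<Sum>l<k. - (col G k \<bullet>c g l) / (g l \<bullet>c g l) * g l $ a)"
      by (simp add: rev_map[symmetric] sum_list_rev interv_sum_list_conv_sum_set_nat lessThan_atLeast0 o_def)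
    finally have gka: "g k $ a = col G k $ a - (\<Sum>l<k. (col G k \<bullet>c g l) / (g l \<bullet>c g l) * g l $ a)"
      by (simp add: sum_negf)
    have "orthogonalize n (scaled_column n G) k a = scaled_column n G k a -
        (\<Sum>l<k. (col G k \<bullet>c g l) / (g l \<bullet>c g l) * (g l $ a / s))"
    proof -
      have "ip n (scaled_column n G k) (orthogonalize n (scaled_column n G) l) /
          ip n (orthogonalize n (scaled_column n G) l) (orthogonalize n (scaled_column n G) l) *
          orthogonalize n (scaled_column n G) l a = (col G k \<bullet>c g l) / (g l \<bullet>c g l) * (g l $ a / s)"
        if l: "l < k" for l
      proof -
        have "orthogonalize n (scaled_column n G) l a = g l $ a / s" using gl(2)[OF l] True by simp
        then show ?thesis by (simp only: ratio[OF l])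
      qed
      then show ?thesis by (subst orthogonalize.simps) simp
    qed
    also have "\<dots> = g k $ a / s"
      unfolding gka using True less.prems G
      by (simp add: scaled_column_def s_def[symmetric] diff_divide_distrib sum_divide_distrib)
    finally show ?thesis using True by simp
  next
    case False
    then show ?thesis by (subst orthogonalize.simps) (simp add: scaled_column_def gl(2))
  qed
  then show ?case using carr unfolding g_def s_def by auto
qed

text \<open>Normalization cancels the common factor \<open>1 / sqrt n\<close>.\<close>

lemma normalize_gram_schmidt_eq_orthonormalize:
  assumes G: "G \<in> carrier_mat n r" and n: "0 < n" and k: "k < r"
  shows "orthonormalize n (scaled_column n G) k =
      (\<lambda>a. if a < n then normalize_vec (gram_schmidt n (cols G) ! k) $ a else 0)"
proof -
  define g where "g = gram_schmidt n (cols G) ! k"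
  define s where "s = sqrt (real n)"
  have s: "s > 0" using n by (simp add: s_def)
  have g: "g \<in> carrier_vec n" "orthogonalize n (scaled_column n G) k = (\<lambda>a. if a < n then g $ a / complex_of_real s else 0)"
    using gram_schmidt_eq_orthogonalize[OF assms] by (auto simp: g_def s_def)
  have "nsq n (orthogonalize n (scaled_column n G) k) = (\<Sum>j<n. (cmod (g $ j))\<^sup>2) / s\<^sup>2"
    unfolding g(2) by (simp add: nsq_def norm_divide power_divide sum_divide_distrib)
  then have L: "sqrt (nsq n (orthogonalize n (scaled_column n G) k)) = L2_set (\<lambda>j. cmod (g $ j)) {..<n} / s"
    using s by (simp add: L2_set_def real_sqrt_divide)
  show ?thesis
    unfolding orthonormalize_def L unfolding g(2) normalize_vec_def g_def[symmetric]
    using g(1) s by (auto simp: fun_eq_iff)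
qed

text \<open>The Gram matrix of the scaled columns tends to the identity, so it is eventually
  positive definite and the columns are independent.\<close>

lemma eventually_full_rank:
  assumes G: "\<And>n. G n \<in> carrier_mat (N n) r"
    and gram: "\<And>i j. i < r \<Longrightarrow> j < r \<Longrightarrow>
      (\<lambda>n. ip (N n) (scaled_column (N n) (G n) i) (scaled_column (N n) (G n) j)) \<longlonglongrightarrow> (if i = j then 1 else 0)"
  shows "\<forall>\<^sub>F n in sequentially. vec_space.rank (N n) (G n) = r"
proof -
  have "\<forall>\<^sub>F n in sequentially. \<forall>c::nat \<Rightarrow> complex. (\<exists>j\<in>{..<r}. c j \<noteq> 0) \<longrightarrow>
    0 < Re (\<Sum>j\<in>{..<r}. \<Sum>k\<in>{..<r}. c j * cnj (c k) *
      ip (N n) (scaled_column (N n) (G n) j) (scaled_column (N n) (G n) k))"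
  proof (rule eventually_form_positive[where \<phi> = "\<lambda>_. 1"])
    fix j k assume "j \<in> {..<r}" "k \<in> {..<r}"
    then show "(\<lambda>n. ip (N n) (scaled_column (N n) (G n) j) (scaled_column (N n) (G n) k)) \<longlonglongrightarrow>
        (if j = k then complex_of_real 1 else 0)"
      using gram[of j k] by (cases "j = k") simp_all
  qed simp_all
  then show ?thesis
  proof eventually_elim
    case (elim n)
    have inj: "\<exists>a<N n. (\<Sum>j<r. G n $$ (a, j) * c j) \<noteq> 0" if c: "\<exists>j<r. c j \<noteq> 0" for c :: "nat \<Rightarrow> complex"
    proof (rule ccontr)
      assume neg: "\<not> (\<exists>a<N n. (\<Sum>j<r. G n $$ (a, j) * c j) \<noteq> 0)"
      have "lc r c (scaled_column (N n) (G n)) a = 0" for a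
      proof (cases "a < N n")
        case True
        then have "lc r c (scaled_column (N n) (G n)) a =
            (\<Sum>j<r. G n $$ (a, j) * c j) / complex_of_real (sqrt (real (N n)))"
          by (simp add: lc_def scaled_column_def sum_divide_distrib mult.commute)
        then show ?thesis using neg True by simp
      qed (simp add: lc_def scaled_column_def)
      then have "ip (N n) (lc r c (scaled_column (N n) (G n))) (lc r c (scaled_column (N n) (G n))) = 0"
        by (simp add: ip_def)
      then have "(\<Sum>j<r. \<Sum>k<r. c j * cnj (c k) *
          ip (N n) (scaled_column (N n) (G n) j) (scaled_column (N n) (G n) k)) = 0"
        unfolding ip_lc_left by (simp add: ip_lc_right sum_distrib_left mult.assoc)
      then show False using elim[rule_format, of c] c by auto
    qed
    interpret vec_space "TYPE(complex)" "N n" .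
    \<comment> \<open>Linear independence is stated for the set of columns, where a repetition would
      go unnoticed. Equal columns are excluded by the coefficients 1 at \<open>i\<close> and -1 at
      \<open>j\<close>.\<close>
    have dist: "distinct (cols (G n))"
    proof (rule ccontr)
      assume "\<not> distinct (cols (G n))"
      then obtain i j where ij: "i < r" "j < r" "i \<noteq> j" "col (G n) i = col (G n) j"
        using G[of n] by (auto simp: distinct_conv_nth)
      define c :: "nat \<Rightarrow> complex" where "c = (\<lambda>l. (if l = i then 1 else 0) - (if l = j then 1 else 0))"
      obtain a where a: "a < N n" "(\<Sum>l<r. G n $$ (a, l) * c l) \<noteq> 0"
      proof -
        have "\<exists>l<r. c l \<noteq> 0" using ij by (intro exI[of _ i]) (simp add: c_def)
        from inj[OF this] show ?thesis using that by blast
      qed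
      have "(\<Sum>l<r. G n $$ (a, l) * c l) = G n $$ (a, i) - G n $$ (a, j)"
        using ij by (simp add: c_def right_diff_distrib sum_subtractf if_distrib[where f = "(*) x" for x] cong: if_cong)
      moreover have "G n $$ (a, i) = G n $$ (a, j)"
      proof -
        have "col (G n) i $ a = col (G n) j $ a" using ij(4) by simp
        then show ?thesis using a G[of n] ij(1,2) by simp
      qed
      ultimately show False using a by simp
    qed
    have "lin_indpt (set (cols (G n)))"
    proof
      assume "lin_dep (set (cols (G n)))"
      then obtain v where v: "v \<in> carrier_vec r" "v \<noteq> 0\<^sub>v r" "G n *\<^sub>v v = 0\<^sub>v (N n)"
        using lin_depE[OF G _ dist] by blast
      have "\<exists>j<r. v $ j \<noteq> 0" using v(1,2) by (metis carrier_vecD eq_vecI index_zero_vec)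
      then obtain a where a: "a < N n" "(\<Sum>l<r. G n $$ (a, l) * v $ l) \<noteq> 0" using inj[of "\<lambda>j. v $ j"] by blast
      have "(G n *\<^sub>v v) $ a = (\<Sum>l<r. G n $$ (a, l) * v $ l)"
        using a G[of n] v(1) by (simp add: scalar_prod_def lessThan_atLeast0)
      then show False using a v(3) by simp
    qed
    then show ?case using lin_indpt_full_rank[OF G dist] by simp
  qed
qed

section \<open>The D-transform and the theorem\<close>

context spectral_limit
begin

lemma moment_sequence: "0 \<le> c \<Longrightarrow> moment_sequence mom c b"
  using mom_bounds b_nonneg by unfold_locales auto

text \<open>Almost every t lies in [0, b], where 1/(z^2 - t^2) is a geometric series with
  nonnegative terms; the summable moment series allows integration term by term.\<close>

lemma integral_resolvent:
  assumes "b < z"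
  shows "(\<integral>t. z / (z\<^sup>2 - t\<^sup>2) \<partial>\<mu>) = z * (\<Sum>k. mom k / z ^ (2 * k + 2))"
proof -
  have z: "z > 0" using assms b_nonneg by simp
  define f where "f = (\<lambda>k t. t ^ (2 * k) / z ^ (2 * k + 2) :: real)"
  have int: "integrable \<mu> (f k)" for k
    unfolding f_def by (intro integrable_divide integrable_pow)
  have intf: "(\<integral>t. f k t \<partial>\<mu>) = mom k / z ^ (2 * k + 2)" for k
    by (simp add: f_def mom_def)
  have norm_f: "norm (f k t) = f k t" for k t using z by (simp add: f_def)
  have geo: "(\<lambda>k. f k t) sums (1 / (z\<^sup>2 - t\<^sup>2))" if "0 \<le> t" "t \<le> b" for t
  proof -
    have t2: "t\<^sup>2 < z\<^sup>2" using that assms by (intro power_strict_mono) auto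
    have "(\<lambda>k. (t\<^sup>2 / z\<^sup>2) ^ k) sums (1 / (1 - t\<^sup>2 / z\<^sup>2))"
      using t2 z by (intro geometric_sums) (simp add: divide_less_eq)
    from sums_mult[OF this, of "1 / z\<^sup>2"]
    have "(\<lambda>k. 1 / z\<^sup>2 * (t\<^sup>2 / z\<^sup>2) ^ k) sums (1 / z\<^sup>2 * (1 / (1 - t\<^sup>2 / z\<^sup>2)))" .
    moreover have "1 / z\<^sup>2 * (t\<^sup>2 / z\<^sup>2) ^ k = f k t" for k
      by (simp add: f_def power_divide power_mult power_add power2_eq_square)
    moreover have "1 / z\<^sup>2 * (1 / (1 - t\<^sup>2 / z\<^sup>2)) = 1 / (z\<^sup>2 - t\<^sup>2)"
      using z t2 by (simp add: right_diff_distrib)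
    ultimately show ?thesis by simp
  qed
  have sm: "summable (\<lambda>k. mom k / z ^ (2 * k + 2))"
    using mom_bounds by (intro power_series_summable[OF _ _ b_nonneg assms, where C = 1]) auto
  have AEg: "AE t in \<mu>. (\<lambda>k. f k t) sums (1 / (z\<^sup>2 - t\<^sup>2))"
    using AE_nonneg AE_le by eventually_elim (rule geo)
  have s1: "AE t in \<mu>. summable (\<lambda>k. norm (f k t))"
    using AEg unfolding norm_f by eventually_elim (rule sums_summable)
  have s2: "summable (\<lambda>k. \<integral>t. norm (f k t) \<partial>\<mu>)"
    using sm by (simp only: norm_f intf)
  have "(\<lambda>k. \<integral>t. f k t \<partial>\<mu>) sums (\<integral>t. (\<Sum>k. f k t) \<partial>\<mu>)"
    by (rule sums_integral[OF int s1 s2])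
  then have "(\<Sum>k. mom k / z ^ (2 * k + 2)) = (\<integral>t. (\<Sum>k. f k t) \<partial>\<mu>)" by (simp add: intf sums_iff)
  also have "\<dots> = (\<integral>t. 1 / (z\<^sup>2 - t\<^sup>2) \<partial>\<mu>)"
  proof (rule integral_cong_AE)
    show "(\<lambda>t. \<Sum>k. f k t) \<in> borel_measurable \<mu>"
      using int by (intro borel_measurable_suminf borel_measurable_integrable)
    show "AE t in \<mu>. (\<Sum>k. f k t) = 1 / (z\<^sup>2 - t\<^sup>2)" using AEg by eventually_elim (simp add: sums_iff)
  qed (simp add: measurable_cong_sets[OF \<mu>(2) refl])
  finally have "z * (\<Sum>k. mom k / z ^ (2 * k + 2)) = (\<integral>t. z * (1 / (z\<^sup>2 - t\<^sup>2)) \<partial>\<mu>)"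
    by (simp only: integral_mult_right_zero)
  then show ?thesis by simp
qed

lemma D_transform_eq:
  assumes "0 \<le> c" "b < z"
  shows "D_transform c \<mu> z = moment_sequence.D mom c z"
proof -
  interpret moment_sequence mom c b by (rule moment_sequence[OF assms(1)])
  have z: "z > 0" using assms b_nonneg by simp
  show ?thesis
    unfolding D_transform_def integral_resolvent[OF assms(2)] alpha_def[symmetric] D_def beta_eq[OF assms(2)]
    using z by (simp add: field_simps power2_eq_square)
qed

lemma D_right_eq:
  assumes "0 \<le> c"
  shows "D_right c \<mu> b = moment_sequence.D_sup mom c b"
proof -
  interpret moment_sequence mom c b by (rule moment_sequence[OF assms])
  have "((\<lambda>z. ereal (D_transform c \<mu> z)) \<longlongrightarrow> D_sup) (at_right b)"
  proof (rule Lim_transform_eventually[OF D_right_limit])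
    show "\<forall>\<^sub>F z in at_right b. ereal (D z) = ereal (D_transform c \<mu> z)"
      using eventually_at_right_less[of b] by eventually_elim (simp add: D_transform_eq[OF assms])
  qed
  then show ?thesis unfolding D_right_def by (intro tendsto_Lim) auto
qed

lemma less_theta_bar_iff:
  assumes c: "0 \<le> c" and \<theta>: "0 < \<theta>"
  shows "theta_bar c \<mu> b < \<theta> \<longleftrightarrow> ereal (1 / \<theta>\<^sup>2) < moment_sequence.D_sup mom c b"
proof -
  interpret moment_sequence mom c b by (rule moment_sequence[OF c])
  have pos: "0 < D_sup" using D_less_sup[of "b + 1"] D_pos[of "b + 1"] by (meson ereal_less(2) less_add_one less_trans)
  show ?thesis
  proof (cases "D_sup = \<infinity>")
    \<comment> \<open>Here \<open>theta_bar\<close> is 0 and both sides hold.\<close>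
    case True
    then show ?thesis using \<theta> by (simp add: theta_bar_def D_right_eq[OF c])
  next
    case False
    then obtain s where s: "D_sup = ereal s" "s > 0" using pos by (cases D_sup) auto
    have "s powr (- 1 / 2) = 1 / sqrt s"
      using s(2) by (simp add: powr_minus_divide powr_half_sqrt)
    then have "theta_bar c \<mu> b = 1 / sqrt s" using False s by (simp add: theta_bar_def D_right_eq[OF c])
    moreover have "1 / sqrt s < \<theta> \<longleftrightarrow> (1 / sqrt s)\<^sup>2 < \<theta>\<^sup>2"
      using \<theta> s(2) by (auto intro: power_strict_mono power2_less_imp_less simp del: power_one_over)
    moreover have "(1 / sqrt s)\<^sup>2 < \<theta>\<^sup>2 \<longleftrightarrow> 1 / \<theta>\<^sup>2 < s"
      using \<theta> s(2) by (simp add: power_divide field_simps)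
    ultimately show ?thesis using s(1) by simp
  qed
qed

text \<open>The value \<open>D_sup\<close> at \<open>b\<close> exceeds all values to its right, so
  strict decrease, and with it injectivity, extends to the closed half-line even if
  \<open>D_sup\<close> is infinite.\<close>

lemma D_inverse_eq:
  assumes c: "0 \<le> c" and z: "b < z" "moment_sequence.D mom c z = y"
  shows "D_inverse c \<mu> b y = z"
proof -
  interpret moment_sequence mom c b by (rule moment_sequence[OF c])
  define f where "f = (\<lambda>z. if z = b then D_right c \<mu> b else ereal (D_transform c \<mu> z))"
  have fb: "f b = D_sup" by (simp add: f_def D_right_eq[OF c])
  have fz: "f z = ereal (D z)" if "b < z" for z using that by (simp add: f_def D_transform_eq[OF c])
  have dec: "f z' < f z" if "b \<le> z" "z < z'" for z z'
  proof (cases "z = b")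
    case True
    then show ?thesis using that D_less_sup[of z'] by (simp add: fb fz)
  next
    case False
    then show ?thesis using that D_strict_decreasing[of z z'] by (simp add: fz)
  qed
  have "inj_on f {b..}"
  proof (rule linorder_inj_onI)
    fix x y assume "x < y" "x \<in> {b..}"
    then show "f x \<noteq> f y" using dec[of x y] by auto
  qed auto
  then have "the_inv_into {b..} f (ereal y) = z"
    using z by (intro the_inv_into_f_eq) (auto simp: fz)
  then show ?thesis by (simp add: D_inverse_def f_def)
qed

end

text \<open>Shifts the index from \<open>1..r\<close> to \<open>0..r-1\<close>.\<close>

definition vec_fun :: "nat \<Rightarrow> (nat \<Rightarrow> complex vec) \<Rightarrow> nat \<Rightarrow> nat \<Rightarrow> complex" where
  "vec_fun n u i = (\<lambda>a. if a < n then u (Suc i) $ a else 0)"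

section \<open>From the matrix models to the limits of the singular values\<close>

lemma entries_add_perturbation:
  assumes "X \<in> carrier_mat n m"
  shows "entries (X + perturbation n m r \<theta> u v) =
    rank_update (entries X) r (\<lambda>i. \<theta> (Suc i)) (vec_fun n u) (vec_fun m v)"
proof (intro ext)
  fix j k
  have "(\<Sum>i=1..r. complex_of_real (\<theta> i) * (u i $ j) * cnj (v i $ k)) =
      (\<Sum>i<r. complex_of_real (\<theta> (Suc i)) * (u (Suc i) $ j) * cnj (v (Suc i) $ k))"
    by (rule sum.reindex_bij_witness[of _ Suc "\<lambda>i. i - 1"]) auto
  then show "entries (X + perturbation n m r \<theta> u v) j k =
      rank_update (entries X) r (\<lambda>i. \<theta> (Suc i)) (vec_fun n u) (vec_fun m v) j k"
    using assms by (auto simp: entries_def rank_update_def vec_fun_def perturbation_def)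
qed

lemma iid_model_vec_fun:
  assumes "iid_model n r G u" "G \<in> carrier_mat n r" "i < r"
  shows "vec_fun n u i = scaled_column n G i"
  using assms by (auto simp: iid_model_def vec_fun_def scaled_column_def fun_eq_iff)

lemma orthonormalized_model_vec_fun:
  assumes "orthonormalized_model n r G u" "G \<in> carrier_mat n r" "0 < n" "vec_space.rank n G = r" "i < r"
  shows "vec_fun n u i = orthonormalize n (scaled_column n G) i"
  using assms unfolding normalize_gram_schmidt_eq_orthonormalize[OF assms(2,3,5)]
  by (auto simp: orthonormalized_model_def vec_fun_def)

lemma model_asymptotic_combination:
  assumes G: "\<And>n. G n \<in> carrier_mat (N n) r" and N: "\<And>n. n \<le> N n"
    and gram: "\<And>i j. i < r \<Longrightarrow> j < r \<Longrightarrow>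
      (\<lambda>n. ip (N n) (scaled_column (N n) (G n) i) (scaled_column (N n) (G n) j)) \<longlonglongrightarrow> (if i = j then 1 else 0)"
    and model: "(\<forall>n. iid_model (N n) r (G n) (u n)) \<or> (\<forall>n. orthonormalized_model (N n) r (G n) (u n))"
  shows "asymptotic_combination r (\<lambda>n. scaled_column (N n) (G n)) (\<lambda>n. vec_fun (N n) (u n))"
  using model
proof
  assume "\<forall>n. iid_model (N n) r (G n) (u n)"
  then show ?thesis
    by (intro asymptotic_combination_refl always_eventually allI impI iid_model_vec_fun) (simp_all add: G)
next
  assume om: "\<forall>n. orthonormalized_model (N n) r (G n) (u n)"
  \<comment> \<open>Convergence of the Gram matrices gives full rank for all large n, so the vectors
    that the model leaves unspecified occur at most finitely often.\<close>
  have full: "\<forall>\<^sub>F n in sequentially. vec_space.rank (N n) (G n) = r"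
    by (intro eventually_full_rank G gram)
  have "\<forall>\<^sub>F n in sequentially. \<forall>k<r. vec_fun (N n) (u n) k = orthonormalize (N n) (scaled_column (N n) (G n)) k"
    using full eventually_gt_at_top[of 0]
  proof eventually_elim
    case (elim n)
    then show ?case using om G N[of n] by (intro allI impI orthonormalized_model_vec_fun) auto
  qed
  then show ?thesis by (intro orthonormalize_combination[where N = N] gram)
qed

text \<open>Since \<open>D\<close> decreases strictly, comparing z with the solution \<rho> of
  \<theta>^2 D(\<rho>) = 1 is the same as comparing \<theta>^2 D(z) with 1. If there is no solution,
  every z above b is an upper bound and the bulk supplies the lower one. For \<open>i\<close> from
  \<open>r\<close> on the condition on the remaining \<theta> is empty.\<close>

lemma (in spectral_limit) singular_value_limit:
  fixes u v :: "nat \<Rightarrow> nat \<Rightarrow> nat \<Rightarrow> complex" and Yt :: "nat \<Rightarrow> complex mat" and \<theta> :: "nat \<Rightarrow> real"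
  assumes cf: "converging_forms m (\<lambda>n. entries (Y n)) u v r mom c b"
    and \<theta>: "\<And>i j. i \<le> j \<Longrightarrow> j < r \<Longrightarrow> \<theta> j \<le> \<theta> i" "\<And>i. i < r \<Longrightarrow> 0 < \<theta> i"
    and Yt: "\<And>n. Yt n \<in> carrier_mat n (m n)" "\<And>n. entries (Yt n) = rank_update (entries (Y n)) r \<theta> (u n) (v n)"
  shows "(\<lambda>n. singular_value (Yt n) (Suc i)) \<longlonglongrightarrow>
    (if i < r \<and> theta_bar c \<mu> b < \<theta> i then D_inverse c \<mu> b (1 / (\<theta> i)\<^sup>2) else b)"
proof -
  interpret C: converging_forms m "\<lambda>n. entries (Y n)" u v r mom c b by (rule cf)
  have D: "C.alpha z * (1 + C.beta z) = C.D z" for z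
    by (simp add: C.D_def)
  have sq_mono: "(\<theta> j)\<^sup>2 \<le> (\<theta> i)\<^sup>2" if "i \<le> j" "j < r" for i j
    using \<theta>(1)[OF that] \<theta>(2)[OF that(2)] by (intro power_mono) auto
  have upper: "\<forall>\<^sub>F n in sequentially. singular_value (Yt n) (Suc i) \<le> z"
    if z: "b < z'" "z' < z" and D1: "i < r \<Longrightarrow> (\<theta> i)\<^sup>2 * C.D z' < 1" for z z'
  proof -
    have lt: "(\<theta> j)\<^sup>2 * (C.alpha z' * (1 + C.beta z')) < 1" if "i \<le> j" "j < r" for j
    proof -
      have "(\<theta> j)\<^sup>2 * C.D z' \<le> (\<theta> i)\<^sup>2 * C.D z'"
        using C.D_pos[OF z(1)] sq_mono[OF that] by (intro mult_right_mono) auto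
      then show ?thesis using D1 that unfolding D by simp
    qed
    have "\<forall>\<^sub>F n in sequentially. \<forall>A\<in>carrier_mat n (m n).
        entries A = rank_update (entries (Y n)) r \<theta> (u n) (v n) \<longrightarrow> singular_value A (Suc i) \<le> z"
      by (intro C.eventually_singular_value_le[OF z] lt)
    then show ?thesis by eventually_elim (use Yt in auto)
  qed
  show ?thesis
  proof (cases "i < r \<and> theta_bar c \<mu> b < \<theta> i")
    case True
    then have i: "i < r" and "ereal (1 / (\<theta> i)\<^sup>2) < C.D_sup"
      using less_theta_bar_iff[OF C.c_nonneg \<theta>(2)] by auto
    moreover have \<theta>i: "(\<theta> i)\<^sup>2 > 0" using \<theta>(2)[OF i] by simp
    ultimately obtain \<rho> where \<rho>: "b < \<rho>" "C.D \<rho> = 1 / (\<theta> i)\<^sup>2"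
      using C.D_attains[of "1 / (\<theta> i)\<^sup>2"] by auto
    have "(\<lambda>n. singular_value (Yt n) (Suc i)) \<longlonglongrightarrow> \<rho>"
    proof (rule order_tendstoI)
      fix z assume z: "z < \<rho>"
      define z' where "z' = (max z b + \<rho>) / 2"
      have z': "b < z'" "z < z'" "z' < \<rho>" using z \<rho>(1) by (auto simp: z'_def)
      have gt: "1 < (\<theta> j)\<^sup>2 * (C.alpha z' * (1 + C.beta z'))" if j: "j \<le> i" for j
      proof -
        have "1 = (\<theta> i)\<^sup>2 * C.D \<rho>" using \<rho>(2) \<theta>i by simp
        also have "\<dots> < (\<theta> i)\<^sup>2 * C.D z'"
          using C.D_strict_decreasing[OF z'(1,3)] \<theta>i by (intro mult_strict_left_mono) auto
        also have "\<dots> \<le> (\<theta> j)\<^sup>2 * C.D z'"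
          using C.D_pos[OF z'(1)] sq_mono[OF j i] by (intro mult_right_mono) auto
        finally show ?thesis unfolding D .
      qed
      have "\<forall>\<^sub>F n in sequentially. \<forall>A\<in>carrier_mat n (m n).
          entries A = rank_update (entries (Y n)) r \<theta> (u n) (v n) \<longrightarrow> z' < singular_value A (Suc i)"
        by (intro C.eventually_singular_value_gt[OF z'(1) i] gt)
      then show "\<forall>\<^sub>F n in sequentially. z < singular_value (Yt n) (Suc i)"
        by eventually_elim (use Yt z'(2) in force)
    next
      fix z assume z: "\<rho> < z"
      \<comment> \<open>Two intermediate points are needed: the form is already negative at
        \<open>z'\<close>, the gap up to \<open>z''\<close> absorbs the truncation remainder, and
        \<open>z'' < z\<close> makes the final bound strict.\<close>
      define z' where "z' = (3 * \<rho> + z) / 4"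
      define z'' where "z'' = (\<rho> + z) / 2"
      have z': "\<rho> < z'" "z' < z''" "z'' < z" using z by (auto simp: z'_def z''_def)
      have "(\<theta> i)\<^sup>2 * C.D z' < (\<theta> i)\<^sup>2 * C.D \<rho>"
        using C.D_strict_decreasing[OF \<rho>(1) z'(1)] \<theta>i by (intro mult_strict_left_mono) auto
      also have "\<dots> = 1" using \<rho>(2) \<theta>i by simp
      finally have "\<forall>\<^sub>F n in sequentially. singular_value (Yt n) (Suc i) \<le> z''"
        using \<rho>(1) z' by (intro upper[of z' z'']) auto
      then show "\<forall>\<^sub>F n in sequentially. singular_value (Yt n) (Suc i) < z"
        by eventually_elim (use z' in simp)
    qed
    moreover have "D_inverse c \<mu> b (1 / (\<theta> i)\<^sup>2) = \<rho>"
      by (rule D_inverse_eq[OF C.c_nonneg \<rho>])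
    ultimately show ?thesis using True by simp
  next
    case False
    have "(\<lambda>n. singular_value (Yt n) (Suc i)) \<longlonglongrightarrow> b"
    proof (rule order_tendstoI)
      fix z assume "z < b"
      from eventually_updated_singular_value_gt[OF this, of r \<theta> i]
      show "\<forall>\<^sub>F n in sequentially. z < singular_value (Yt n) (Suc i)"
        by eventually_elim (use Yt in blast)
    next
      fix z assume z: "b < z"
      define z' where "z' = (3 * b + z) / 4"
      define z'' where "z'' = (b + z) / 2"
      have z': "b < z'" "z' < z''" "z'' < z" using z by (auto simp: z'_def z''_def)
      have "(\<theta> i)\<^sup>2 * C.D z' < 1" if i: "i < r"
      proof -
        have "C.D_sup \<le> ereal (1 / (\<theta> i)\<^sup>2)"
          using False i less_theta_bar_iff[OF C.c_nonneg \<theta>(2)[OF i]] by auto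
        with C.D_less_sup[OF z'(1)] have "ereal (C.D z') < ereal (1 / (\<theta> i)\<^sup>2)" by (rule less_le_trans)
        then show ?thesis using \<theta>(2)[OF i] by (simp add: field_simps)
      qed
      then have "\<forall>\<^sub>F n in sequentially. singular_value (Yt n) (Suc i) \<le> z''"
        using z' by (intro upper[of z' z'']) auto
      then show "\<forall>\<^sub>F n in sequentially. singular_value (Yt n) (Suc i) < z"
        by eventually_elim (use z' in simp)
    qed
    then show ?thesis unfolding if_not_P[OF False] .
  qed
qed

lemma (in random_setting_limit) AE_limits:
  "AE \<omega> in M. \<forall>k. \<forall>i<r. \<forall>j<r.
     (\<lambda>n. ip n ((S n \<omega> ^^ k) (ug n \<omega> i)) (ug n \<omega> j)) \<longlonglongrightarrow>
        (if i = j then complex_of_real (\<integral>t. t ^ (2 * k) \<partial>\<mu>) else 0) \<and>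
     (\<lambda>n. ip n ((S n \<omega> ^^ k) (mulv (Z n \<omega>) (m n) (vg n \<omega> i))) (mulv (Z n \<omega>) (m n) (vg n \<omega> j))) \<longlonglongrightarrow>
        (if i = j then complex_of_real (c * (\<integral>t. t ^ (2 * Suc k) \<partial>\<mu>)) else 0) \<and>
     (\<lambda>n. ip n ((S n \<omega> ^^ k) (mulv (Z n \<omega>) (m n) (vg n \<omega> i))) (ug n \<omega> j)) \<longlonglongrightarrow> 0 \<and>
     (\<lambda>n. ip (m n) (vg n \<omega> i) (vg n \<omega> j)) \<longlonglongrightarrow> (if i = j then 1 else 0)"
proof -
  have fin: "AE \<omega> in M. \<forall>i<r. P i \<omega>" if "\<And>i. i < r \<Longrightarrow> AE \<omega> in M. P i \<omega>" for P :: "nat \<Rightarrow> 'w \<Rightarrow> bool"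
    by (subst AE_all_countable) (intro allI AE_impI that)
  show ?thesis
    by (subst AE_all_countable) (intro allI fin AE_conjI uu_limit vv_limit vu_limit v_orthonormal_limit)
qed

lemma (in spectral_limit) converging_formsI:
  fixes w w' u v :: "nat \<Rightarrow> nat \<Rightarrow> nat \<Rightarrow> complex"
  assumes c: "0 \<le> c"
    and u: "asymptotic_combination r w u" "\<And>n i. u n i \<in> vecs n"
    and v: "asymptotic_combination r w' v"
    and lim: "\<And>k i j. i < r \<Longrightarrow> j < r \<Longrightarrow> (\<lambda>n. ip n ((gram (entries (Y n)) n (m n) ^^ k) (w n i)) (w n j)) \<longlonglongrightarrow>
        (if i = j then complex_of_real (mom k) else 0)"
      "\<And>k i j. i < r \<Longrightarrow> j < r \<Longrightarrow> (\<lambda>n. ip n ((gram (entries (Y n)) n (m n) ^^ k) (mulv (entries (Y n)) (m n) (w' n i)))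
          (mulv (entries (Y n)) (m n) (w' n j))) \<longlonglongrightarrow>
        (if i = j then complex_of_real (c * mom (Suc k)) else 0)"
      "\<And>k i j. i < r \<Longrightarrow> j < r \<Longrightarrow>
        (\<lambda>n. ip n ((gram (entries (Y n)) n (m n) ^^ k) (mulv (entries (Y n)) (m n) (w' n i))) (w n j)) \<longlonglongrightarrow> 0"
      "\<And>i j. i < r \<Longrightarrow> j < r \<Longrightarrow> (\<lambda>n. ip (m n) (w' n i) (w' n j)) \<longlonglongrightarrow> (if i = j then 1 else 0)"
  shows "converging_forms m (\<lambda>n. entries (Y n)) u v r mom c b"
proof
  fix k i j assume ij: "i < r" "j < r"
  note lin = gram_pow_lc mulv_lc ip_lc_left ip_lc_right
  show "(\<lambda>n. ip n ((gram (entries (Y n)) n (m n) ^^ k) (u n i)) (u n j)) \<longlonglongrightarrow>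
      (if i = j then complex_of_real (mom k) else 0)"
    by (rule asymptotic_combination_limit[OF u(1) u(1), where
        B = "\<lambda>n x y. ip n ((gram (entries (Y n)) n (m n) ^^ k) x) y" and \<beta> = "\<lambda>i j. if i = j then complex_of_real (mom k) else 0"])
      (simp_all only: lin lim ij)
  show "(\<lambda>n. ip n ((gram (entries (Y n)) n (m n) ^^ k) (mulv (entries (Y n)) (m n) (v n i))) (mulv (entries (Y n)) (m n) (v n j))) \<longlonglongrightarrow>
      (if i = j then complex_of_real (c * mom (Suc k)) else 0)"
    by (rule asymptotic_combination_limit[OF v v, where
        B = "\<lambda>n x y. ip n ((gram (entries (Y n)) n (m n) ^^ k) (mulv (entries (Y n)) (m n) x)) (mulv (entries (Y n)) (m n) y)"
        and \<beta> = "\<lambda>i j. if i = j then complex_of_real (c * mom (Suc k)) else 0"])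
      (simp_all only: lin lim ij)
  show "(\<lambda>n. ip n ((gram (entries (Y n)) n (m n) ^^ k) (mulv (entries (Y n)) (m n) (v n i))) (u n j)) \<longlonglongrightarrow> 0"
    by (rule asymptotic_combination_limit[OF v u(1), where
        B = "\<lambda>n x y. ip n ((gram (entries (Y n)) n (m n) ^^ k) (mulv (entries (Y n)) (m n) x)) y" and \<beta> = "\<lambda>i j. 0"])
      (simp_all only: lin lim ij)
  show "(\<lambda>n. ip (m n) (v n i) (v n j)) \<longlonglongrightarrow> (if i = j then 1 else 0)"
    by (rule asymptotic_combination_limit[OF v v, where
        B = "\<lambda>n x y. ip (m n) x y" and \<beta> = "\<lambda>i j. if i = j then 1 else 0"])
      (simp_all only: lin lim ij)
qed (use Y entries_kern u(2) norm_bound mom_bounds b_nonneg c in auto)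

theorem theorem2p8:
  fixes M :: "'w measure"
    and K :: "complex set"
    and m :: "nat \<Rightarrow> nat" and c b :: real
    and X Gu Gv :: "nat \<Rightarrow> 'w \<Rightarrow> complex mat"
    and Xt :: "nat \<Rightarrow> 'w \<Rightarrow> complex mat"
    and \<mu>X :: "real measure" and \<nu> :: "complex measure"
    and r :: nat and \<theta> :: "nat \<Rightarrow> real"
    and u v :: "nat \<Rightarrow> 'w \<Rightarrow> nat \<Rightarrow> complex vec"
  assumes M: "prob_space M"
    and K: "K = \<real> \<or> K = UNIV"
    and m: "\<And>n. n \<le> m n"
    and c: "c \<in> {0..1}" "(\<lambda>n. real n / real (m n)) \<longlonglongrightarrow> c"
    and X: "\<And>n. random_matrix M K n (m n) (X n)"
    and muX: "prob_space \<mu>X" "sets \<mu>X = sets borel" "compact (measure_support \<mu>X)"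
    and muX_conv: "AE \<omega> in M. weak_conv_m (\<lambda>n. singular_value_distribution (X n \<omega>)) \<mu>X"
    and b: "b = Sup (measure_support \<mu>X)"
    and largest: "AE \<omega> in M. (\<lambda>n. singular_value (X n \<omega>) 1) \<longlonglongrightarrow> b"
    and r: "r \<ge> 1"
    and \<theta>: "\<And>i j. 1 \<le> i \<Longrightarrow> i \<le> j \<Longrightarrow> j \<le> r \<Longrightarrow> \<theta> j \<le> \<theta> i" "\<theta> r > 0"
    and nu: "prob_space \<nu>" "sets \<nu> = sets borel" "AE x in \<nu>. x \<in> K"
    and nu_mean: "integrable \<nu> (\<lambda>x. x)" "(\<integral>x. x \<partial>\<nu>) = 0"
    and nu_var: "(\<integral>x. (cmod x)\<^sup>2 \<partial>\<nu>) = 1"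
    and nu_LSI: "log_sobolev_on K \<nu>"
    and Gu: "\<And>n. random_matrix M K n r (Gu n)"
    and Gv: "\<And>n. random_matrix M K (m n) r (Gv n)"
    and G_iid: "\<And>n. iid_matrix_pair M \<nu> n (m n) r (Gu n) (Gv n)"
    and indep: "indep_families M m r X Gu Gv"
    and model:
      "(\<forall>n. \<forall>\<omega>\<in>space M. iid_model n r (Gu n \<omega>) (u n \<omega>) \<and>
                         iid_model (m n) r (Gv n \<omega>) (v n \<omega>)) \<or>
       (\<forall>n. \<forall>\<omega>\<in>space M. orthonormalized_model n r (Gu n \<omega>) (u n \<omega>) \<and>
                         orthonormalized_model (m n) r (Gv n \<omega>) (v n \<omega>))"
    and Xt: "\<And>n \<omega>. \<omega> \<in> space M \<Longrightarrow>
               Xt n \<omega> = X n \<omega> + perturbation n (m n) r \<theta> (u n \<omega>) (v n \<omega>)"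
  shows "(\<forall>i\<in>{1..r}. AE \<omega> in M. (\<lambda>n. singular_value (Xt n \<omega>) i) \<longlonglongrightarrow>
           (if \<theta> i > theta_bar c \<mu>X b then D_inverse c \<mu>X b (1 / (\<theta> i)\<^sup>2) else b)) \<and>
         (\<forall>i>r. AE \<omega> in M. (\<lambda>n. singular_value (Xt n \<omega>) i) \<longlonglongrightarrow> b)"
proof -
  interpret prob_space M by (rule M)
  \<comment> \<open>A function that is not integrable has integral 0, so variance one already forces
    integrability.\<close>
  have var_int: "integrable \<nu> (\<lambda>x. (cmod x)\<^sup>2)"
    using nu_var not_integrable_integral_eq by fastforce
  interpret N: unit_law \<nu>
    using nu nu_mean nu_var log_sobolev_on_eighth_moment[OF nu K nu_LSI var_int]
    by (intro unit_law.intro unit_law_axioms.intro) auto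
  have spectral: "AE \<omega> in M. spectral_limit m (\<lambda>n. X n \<omega>) \<mu>X b"
    using muX_conv largest AE_space
  proof eventually_elim
    case (elim \<omega>)
    have "X n \<omega> \<in> carrier_mat n (m n)" for n
      using X[of n] elim(3) by (auto simp: random_matrix_def)
    then show ?case by (rule spectral_limit.intro[OF _ elim(1) muX b elim(2)])
  qed
  interpret R: random_setting_limit M \<nu> K m r X Gu Gv \<mu>X b c
    using m r X Gu Gv G_iid indep spectral c(2) by unfold_locales auto
  define \<theta>' where "\<theta>' = (\<lambda>i. \<theta> (Suc i))"
  have \<theta>': "\<And>i j. i \<le> j \<Longrightarrow> j < r \<Longrightarrow> \<theta>' j \<le> \<theta>' i" "\<And>i. i < r \<Longrightarrow> 0 < \<theta>' i"
  proof -
    show "i \<le> j \<Longrightarrow> j < r \<Longrightarrow> \<theta>' j \<le> \<theta>' i" for i j unfolding \<theta>'_def by (intro \<theta>(1)) auto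
    show "0 < \<theta>' i" if "i < r" for i
      using \<theta>(1)[of "Suc i" r] \<theta>(2) that unfolding \<theta>'_def by simp
  qed
  have main: "AE \<omega> in M. (\<lambda>n. singular_value (Xt n \<omega>) (Suc i)) \<longlonglongrightarrow>
      (if i < r \<and> theta_bar c \<mu>X b < \<theta>' i then D_inverse c \<mu>X b (1 / (\<theta>' i)\<^sup>2) else b)" for i
    using spectral R.AE_limits AE_space
  proof eventually_elim
    case (elim \<omega>)
    interpret L: spectral_limit m "\<lambda>n. X n \<omega>" \<mu>X b by (rule elim(1))
    note lim = elim(2)[rule_format]
    have car: "Gu n \<omega> \<in> carrier_mat n r" "Gv n \<omega> \<in> carrier_mat (m n) r" "X n \<omega> \<in> carrier_mat n (m n)" for n
      using Gu[of n] Gv[of n] X[of n] elim(3) by (auto simp: random_matrix_def)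
    \<comment> \<open>This is the case \<open>k = 0\<close> of the left forms, where the moment is
      the total mass 1.\<close>
    have gram_u: "(\<lambda>n. ip n (scaled_column n (Gu n \<omega>) i) (scaled_column n (Gu n \<omega>) j)) \<longlonglongrightarrow> (if i = j then 1 else 0)"
      if "i < r" "j < r" for i j
      using lim[of i j 0] that L.mom_bounds(3) by (auto simp: L.mom_def)
    have gram_v: "(\<lambda>n. ip (m n) (scaled_column (m n) (Gv n \<omega>) i) (scaled_column (m n) (Gv n \<omega>) j)) \<longlonglongrightarrow> (if i = j then 1 else 0)"
      if "i < r" "j < r" for i j
      using lim[of i j 0] that by blast
    have model_u: "(\<forall>n. iid_model n r (Gu n \<omega>) (u n \<omega>)) \<or> (\<forall>n. orthonormalized_model n r (Gu n \<omega>) (u n \<omega>))"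
      and model_v: "(\<forall>n. iid_model (m n) r (Gv n \<omega>) (v n \<omega>)) \<or> (\<forall>n. orthonormalized_model (m n) r (Gv n \<omega>) (v n \<omega>))"
      using model elim(3) by blast+
    have cu: "asymptotic_combination r (\<lambda>n. scaled_column n (Gu n \<omega>)) (\<lambda>n. vec_fun n (u n \<omega>))"
      by (rule model_asymptotic_combination[where N = "\<lambda>n. n", OF car(1) _ gram_u model_u]) auto
    have cv: "asymptotic_combination r (\<lambda>n. scaled_column (m n) (Gv n \<omega>)) (\<lambda>n. vec_fun (m n) (v n \<omega>))"
      by (rule model_asymptotic_combination[where N = m, OF car(2) m gram_v model_v])
    have "converging_forms m (\<lambda>n. entries (X n \<omega>)) (\<lambda>n. vec_fun n (u n \<omega>)) (\<lambda>n. vec_fun (m n) (v n \<omega>)) r L.mom c b"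
    proof (rule L.converging_formsI[OF _ cu _ cv])
      show "0 \<le> c" using c(1) by simp
      show "vec_fun n (u n \<omega>) i \<in> vecs n" for n i by (simp add: vec_fun_def vecs_def)
    qed (use lim in \<open>simp_all only: L.mom_def\<close>)
    then show ?case
    proof (rule L.singular_value_limit[OF _ \<theta>'])
      fix n
      show "Xt n \<omega> \<in> carrier_mat n (m n)"
        using car(3)[of n] by (simp add: Xt[OF elim(3)] perturbation_def)
      show "entries (Xt n \<omega>) =
          rank_update (entries (X n \<omega>)) r \<theta>' (vec_fun n (u n \<omega>)) (vec_fun (m n) (v n \<omega>))"
        unfolding Xt[OF elim(3)] \<theta>'_def by (rule entries_add_perturbation[OF car(3)])
    qed
  qed
  show ?thesis
  proof (intro conjI ballI allI impI)
    fix i assume "i \<in> {1..r}"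
    then obtain j where i: "i = Suc j" and "j < r" by (cases i) auto
    then show "AE \<omega> in M. (\<lambda>n. singular_value (Xt n \<omega>) i) \<longlonglongrightarrow>
        (if \<theta> i > theta_bar c \<mu>X b then D_inverse c \<mu>X b (1 / (\<theta> i)\<^sup>2) else b)"
      using main[of j] unfolding \<theta>'_def i by (simp split del: if_split)
  next
    fix i assume "i > r"
    then obtain j where "i = Suc j" "\<not> j < r" by (cases i) auto
    then show "AE \<omega> in M. (\<lambda>n. singular_value (Xt n \<omega>) i) \<longlonglongrightarrow> b"
      using main[of j] by simp
  qed
qed

end
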